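(* Let $a,b,b'$ be parameters and put $$\mathbf x=\frac{-x}{1-x},\qquad \mathbf y=\frac{-y}{1-y},\qquad \mathbf x\mathbf y=\frac{xy}{(1-x)(1-y)}.$$ (i) The following inclusions of spaces of solutions hold: $$(1-y)^{b'}(1-x)^{b}S_2(a,b,b',a,a;x,y)\ \supset\ S_1\left(b,0,b',a;\ \frac{-x}{1-x},\ \frac{xy}{(1-x)(1-y)}\right)\ \supset\ S\left(b,b',a;\ \frac{xy}{(1-x)(1-y)}\right),$$ $$(1-y)^{b'}(1-x)^{b}S_2(a,b,b',a,a;x,y)\ \supset\ S_1\left(b',b,0,a;\ \frac{xy}{(1-x)(1-y)},\ \frac{-y}{1-y}\right)\ \supset\ S\left(b,b',a;\ \frac{xy}{(1-x)(1-y)}\right).$$ (ii) Moreover, the collection of solutions $(1-y)^{b'}(1-x)^{b}S_2(a,b,b',a,a;x,y)$ is spanned by $f_1$, $f_2$ and $S\left(b,b',a;\frac{xy}{(1-x)(1-y)}\right)$, where $$f_1=\int_0^{\mathbf x}s^{b'-a}(1-s)^{a-b-1}(\mathbf x\mathbf y-s)^{-b'}ds,\qquad f_2=(\mathbf x\mathbf y)^{-a+1}\int_0^{\mathbf x}s^{b'-1}(1-s)^{-b}(\mathbf x\mathbf y-s)^{a-b'-1}ds .$$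
   Context: $E(a,b,c;t)$ is the Gauss hypergeometric equation $[D_t(c-1+D_t)-t(a+D_t)(b+D_t)]u=0$, $D_t=t\,d/dt$; $S(a,b,c;t)$ is the collection of its solutions. $E_1(a,b,b',c;x,y)$ is Appell's system $P_1z=Q_1z=R_1z=0$, where $P_1=x(1-x)\partial_{xx}+y(1-x)\partial_{xy}+(c-(a+b+1)x)\partial_x-by\,\partial_y-ab$, $Q_1=y(1-y)\partial_{yy}+x(1-y)\partial_{yx}+(c-(a+b'+1)y)\partial_y-b'x\,\partial_x-ab'$, $R_1=(x-y)\partial_{xy}-b'\partial_x+b\,\partial_y$; $S_1(a,b,b',c;x,y)$ is the collection of its solutions. $E_2(a,b,b',c,c';x,y)$ is Appell's system $P_2z=Q_2z=0$, where, with $D=x\,\partial/\partial x$, $D'=y\,\partial/\partial y$, $P_2=D(c-1+D)-x(a+D+D')(b+D)$, $Q_2=D'(c'-1+D')-y(a+D+D')(b'+D')$; $S_2(a,b,b',c,c';x,y)$ is the collection of its solutions. When the variables of $S$ or $S_1$ are replaced by functions of $(x,y)$, this means the solutions composed with the corresponding map; a function in front of $S_2$ means that all solutions are multiplied by it.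
   Formalization: In (ii) it is assumed that a ≠ 1 (for a = 1 the integrals f1 and f2 coincide up to branches and cannot span the rank-4 space), that b'-a is not a negative integer and that b' is not 0 or a negative integer (otherwise f1 or f2 is undefined, even by continuation in the exponent). *)

theory Defs
  imports "HOL-Analysis.Analysis" "HOL-Library.Function_Algebras" "HOL-Library.Nonpos_Ints"
begin

text \<open>
  Solutions of the differential systems are multivalued in the large.  They are represented here by
  their germs at a point \<open>p\<close>: a collection of solutions at \<open>p\<close> is a set of total functions which
  satisfy the equations on some neighbourhood of \<open>p\<close> and are arbitrary elsewhere.
\<close>

definition holomorphic2_on :: "(complex \<times> complex \<Rightarrow> complex) \<Rightarrow> (complex \<times> complex) set \<Rightarrow> bool"
  where "holomorphic2_on f U \<longleftrightarrow>
    (\<forall>p\<in>U. \<exists>A B. (f has_derivative (\<lambda>(h, k). A * h + B * k)) (at p))"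

definition dx :: "(complex \<times> complex \<Rightarrow> complex) \<Rightarrow> complex \<times> complex \<Rightarrow> complex"
  where "dx f = (\<lambda>(x, y). deriv (\<lambda>s. f (s, y)) x)"

definition dy :: "(complex \<times> complex \<Rightarrow> complex) \<Rightarrow> complex \<times> complex \<Rightarrow> complex"
  where "dy f = (\<lambda>(x, y). deriv (\<lambda>s. f (x, s)) y)"

definition Dt :: "(complex \<Rightarrow> complex) \<Rightarrow> complex \<Rightarrow> complex"
  where "Dt u = (\<lambda>t. t * deriv u t)"

definition Dx :: "(complex \<times> complex \<Rightarrow> complex) \<Rightarrow> complex \<times> complex \<Rightarrow> complex"
  where "Dx f = (\<lambda>(x, y). x * dx f (x, y))"

definition Dy :: "(complex \<times> complex \<Rightarrow> complex) \<Rightarrow> complex \<times> complex \<Rightarrow> complex"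
  where "Dy f = (\<lambda>(x, y). y * dy f (x, y))"

text \<open>\<open>shift c D\<close> is the operator \<open>c + D\<close>.\<close>

definition shift :: "complex \<Rightarrow> (('a \<Rightarrow> complex) \<Rightarrow> 'a \<Rightarrow> complex) \<Rightarrow> ('a \<Rightarrow> complex) \<Rightarrow> 'a \<Rightarrow> complex"
  where "shift c D f = (\<lambda>q. c * f q + D f q)"

definition gauss_op :: "complex \<Rightarrow> complex \<Rightarrow> complex \<Rightarrow> (complex \<Rightarrow> complex) \<Rightarrow> complex \<Rightarrow> complex"
  where "gauss_op a b c u = (\<lambda>t. Dt (shift (c - 1) Dt u) t - t * shift a Dt (shift b Dt u) t)"

definition S :: "complex \<Rightarrow> complex \<Rightarrow> complex \<Rightarrow> complex \<Rightarrow> (complex \<Rightarrow> complex) set"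
  where "S a b c t0 = {u. \<exists>U. open U \<and> t0 \<in> U \<and> u holomorphic_on U \<and> (\<forall>t\<in>U. gauss_op a b c u t = 0)}"

definition P1 :: "complex \<Rightarrow> complex \<Rightarrow> complex \<Rightarrow> complex \<Rightarrow>
    (complex \<times> complex \<Rightarrow> complex) \<Rightarrow> complex \<times> complex \<Rightarrow> complex"
  where "P1 a b b' c z = (\<lambda>(x, y).
    x * (1 - x) * dx (dx z) (x, y) + y * (1 - x) * dx (dy z) (x, y)
    + (c - (a + b + 1) * x) * dx z (x, y) - b * y * dy z (x, y) - a * b * z (x, y))"

definition Q1 :: "complex \<Rightarrow> complex \<Rightarrow> complex \<Rightarrow> complex \<Rightarrow>
    (complex \<times> complex \<Rightarrow> complex) \<Rightarrow> complex \<times> complex \<Rightarrow> complex"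
  where "Q1 a b b' c z = (\<lambda>(x, y).
    y * (1 - y) * dy (dy z) (x, y) + x * (1 - y) * dy (dx z) (x, y)
    + (c - (a + b' + 1) * y) * dy z (x, y) - b' * x * dx z (x, y) - a * b' * z (x, y))"

definition R1 :: "complex \<Rightarrow> complex \<Rightarrow> complex \<Rightarrow> complex \<Rightarrow>
    (complex \<times> complex \<Rightarrow> complex) \<Rightarrow> complex \<times> complex \<Rightarrow> complex"
  where "R1 a b b' c z = (\<lambda>(x, y).
    (x - y) * dx (dy z) (x, y) - b' * dx z (x, y) + b * dy z (x, y))"

definition S1 :: "complex \<Rightarrow> complex \<Rightarrow> complex \<Rightarrow> complex \<Rightarrow> complex \<times> complex \<Rightarrow>
    (complex \<times> complex \<Rightarrow> complex) set"
  where "S1 a b b' c p = {z. \<exists>U. open U \<and> p \<in> U \<and> holomorphic2_on z U \<and>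
    (\<forall>q\<in>U. P1 a b b' c z q = 0 \<and> Q1 a b b' c z q = 0 \<and> R1 a b b' c z q = 0)}"

definition P2 :: "complex \<Rightarrow> complex \<Rightarrow> complex \<Rightarrow> complex \<Rightarrow> complex \<Rightarrow>
    (complex \<times> complex \<Rightarrow> complex) \<Rightarrow> complex \<times> complex \<Rightarrow> complex"
  where "P2 a b b' c c' z = (\<lambda>q. Dx (shift (c - 1) Dx z) q
    - fst q * shift a (\<lambda>f r. Dx f r + Dy f r) (shift b Dx z) q)"

definition Q2 :: "complex \<Rightarrow> complex \<Rightarrow> complex \<Rightarrow> complex \<Rightarrow> complex \<Rightarrow>
    (complex \<times> complex \<Rightarrow> complex) \<Rightarrow> complex \<times> complex \<Rightarrow> complex"
  where "Q2 a b b' c c' z = (\<lambda>q. Dy (shift (c' - 1) Dy z) q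
    - snd q * shift a (\<lambda>f r. Dx f r + Dy f r) (shift b' Dy z) q)"

definition S2 :: "complex \<Rightarrow> complex \<Rightarrow> complex \<Rightarrow> complex \<Rightarrow> complex \<Rightarrow> complex \<times> complex \<Rightarrow>
    (complex \<times> complex \<Rightarrow> complex) set"
  where "S2 a b b' c c' p = {z. \<exists>U. open U \<and> p \<in> U \<and> holomorphic2_on z U \<and>
    (\<forall>q\<in>U. P2 a b b' c c' z q = 0 \<and> Q2 a b b' c c' z q = 0)}"

text \<open>
  \<open>pullback \<phi> A p\<close> consists of the germs at \<open>p\<close> of the elements of \<open>A\<close> (germs at \<open>\<phi> p\<close>) composed
  with \<open>\<phi>\<close>; \<open>multiples g A p\<close> consists of the germs at \<open>p\<close> of the elements of \<open>A\<close> multiplied by \<open>g\<close>.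
\<close>

definition pullback :: "(complex \<times> complex \<Rightarrow> 'a) \<Rightarrow> ('a \<Rightarrow> complex) set \<Rightarrow> complex \<times> complex \<Rightarrow>
    (complex \<times> complex \<Rightarrow> complex) set"
  where "pullback \<phi> A p = {w. \<exists>v\<in>A. \<forall>\<^sub>F q in nhds p. w q = v (\<phi> q)}"

definition multiples :: "(complex \<times> complex \<Rightarrow> complex) \<Rightarrow> (complex \<times> complex \<Rightarrow> complex) set \<Rightarrow>
    complex \<times> complex \<Rightarrow> (complex \<times> complex \<Rightarrow> complex) set"
  where "multiples g A p = {w. \<exists>z\<in>A. \<forall>\<^sub>F q in nhds p. w q = g q * z q}"

text \<open>A branch near \<open>p\<close> of the logarithm of \<open>g\<close>; then \<open>exp (e * L q)\<close> is a branch of \<open>g\<close> to the power \<open>e\<close>.\<close>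

definition log_branch :: "(complex \<times> complex \<Rightarrow> complex) \<Rightarrow> (complex \<times> complex \<Rightarrow> complex) \<Rightarrow>
    complex \<times> complex \<Rightarrow> bool"
  where "log_branch L g p \<longleftrightarrow>
    (\<exists>U. open U \<and> p \<in> U \<and> continuous_on U L \<and> (\<forall>q\<in>U. exp (L q) = g q))"

definition X :: "complex \<times> complex \<Rightarrow> complex" where "X = (\<lambda>(x, y). - x / (1 - x))"
definition Y :: "complex \<times> complex \<Rightarrow> complex" where "Y = (\<lambda>(x, y). - y / (1 - y))"
definition XY :: "complex \<times> complex \<Rightarrow> complex" where "XY = (\<lambda>(x, y). x * y / ((1 - x) * (1 - y)))"

text \<open>
  \<open>reg_integral \<gamma> l0 l1 l2 \<mu> \<beta> \<delta>\<close> is the integral of \<open>s\<^sup>\<mu> (1 - s)\<^sup>\<beta> (T - s)\<^sup>\<delta> ds\<close> along \<open>\<gamma>\<close>, a path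
  issuing from \<open>0\<close>, where \<open>l0 t\<close>, \<open>l1 t\<close>, \<open>l2 t\<close> are the logarithms of \<open>s\<close>, \<open>1 - s\<close>, \<open>T - s\<close> at
  \<open>s = \<gamma> t\<close>.  It is the ordinary integral when it converges at \<open>s = 0\<close>, that is for \<open>Re \<mu> > - 1\<close>;
  otherwise it is defined, as usual for hypergeometric integrals, by analytic continuation in the
  exponent \<open>\<mu>\<close> of \<open>s\<close>, which is possible as long as \<open>\<mu>\<close> is not a negative integer.
\<close>

definition reg_integral :: "(real \<Rightarrow> complex) \<Rightarrow> (real \<Rightarrow> complex) \<Rightarrow> (real \<Rightarrow> complex) \<Rightarrow> (real \<Rightarrow> complex) \<Rightarrow>
    complex \<Rightarrow> complex \<Rightarrow> complex \<Rightarrow> complex"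
  where "reg_integral \<gamma> l0 l1 l2 \<mu> \<beta> \<delta> = (THE v. \<exists>G.
    G holomorphic_on {\<nu>. \<nu> + 1 \<notin> \<int>\<^sub>\<le>\<^sub>0} \<and>
    (\<forall>\<nu>. Re \<nu> > - 1 \<longrightarrow>
      ((\<lambda>t. exp (\<nu> * l0 t + \<beta> * l1 t + \<delta> * l2 t) * vector_derivative \<gamma> (at t)) has_integral G \<nu>) {0..1}) \<and>
    v = G \<mu>)"

text \<open>
  \<open>F\<close> is, near \<open>p\<close>, a branch of the function \<open>\<integral> s\<^sup>\<mu> (1 - s)\<^sup>\<beta> (XY - s)\<^sup>\<delta> ds\<close> with \<open>s\<close> running from
  \<open>0\<close> to \<open>X\<close>.  The path from \<open>0\<close> to \<open>X p\<close> is arbitrary up to homotopy in the complement of the branch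
  points \<open>0\<close>, \<open>1\<close>, \<open>XY p\<close> (the equations for \<open>exp\<close> force it to avoid them); it is carried along to
  the nearby points \<open>q\<close> as the path \<open>X q * \<tau> t\<close>, and the logarithms are continuous in \<open>(q, t)\<close>.
\<close>

definition integral_branch :: "complex \<Rightarrow> complex \<Rightarrow> complex \<Rightarrow> (complex \<times> complex \<Rightarrow> complex) \<Rightarrow>
    complex \<times> complex \<Rightarrow> bool"
  where "integral_branch \<mu> \<beta> \<delta> F p \<longleftrightarrow> (\<exists>U \<tau> l0 l1 l2.
    open U \<and> p \<in> U \<and>
    \<tau> C1_differentiable_on {0..1} \<and> \<tau> 0 = 0 \<and> \<tau> 1 = 1 \<and> vector_derivative \<tau> (at 0) \<noteq> 0 \<and>
    continuous_on (U \<times> {0<..1}) (\<lambda>(q, t). l0 q t) \<and>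
    continuous_on (U \<times> {0..1}) (\<lambda>(q, t). l1 q t) \<and>
    continuous_on (U \<times> {0..1}) (\<lambda>(q, t). l2 q t) \<and>
    (\<forall>q\<in>U. \<forall>t\<in>{0<..1}. exp (l0 q t) = X q * \<tau> t) \<and>
    (\<forall>q\<in>U. \<forall>t\<in>{0..1}. exp (l1 q t) = 1 - X q * \<tau> t) \<and>
    (\<forall>q\<in>U. \<forall>t\<in>{0..1}. exp (l2 q t) = XY q - X q * \<tau> t) \<and>
    (\<forall>q\<in>U. F q = reg_integral (\<lambda>t. X q * \<tau> t) (l0 q) (l1 q) (l2 q) \<mu> \<beta> \<delta>))"

end

theory Submission
  imports Defs "HOL-Complex_Analysis.Complex_Analysis"
begin

text \<open>
  Write \<open>w = (1 - y)^b' (1 - x)^b z\<close>, \<open>T = XY\<close>, and let \<open>\<theta> = x (1 - x) d/dx\<close>, \<open>\<theta>' = y (1 - y) d/dy\<close>. These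
  fields commute, and \<open>\<theta> X = X\<close>, \<open>\<theta>' X = 0\<close>, \<open>\<theta> Y = 0\<close>, \<open>\<theta>' Y = Y\<close>, \<open>\<theta> T = \<theta>' T = T\<close>. In terms of \<open>w\<close> the system
  \<open>E\<^sub>2\<close> with \<open>c = c' = a\<close> reads
    \<open>(\<theta> (a - 1 + \<theta>) - X (b + \<theta>) (\<theta> - \<theta>') - T (b + \<theta>) (b' + \<theta>')) w = 0\<close>
  together with its mirror image under \<open>x \<leftrightarrow> y\<close>, \<open>b \<leftrightarrow> b'\<close> (lemma \<open>gauged_equations\<close>).

  Part (i). In the variables \<open>(X, T)\<close> one has \<open>\<theta>' = T d/dT\<close> and \<open>\<theta> - \<theta>' = X d/dX\<close>, and both equations become
  combinations of \<open>P\<^sub>1\<close>, \<open>Q\<^sub>1\<close>, \<open>R\<^sub>1\<close> for the parameters \<open>(b, 0, b', a)\<close>. The coefficients are polynomials,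
  so the inclusion holds also at points with \<open>x = 0\<close>, \<open>y = 0\<close> or \<open>x + y = 1\<close>.
  On functions of \<open>T\<close> alone \<open>P\<^sub>1\<close> and \<open>R\<^sub>1\<close> vanish and \<open>Q\<^sub>1\<close> is the Gauss equation.

  Part (ii). Let \<open>\<phi> = \<theta> w - \<theta>' w\<close>, let \<open>D = \<theta> - X (b + \<theta>)\<close> and \<open>D' = \<theta>' - Y (b' + \<theta>')\<close> be the conjugates of
  \<open>x d/dx\<close> and \<open>y d/dy\<close>, and \<open>M = a - 1 + D + D'\<close>. The system is \<open>M \<theta> w = D D' w = M \<theta>' w\<close>. Hence
  \<open>M \<phi> = 0\<close>, and the operator identity \<open>D D' (\<theta> - \<theta>') = \<theta>' (M \<theta> - D D') - \<theta> (M \<theta>' - D D')\<close> gives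
  \<open>D D' \<phi> = 0\<close>. So \<open>(1 - a) \<phi> = D \<phi> + D' \<phi>\<close>, where \<open>D \<phi>\<close> is annihilated by \<open>D'\<close> and an eigenfunction of \<open>D\<close> for
  \<open>1 - a\<close>, and likewise for \<open>D' \<phi>\<close> with \<open>D\<close> and \<open>D'\<close> exchanged (lemma \<open>difference_splits\<close>). Each of the two first order systems has a
  one-dimensional space of local solutions. For the integrals \<open>f\<^sub>1\<close> and \<open>f\<^sub>2\<close> the function \<open>\<phi>\<close> is \<open>X\<close> times the
  integrand at the end point \<open>s = X\<close> (for \<open>f\<^sub>2\<close> with the factor \<open>T^(1-a)\<close>), and it spans the first, respectively
  the second of them. As \<open>a \<noteq> 1\<close>, suitable multiples of \<open>f\<^sub>1\<close> and \<open>f\<^sub>2\<close> can be subtracted from \<open>w\<close> so that \<open>\<phi>\<close>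
  becomes \<open>0\<close>; then \<open>w\<close> is locally a function of \<open>T\<close>, and it solves the Gauss equation
  (lemma \<open>remainder_is_pullback\<close>).

  It remains to see that \<open>f\<^sub>1\<close> and \<open>f\<^sub>2\<close> are solutions. Integration by parts expresses the integral with the exponent
  \<open>\<nu>\<close> at \<open>s = 0\<close> by integrals with the exponent \<open>\<nu> + 1\<close>; this recursion is the analytic continuation, and by
  it all derivatives and contiguity relations follow from those in the range \<open>Re \<nu> > 0\<close>, where the integrand
  extends continuously to \<open>s = 0\<close>. The equations for \<open>f\<^sub>1\<close> then express that a total derivative integrates to its
  boundary term (lemma \<open>euler_solves\<close>). Multiplication by \<open>T^(1-a)\<close> turns solutions for the
  parameters \<open>(2 - a, b - a + 1, b' - a + 1)\<close> into solutions for \<open>(a, b, b')\<close> (lemma \<open>power_T_mult\<close>), and this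
  reduces \<open>f\<^sub>2\<close> to an integral of the first kind.
\<close>

section \<open>Holomorphic functions of two variables\<close>

lemma deriv_eq_circle_integral:
  assumes "f holomorphic_on V" "cball x0 r \<subseteq> V" "x \<in> ball x0 r"
  shows "deriv f x = 1 / (2 * of_real pi * \<i>) * integral {0..1} (\<lambda>s.
           f (circlepath x0 r s) / (circlepath x0 r s - x)^2 * (2 * pi * \<i> * r * exp (2 * of_real pi * \<i> * s)))"
proof -
  have "(f has_field_derivative (1 / (2 * of_real pi * \<i>) * contour_integral (circlepath x0 r) (\<lambda>u. f u / (u-x)^2))) (at x)"
    using assms by (intro Cauchy_derivative_integral_circlepath(2) holomorphic_on_imp_continuous_on)
      (auto elim!: holomorphic_on_subset simp: subset_iff)
  then have "deriv f x = 1 / (2 * of_real pi * \<i>) * contour_integral (circlepath x0 r) (\<lambda>u. f u / (u-x)^2)"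
    by (rule DERIV_imp_deriv)
  also have "contour_integral (circlepath x0 r) (\<lambda>u. f u / (u-x)^2) = integral {0..1} (\<lambda>s.
           f (circlepath x0 r s) / (circlepath x0 r s - x)^2 * (2 * pi * \<i> * r * exp (2 * of_real pi * \<i> * s)))"
    unfolding contour_integral_integral
    by (rule integral_cong) (simp add: vector_derivative_circlepath)
  finally show ?thesis .
qed

text \<open>
  By Cauchy's formula the derivative is an integral over a circle whose integrand is jointly continuous in all
  variables.
\<close>

lemma continuous_on_deriv_param:
  fixes f :: "complex \<Rightarrow> 'b::t2_space \<Rightarrow> complex"
  assumes V: "open V"
    and cont: "continuous_on (V \<times> W) (\<lambda>(x, t). f x t)"
    and hol: "\<And>t. t \<in> W \<Longrightarrow> (\<lambda>x. f x t) holomorphic_on V"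
  shows "continuous_on (V \<times> W) (\<lambda>(x, t). deriv (\<lambda>s. f s t) x)"
  unfolding continuous_on_eq_continuous_within
proof clarify
  fix x0 t0 assume x0: "x0 \<in> V" and t0: "t0 \<in> W"
  obtain r where r: "r > 0" "cball x0 r \<subseteq> V"
    using V x0 open_contains_cball by blast
  let ?c = "circlepath x0 r"
  have c_in: "?c s \<in> V" if "s \<in> {0..1}" for s
    using r path_image_circlepath_nonneg[of r x0] that unfolding path_image_def
    by (metis imageI less_eq_real_def sphere_cball subset_iff)
  have c_ne: "?c s \<noteq> x" if "s \<in> {0..1}" "x \<in> ball x0 r" for s x
  proof -
    have "?c s \<in> sphere x0 r"
      using r path_image_circlepath_nonneg[of r x0] that unfolding path_image_def
      by (metis imageI less_eq_real_def)
    with that show ?thesis by auto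
  qed
  have cc: "continuous_on UNIV ?c"
    unfolding circlepath by (intro continuous_intros)
  have "continuous_on ((ball x0 r \<times> W) \<times> cbox 0 (1::real)) (\<lambda>(q, s).
      f (?c s) (snd q) / (?c s - fst q)^2 * (2 * pi * \<i> * r * exp (2 * of_real pi * \<i> * s)))"
  proof -
    have "continuous_on ((ball x0 r \<times> W) \<times> cbox 0 (1::real)) (\<lambda>z. f (?c (snd z)) (snd (fst z)))"
      by (rule continuous_on_compose2[OF cont, where f="\<lambda>z. (?c (snd z), snd (fst z))", simplified])
        (use c_in in \<open>auto intro!: continuous_intros continuous_on_compose2[OF cc]\<close>)
    moreover have "continuous_on ((ball x0 r \<times> W) \<times> cbox 0 (1::real)) (\<lambda>z. ?c (snd z))"
      by (auto intro!: continuous_intros continuous_on_compose2[OF cc])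
    moreover have "(?c (snd z) - fst (fst z))^2 \<noteq> 0" if "z \<in> (ball x0 r \<times> W) \<times> cbox 0 (1::real)" for z
      using c_ne[of "snd z" "fst (fst z)"] that by auto
    ultimately show ?thesis
      unfolding split_beta
      by (intro continuous_on_mult continuous_on_divide continuous_on_power continuous_on_diff
            continuous_on_exp continuous_on_of_real continuous_on_const continuous_on_fst
            continuous_on_snd continuous_on_id) auto
  qed
  from integral_continuous_on_param[OF this]
  have "continuous_on (ball x0 r \<times> W) (\<lambda>q. 1 / (2 * of_real pi * \<i>) * integral (cbox 0 1) (\<lambda>s.
      f (?c s) (snd q) / (?c s - fst q)^2 * (2 * pi * \<i> * r * exp (2 * of_real pi * \<i> * s))))"
    by (intro continuous_intros)
  then have "continuous_on (ball x0 r \<times> W) (\<lambda>(x, t). deriv (\<lambda>s. f s t) x)"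
    by (rule continuous_on_eq) (use deriv_eq_circle_integral[OF hol r(2)] in auto)
  then have "continuous (at (x0, t0) within ball x0 r \<times> W) (\<lambda>(x, t). deriv (\<lambda>s. f s t) x)"
    using r t0 unfolding continuous_on_eq_continuous_within by force
  moreover have "at (x0, t0) within ball x0 r \<times> W = at (x0, t0) within V \<times> W"
    by (rule at_within_nhd[of _ "ball x0 r \<times> UNIV"]) (use r in \<open>auto simp: open_Times subset_iff\<close>)
  ultimately show "continuous (at (x0, t0) within V \<times> W) (\<lambda>(x, t). deriv (\<lambda>s. f s t) x)"
    by simp
qed

text \<open>
  Leibniz rule in which the continuity of the derivative of the integrand comes for free from Cauchy's formula.
  It serves for integrals depending holomorphically on a point as well as on an exponent.
\<close>

lemma has_field_derivative_integral_param:
  fixes f :: "complex \<Rightarrow> real \<Rightarrow> complex"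
  assumes V: "open V" "x0 \<in> V"
    and cont: "continuous_on (V \<times> {a..b}) (\<lambda>(x, t). f x t)"
    and hol: "\<And>t. t \<in> {a..b} \<Longrightarrow> (\<lambda>x. f x t) holomorphic_on V"
  shows "((\<lambda>x. integral {a..b} (f x)) has_field_derivative
           integral {a..b} (\<lambda>t. deriv (\<lambda>s. f s t) x0)) (at x0)"
proof -
  obtain r where r: "r > 0" "ball x0 r \<subseteq> V"
    using V open_contains_ball by blast
  have "((\<lambda>x. integral (cbox a b) (f x)) has_field_derivative
           integral (cbox a b) (\<lambda>t. deriv (\<lambda>s. f s t) x0)) (at x0 within ball x0 r)"
  proof (rule leibniz_rule_field_derivative)
    fix x t assume x: "x \<in> ball x0 r" and t: "t \<in> cbox a b"
    show "((\<lambda>x. f x t) has_field_derivative deriv (\<lambda>s. f s t) x) (at x within ball x0 r)"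
      using hol[of t] t x r V
      by (intro holomorphic_derivI[of _ V]) auto
  next
    fix x assume x: "x \<in> ball x0 r"
    have "continuous_on {a..b} (f x)"
      by (rule continuous_on_compose2[OF cont, of _ "\<lambda>t. (x, t)", simplified])
        (use x r in \<open>auto intro!: continuous_intros\<close>)
    then show "f x integrable_on cbox a b"
      by (metis cbox_interval integrable_continuous_interval)
  next
    show "continuous_on (ball x0 r \<times> cbox a b) (\<lambda>(x, t). deriv (\<lambda>s. f s t) x)"
      by (rule continuous_on_subset[OF continuous_on_deriv_param[OF V(1) cont]]) (use hol r in auto)
  qed (use r in auto)
  then show ?thesis
    using r by (simp add: at_within_open[of x0 "ball x0 r"])
qed

lemma open_slices:
  fixes U :: "(complex \<times> complex) set"
  assumes "open U"
  shows "open {x. (x, y) \<in> U}" "open {y. (x, y) \<in> U}"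
proof -
  have "open ((\<lambda>x. (x, y)) -` U)" "open ((\<lambda>y. (x, y)) -` U)"
    by (intro open_vimage assms continuous_intros)+
  then show "open {x. (x, y) \<in> U}" "open {y. (x, y) \<in> U}"
    by (simp_all add: vimage_def)
qed

text \<open>
  The total complex derivative with named partial derivatives. Unlike \<open>dx\<close> and \<open>dy\<close> it obeys the rules of
  calculus without side conditions of differentiability, so computations are done with it and only read off in
  terms of \<open>dx\<close> and \<open>dy\<close>.
\<close>

definition has_partials :: "(complex \<times> complex \<Rightarrow> complex) \<Rightarrow> complex \<Rightarrow> complex \<Rightarrow> complex \<times> complex \<Rightarrow> bool"
  where "has_partials f A B q \<longleftrightarrow> (f has_derivative (\<lambda>(h, k). A * h + B * k)) (at q)"

lemma partials_slices:
  assumes "has_partials f A B q"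
  shows "((\<lambda>s. f (s, snd q)) has_field_derivative A) (at (fst q))"
    and "((\<lambda>s. f (fst q, s)) has_field_derivative B) (at (snd q))"
proof -
  have f: "(f has_derivative (\<lambda>(h, k). A * h + B * k)) (at (fst q, snd q))"
    using assms by (simp add: has_partials_def)
  have "((\<lambda>s. f (s, snd q)) has_derivative (\<lambda>h. (\<lambda>(h, k). A * h + B * k) (h, 0))) (at (fst q))"
    by (rule has_derivative_compose[where g=f and f="\<lambda>s. (s, snd q)", OF _ f]) (auto intro!: derivative_eq_intros)
  then show "((\<lambda>s. f (s, snd q)) has_field_derivative A) (at (fst q))"
    by (simp add: has_field_derivative_def)
  have "((\<lambda>s. f (fst q, s)) has_derivative (\<lambda>h. (\<lambda>(h, k). A * h + B * k) (0, h))) (at (snd q))"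
    by (rule has_derivative_compose[where g=f and f="\<lambda>s. (fst q, s)", OF _ f]) (auto intro!: derivative_eq_intros)
  then show "((\<lambda>s. f (fst q, s)) has_field_derivative B) (at (snd q))"
    by (simp add: has_field_derivative_def)
qed

lemma partials_dx: "has_partials f A B q \<Longrightarrow> dx f q = A"
  using partials_slices(1)[of f A B q] by (cases q) (simp add: dx_def DERIV_imp_deriv)

lemma partials_dy: "has_partials f A B q \<Longrightarrow> dy f q = B"
  using partials_slices(2)[of f A B q] by (cases q) (simp add: dy_def DERIV_imp_deriv)

lemma holomorphic2_on_iff_partials: "holomorphic2_on f U \<longleftrightarrow> (\<forall>q\<in>U. \<exists>A B. has_partials f A B q)"
  by (simp add: holomorphic2_on_def has_partials_def)

lemma holomorphic2_onI: "(\<And>q. q \<in> U \<Longrightarrow> has_partials f (A q) (B q) q) \<Longrightarrow> holomorphic2_on f U"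
  unfolding holomorphic2_on_iff_partials by blast

lemma holomorphic2_on_partials:
  "holomorphic2_on f U \<Longrightarrow> q \<in> U \<Longrightarrow> has_partials f (dx f q) (dy f q) q"
  unfolding holomorphic2_on_iff_partials by (metis partials_dx partials_dy)

lemma holomorphic2_on_subset: "holomorphic2_on f U \<Longrightarrow> V \<subseteq> U \<Longrightarrow> holomorphic2_on f V"
  unfolding holomorphic2_on_def by blast

lemma holomorphic2_on_continuous: "holomorphic2_on f U \<Longrightarrow> continuous_on U f"
  unfolding holomorphic2_on_def
  by (meson continuous_at_imp_continuous_on has_derivative_continuous)

lemma holomorphic2_on_slices:
  assumes "holomorphic2_on f U"
  shows "(\<lambda>x. f (x, y)) holomorphic_on {x. (x, y) \<in> U}" "(\<lambda>y. f (x, y)) holomorphic_on {y. (x, y) \<in> U}"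
  using partials_slices[OF holomorphic2_on_partials[OF assms]]
  by (auto simp: holomorphic_on_def field_differentiable_def intro: has_field_derivative_at_within)
   (metis fst_conv snd_conv has_field_derivative_at_within)+

lemma continuous_on_swap_pair:
  fixes f :: "complex \<times> complex \<Rightarrow> complex"
  shows "continuous_on U f \<Longrightarrow> continuous_on (prod.swap ` U) (\<lambda>q. f (prod.swap q))"
  by (rule continuous_on_compose2[of U f]) (auto simp: prod.swap_def intro!: continuous_intros)

lemma osgood_dx_continuous:
  assumes U: "open U" and cont: "continuous_on U f"
    and hol: "\<And>y. (\<lambda>x. f (x, y)) holomorphic_on {x. (x, y) \<in> U}"
  shows "continuous_on U (dx f)"
  unfolding continuous_on_eq_continuous_at[OF U]
proof
  fix q assume "q \<in> U"
  then obtain A B where AB: "open A" "open B" "q \<in> A \<times> B" "A \<times> B \<subseteq> U"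
    using U open_prod_elim by blast
  have "continuous_on (A \<times> B) (\<lambda>(x, t). deriv (\<lambda>s. f (s, t)) x)"
    by (rule continuous_on_deriv_param)
      (use AB cont in \<open>auto elim: continuous_on_subset intro!: holomorphic_on_subset[OF hol]\<close>)
  then have "continuous_on (A \<times> B) (dx f)"
    by (simp add: dx_def)
  then show "isCont (dx f) q"
    using AB by (auto simp: continuous_on_eq_continuous_at open_Times)
qed

lemma dy_swap: "dy f = (\<lambda>q. dx (\<lambda>r. f (prod.swap r)) (prod.swap q))"
  by (auto simp: dx_def dy_def fun_eq_iff)

lemma open_swap_image:
  fixes U :: "(complex \<times> complex) set"
  shows "open U \<Longrightarrow> open (prod.swap ` U)"
proof -
  assume U: "open U"
  have "prod.swap ` U = (\<lambda>q. (snd q, fst q)) -` U" by force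
  moreover have "open ((\<lambda>q. (snd q, fst q)) -` U)"
    by (intro open_vimage U continuous_intros)
  ultimately show ?thesis by simp
qed

lemma osgood_dy_continuous:
  assumes U: "open U" and cont: "continuous_on U f"
    and hol: "\<And>x. (\<lambda>y. f (x, y)) holomorphic_on {y. (x, y) \<in> U}"
  shows "continuous_on U (dy f)"
proof -
  have "continuous_on (prod.swap ` U) (dx (\<lambda>r. f (prod.swap r)))"
  proof (rule osgood_dx_continuous)
    fix y
    have "{x. (x, y) \<in> prod.swap ` U} = {x. (y, x) \<in> U}" by force
    then show "(\<lambda>x. f (prod.swap (x, y))) holomorphic_on {x. (x, y) \<in> prod.swap ` U}"
      using hol[of y] by simp
  qed (use U cont in \<open>auto intro: open_swap_image continuous_on_swap_pair\<close>)
  then show ?thesis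
    unfolding dy_swap
    by (rule continuous_on_compose2) (auto simp: prod.swap_def intro!: continuous_intros)
qed

text \<open>
  Osgood's lemma: continuity and holomorphy in each variable give continuous partial derivatives, hence total
  differentiability.
\<close>

lemma osgood_partials:
  assumes U: "open U" and cont: "continuous_on U f"
    and holx: "\<And>y. (\<lambda>x. f (x, y)) holomorphic_on {x. (x, y) \<in> U}"
    and holy: "\<And>x. (\<lambda>y. f (x, y)) holomorphic_on {y. (x, y) \<in> U}"
    and q: "q \<in> U"
  shows "has_partials f (dx f q) (dy f q) q"
proof -
  obtain x y where [simp]: "q = (x, y)" by (cases q)
  obtain r s where rs: "r > 0" "s > 0" "ball x r \<times> ball y s \<subseteq> U"
  proof -
    obtain A B where AB: "open A" "open B" "q \<in> A \<times> B" "A \<times> B \<subseteq> U"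
      using U q open_prod_elim by blast
    then obtain r s where "r > 0" "ball x r \<subseteq> A" "s > 0" "ball y s \<subseteq> B"
      by (metis \<open>q = (x, y)\<close> SigmaE2 open_contains_ball)
    with AB that show ?thesis by blast
  qed
  have in_U: "(u, v) \<in> U" if "u \<in> ball x r" "v \<in> ball y s" for u v
    using rs that by blast
  have "((\<lambda>(x, y). f (x, y)) has_derivative
      (\<lambda>(h, k). (\<lambda>h. dx f q * h) h + blinfun_apply (blinfun_mult_right (dy f (x, y))) k))
      (at (x, y) within ball x r \<times> ball y s)"
  proof (rule has_derivative_partialsI)
    have "((\<lambda>x. f (x, y)) has_field_derivative dx f q) (at x)"
      unfolding dx_def using open_slices(1)[OF U] q
      by (auto intro: holomorphic_derivI[OF holx])
    then show "((\<lambda>x. f (x, y)) has_derivative (\<lambda>h. dx f q * h)) (at x within ball x r)"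
      by (simp add: has_field_derivative_def has_derivative_at_withinI)
  next
    fix u v assume uv: "u \<in> ball x r" "v \<in> ball y s"
    have "((\<lambda>y. f (u, y)) has_field_derivative dy f (u, v)) (at v)"
      unfolding dy_def using open_slices(2)[OF U] in_U[OF uv]
      by (auto intro: holomorphic_derivI[OF holy])
    then have "((\<lambda>y. f (u, y)) has_derivative (\<lambda>h. dy f (u, v) * h)) (at v within ball y s)"
      by (simp add: has_field_derivative_def has_derivative_at_withinI)
    then show "((\<lambda>y. f (u, y)) has_derivative blinfun_apply (blinfun_mult_right (dy f (u, v)))) (at v within ball y s)"
      by simp
  next
    have "isCont (dy f) q"
      using osgood_dy_continuous[OF U cont holy] U q by (simp add: continuous_on_eq_continuous_at)
    then have "isCont (\<lambda>q. blinfun_mult_right (dy f q)) q"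
      by (rule bounded_linear.continuous[OF bounded_linear_blinfun_mult_right])
    then show "continuous (at (x, y) within ball x r \<times> ball y s) (\<lambda>(x, y). blinfun_mult_right (dy f (x, y)))"
      by (simp add: continuous_at_imp_continuous_within case_prod_beta')
  qed (use rs in auto)
  moreover have "at (x, y) within ball x r \<times> ball y s = at (x, y)"
    using rs by (intro at_within_open) (auto simp: open_Times)
  ultimately show ?thesis
    by (simp add: has_partials_def split_beta)
qed

text \<open>
  Differentiating Cauchy's formula for \<open>dx f\<close> under the integral sign. The right-hand side is Cauchy's integral
  for \<open>dx (dy f)\<close>, but that can be said only once \<open>dy f\<close> is known to be holomorphic in \<open>x\<close>; for this the lemma
  is applied a first time with the variables exchanged.
\<close>

lemma dx_circle_integral_in_y:
  assumes U: "open U" and f: "holomorphic2_on f U" and r: "cball x r \<times> V \<subseteq> U" "0 < r"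
    and V: "open V" "y \<in> V"
  shows "((\<lambda>y. dx f (x, y)) has_field_derivative
     1 / (2 * of_real pi * \<i>) * integral {0..1} (\<lambda>s. dy f (circlepath x r s, y) / (circlepath x r s - x)^2
         * (2 * pi * \<i> * r * exp (2 * of_real pi * \<i> * s)))) (at y)"
proof -
  note slices = holomorphic2_on_slices[OF f]
  note cont = holomorphic2_on_continuous[OF f]
  let ?c = "circlepath x r"
  define k where "k = (\<lambda>s::real. 1 / (?c s - x)^2 * (2 * pi * \<i> * r * exp (2 * of_real pi * \<i> * s)))"
  have c_sphere: "?c s \<in> sphere x r" if "s \<in> {0..1}" for s
    using r path_image_circlepath_nonneg[of r x] that unfolding path_image_def
    by (metis imageI less_eq_real_def)
  then have c_in: "(?c s, v) \<in> U" if "s \<in> {0..1}" "v \<in> V" for s v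
    using r that by fastforce
  have cc: "continuous_on UNIV ?c"
    unfolding circlepath by (intro continuous_intros)
  have ck: "continuous_on {0..1} k"
    unfolding k_def
    by (intro continuous_on_mult continuous_on_divide continuous_on_power continuous_on_diff
            continuous_on_exp continuous_on_of_real continuous_on_const continuous_on_id
            continuous_on_subset[OF cc]) (use c_sphere r in fastforce)+
  have hol: "(\<lambda>v. f (?c s, v) * k s) holomorphic_on V" if "s \<in> {0..1}" for s
    using c_in[OF that] by (intro holomorphic_intros holomorphic_on_subset[OF slices(2)]) auto
  have "((\<lambda>v. integral {0..1} (\<lambda>s. f (?c s, v) * k s)) has_field_derivative
           integral {0..1} (\<lambda>s. deriv (\<lambda>v. f (?c s, v) * k s) y)) (at y)"
  proof (rule has_field_derivative_integral_param[OF V _ hol])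
    have "continuous_on (V \<times> {0..1}) (\<lambda>z. f (?c (snd z), fst z))"
      by (rule continuous_on_compose2[OF cont])
         (use c_in in \<open>auto intro!: continuous_intros continuous_on_compose2[OF cc]\<close>)
    moreover have "continuous_on (V \<times> {0..1}) (\<lambda>z. k (snd z))"
      by (rule continuous_on_compose2[OF ck]) (auto intro!: continuous_intros)
    ultimately show "continuous_on (V \<times> {0..1}) (\<lambda>(v, s). f (?c s, v) * k s)"
      unfolding case_prod_beta' by (rule continuous_on_mult)
  qed
  moreover have "integral {0..1} (\<lambda>s. deriv (\<lambda>v. f (?c s, v) * k s) y) = integral {0..1} (\<lambda>s. dy f (?c s, y) * k s)"
  proof (rule integral_cong)
    fix s :: real assume s: "s \<in> {0..1}"
    have "(\<lambda>v. f (?c s, v)) field_differentiable at y"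
      using c_in[OF s] V by (intro holomorphic_on_imp_differentiable_at[of _ V] holomorphic_on_subset[OF slices(2)]) auto
    then show "deriv (\<lambda>v. f (?c s, v) * k s) y = dy f (?c s, y) * k s"
      by (simp add: dy_def mult.commute[of _ "k s"])
  qed
  ultimately have "((\<lambda>v. 1 / (2 * of_real pi * \<i>) * integral {0..1} (\<lambda>s. f (?c s, v) * k s)) has_field_derivative
           1 / (2 * of_real pi * \<i>) * integral {0..1} (\<lambda>s. dy f (?c s, y) * k s)) (at y)"
    by (intro DERIV_cmult) simp
  then have "((\<lambda>v. dx f (x, v)) has_field_derivative
           1 / (2 * of_real pi * \<i>) * integral {0..1} (\<lambda>s. dy f (?c s, y) * k s)) (at y)"
  proof (rule has_field_derivative_transform_within_open[OF _ V])
    fix v assume v: "v \<in> V"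
    have "dx f (x, v) = deriv (\<lambda>s. f (s, v)) x" by (simp add: dx_def)
    also have "\<dots> = 1 / (2 * of_real pi * \<i>) * integral {0..1} (\<lambda>s. f (?c s, v) / (?c s - x)^2
         * (2 * pi * \<i> * r * exp (2 * of_real pi * \<i> * s)))"
      using r v by (intro deriv_eq_circle_integral[OF slices(1)]) auto
    finally show "1 / (2 * of_real pi * \<i>) * integral {0..1} (\<lambda>s. f (?c s, v) * k s) = dx f (x, v)"
      by (simp add: k_def mult.assoc)
  qed
  then show ?thesis by (simp add: k_def mult.assoc)
qed

lemma ex_product_cball:
  fixes U :: "(complex \<times> complex) set"
  assumes "open U" "(x, y) \<in> U"
  obtains r V where "0 < r" "cball x r \<times> V \<subseteq> U" "open V" "y \<in> V"
proof -
  obtain A B where AB: "open A" "open B" "(x, y) \<in> A \<times> B" "A \<times> B \<subseteq> U"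
    using assms open_prod_elim by blast
  obtain r where r: "r > 0" "cball x r \<subseteq> A"
    using AB open_contains_cball by (metis SigmaE2)
  have "cball x r \<times> B \<subseteq> U" using AB r by blast
  with that AB r show ?thesis by blast
qed

lemma dx_holomorphic_in_y:
  assumes U: "open U" and f: "holomorphic2_on f U"
  shows "(\<lambda>y. dx f (x, y)) holomorphic_on {y. (x, y) \<in> U}"
  unfolding holomorphic_on_def field_differentiable_def
proof
  fix y assume "y \<in> {y. (x, y) \<in> U}"
  then obtain r V where "0 < r" "cball x r \<times> V \<subseteq> U" "open V" "y \<in> V"
    using ex_product_cball U by blast
  from dx_circle_integral_in_y[OF U f this(2,1,3,4)]
  show "\<exists>f'. ((\<lambda>y. dx f (x, y)) has_field_derivative f') (at y within {y. (x, y) \<in> U})"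
    by (blast intro: has_field_derivative_at_within)
qed

lemma partials_swap:
  "has_partials f A B (prod.swap q) \<Longrightarrow> has_partials (\<lambda>q. f (prod.swap q)) B A q"
  unfolding has_partials_def
proof -
  assume f: "(f has_derivative (\<lambda>(h, k). A * h + B * k)) (at (prod.swap q))"
  have "(prod.swap has_derivative prod.swap) (at q)"
    unfolding prod.swap_def by (auto intro!: derivative_eq_intros)
  from has_derivative_compose[OF this f]
  show "((\<lambda>q. f (prod.swap q)) has_derivative (\<lambda>(h, k). B * h + A * k)) (at q)"
    by (rule has_derivative_eq_rhs) (auto simp: fun_eq_iff)
qed

lemma holomorphic2_on_swap:
  "holomorphic2_on f U \<Longrightarrow> holomorphic2_on (\<lambda>q. f (prod.swap q)) (prod.swap ` U)"
  unfolding holomorphic2_on_iff_partials by (force dest: partials_swap)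

lemma dy_holomorphic_in_x:
  assumes U: "open U" and f: "holomorphic2_on f U"
  shows "(\<lambda>x. dy f (x, y)) holomorphic_on {x. (x, y) \<in> U}"
proof -
  have "(\<lambda>x. dx (\<lambda>q. f (prod.swap q)) (y, x)) holomorphic_on {x. (y, x) \<in> prod.swap ` U}"
    by (intro dx_holomorphic_in_y open_swap_image U holomorphic2_on_swap f)
  moreover have "{x. (y, x) \<in> prod.swap ` U} = {x. (x, y) \<in> U}" by force
  ultimately show ?thesis by (simp add: dy_swap)
qed

lemma holomorphic2_on_dx:
  assumes U: "open U" and f: "holomorphic2_on f U"
  shows "holomorphic2_on (dx f) U"
proof (rule holomorphic2_onI)
  note slices = holomorphic2_on_slices[OF f]
  note cont = holomorphic2_on_continuous[OF f]
  show "has_partials (dx f) (dx (dx f) q) (dy (dx f) q) q" if "q \<in> U" for q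
  proof (rule osgood_partials[OF U _ _ _ that])
    show "continuous_on U (dx f)"
      by (intro osgood_dx_continuous U cont slices)
    show "(\<lambda>x. dx f (x, y)) holomorphic_on {x. (x, y) \<in> U}" for y
      using holomorphic_deriv[OF slices(1) open_slices(1)[OF U]] by (simp add: dx_def)
    show "(\<lambda>y. dx f (x, y)) holomorphic_on {y. (x, y) \<in> U}" for x
      by (rule dx_holomorphic_in_y[OF U f])
  qed
qed

lemma holomorphic2_on_dy:
  assumes U: "open U" and f: "holomorphic2_on f U"
  shows "holomorphic2_on (dy f) U"
proof -
  have "holomorphic2_on (dx (\<lambda>q. f (prod.swap q))) (prod.swap ` U)"
    by (intro holomorphic2_on_dx open_swap_image U holomorphic2_on_swap f)
  from holomorphic2_on_swap[OF this] show ?thesis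
    by (simp add: dy_swap image_image)
qed

lemma dy_dx_commute:
  assumes U: "open U" and f: "holomorphic2_on f U" and q: "q \<in> U"
  shows "dy (dx f) q = dx (dy f) q"
proof -
  obtain x y where [simp]: "q = (x, y)" by (cases q)
  obtain r V where r: "0 < r" "cball x r \<times> V \<subseteq> U" "open V" "y \<in> V"
    using ex_product_cball[OF U, of x y] q by (metis \<open>q = (x, y)\<close>)
  have "dy (dx f) q = 1 / (2 * of_real pi * \<i>) * integral {0..1} (\<lambda>s. dy f (circlepath x r s, y) / (circlepath x r s - x)^2
         * (2 * pi * \<i> * r * exp (2 * of_real pi * \<i> * s)))"
    using DERIV_imp_deriv[OF dx_circle_integral_in_y[OF U f r(2,1,3,4)]] by (simp add: dy_def)
  also have "\<dots> = dx (dy f) q"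
  proof -
    have "cball x r \<subseteq> {x. (x, y) \<in> U}" using r by blast
    then show ?thesis
    using deriv_eq_circle_integral[OF dy_holomorphic_in_x[OF U f, of y], of x r x] r
    by (simp add: dx_def)
  qed
  finally show ?thesis .
qed

section \<open>Calculus of partial derivatives\<close>

lemma partials_eq: "has_partials f A B q \<Longrightarrow> A = A' \<Longrightarrow> B = B' \<Longrightarrow> has_partials f A' B' q"
  by simp

lemma partials_const: "has_partials (\<lambda>q. c) 0 0 q"
  and partials_fst: "has_partials fst 1 0 q"
  and partials_snd: "has_partials snd 0 1 q"
  unfolding has_partials_def by (auto intro!: derivative_eq_intros)

lemma partials_add: "has_partials f A B q \<Longrightarrow> has_partials g C D q \<Longrightarrow> has_partials (\<lambda>q. f q + g q) (A + C) (B + D) q"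
  and partials_diff: "has_partials f A B q \<Longrightarrow> has_partials g C D q \<Longrightarrow> has_partials (\<lambda>q. f q - g q) (A - C) (B - D) q"
  unfolding has_partials_def by (auto intro!: derivative_eq_intros simp: algebra_simps)

lemma partials_mult:
  "has_partials f A B q \<Longrightarrow> has_partials g C D q \<Longrightarrow> has_partials (\<lambda>q. f q * g q) (A * g q + f q * C) (B * g q + f q * D) q"
  unfolding has_partials_def by (auto intro!: derivative_eq_intros simp: algebra_simps)

lemma partials_cmult: "has_partials f A B q \<Longrightarrow> has_partials (\<lambda>q. c * f q) (c * A) (c * B) q"
  using partials_mult[OF partials_const[of c q], of f A B] by simp

lemma partials_chain1:
  assumes f: "(f has_field_derivative f') (at (u q))" and u: "has_partials u A B q"
  shows "has_partials (\<lambda>q. f (u q)) (f' * A) (f' * B) q"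
  using has_derivative_compose[OF u[unfolded has_partials_def] f[unfolded has_field_derivative_def]]
  unfolding has_partials_def by (rule has_derivative_eq_rhs) (auto simp: algebra_simps)

lemma partials_chain2:
  assumes f: "has_partials f A B (u q, v q)" and u: "has_partials u u1 u2 q" and v: "has_partials v v1 v2 q"
  shows "has_partials (\<lambda>q. f (u q, v q)) (A * u1 + B * v1) (A * u2 + B * v2) q"
  using has_derivative_compose[OF has_derivative_Pair[OF u[unfolded has_partials_def] v[unfolded has_partials_def]] f[unfolded has_partials_def]]
  unfolding has_partials_def by (rule has_derivative_eq_rhs) (auto simp: algebra_simps)

lemma partials_inverse:
  assumes "has_partials f A B q" "f q \<noteq> 0"
  shows "has_partials (\<lambda>q. inverse (f q)) (- A / (f q)\<^sup>2) (- B / (f q)\<^sup>2) q"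
  by (rule partials_eq[OF partials_chain1[OF DERIV_inverse assms(1)]])
     (use assms(2) in \<open>simp_all add: divide_inverse power_inverse power2_eq_square\<close>)

lemma partials_divide:
  assumes "has_partials f A B q" "has_partials g C D q" "g q \<noteq> 0"
  shows "has_partials (\<lambda>q. f q / g q) ((A * g q - f q * C) / (g q)\<^sup>2) ((B * g q - f q * D) / (g q)\<^sup>2) q"
  unfolding divide_inverse[of "f _"]
  by (rule partials_eq[OF partials_mult[OF assms(1) partials_inverse[OF assms(2,3)]]])
     (use assms(3) in \<open>simp_all add: field_simps power2_eq_square\<close>)

lemma partials_exp: "has_partials f A B q \<Longrightarrow> has_partials (\<lambda>q. exp (f q)) (A * exp (f q)) (B * exp (f q)) q"
  using partials_chain1[OF DERIV_exp, where u=f and q=q and A=A and B=B] by (simp add: mult.commute)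

lemma holomorphic2_on_add: "holomorphic2_on f U \<Longrightarrow> holomorphic2_on g U \<Longrightarrow> holomorphic2_on (\<lambda>q. f q + g q) U"
  by (rule holomorphic2_onI[OF partials_add[OF holomorphic2_on_partials holomorphic2_on_partials]])

lemma holomorphic2_on_diff: "holomorphic2_on f U \<Longrightarrow> holomorphic2_on g U \<Longrightarrow> holomorphic2_on (\<lambda>q. f q - g q) U"
  by (rule holomorphic2_onI[OF partials_diff[OF holomorphic2_on_partials holomorphic2_on_partials]])

lemma holomorphic2_on_mult: "holomorphic2_on f U \<Longrightarrow> holomorphic2_on g U \<Longrightarrow> holomorphic2_on (\<lambda>q. f q * g q) U"
  by (rule holomorphic2_onI[OF partials_mult[OF holomorphic2_on_partials holomorphic2_on_partials]])

lemma holomorphic2_on_const: "holomorphic2_on (\<lambda>q. c) U"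
  by (rule holomorphic2_onI[OF partials_const])

lemma holomorphic2_on_cmult: "holomorphic2_on f U \<Longrightarrow> holomorphic2_on (\<lambda>q. c * f q) U"
  by (rule holomorphic2_on_mult[OF holomorphic2_on_const])

lemma partials_transform:
  assumes "has_partials f A B q" "open U" "q \<in> U" "\<And>r. r \<in> U \<Longrightarrow> f r = h r"
  shows "has_partials h A B q"
  using has_derivative_transform_within_open[of f _ q UNIV U h] assms unfolding has_partials_def by auto

lemma dx_cong_open:
  assumes "open U" "q \<in> U" "\<And>r. r \<in> U \<Longrightarrow> f r = h r"
  shows "dx f q = dx h q"
proof -
  obtain x y where q: "q = (x, y)" by (cases q)
  have "\<forall>\<^sub>F s in nhds x. f (s, y) = h (s, y)"
    using open_slices(1)[OF assms(1), of y] assms(2,3) q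
    by (auto simp: eventually_nhds)
  then show ?thesis
    by (simp add: dx_def q deriv_cong_ev)
qed

lemma dy_cong_open:
  assumes "open U" "q \<in> U" "\<And>r. r \<in> U \<Longrightarrow> f r = h r"
  shows "dy f q = dy h q"
proof -
  obtain x y where q: "q = (x, y)" by (cases q)
  have "\<forall>\<^sub>F s in nhds y. f (x, s) = h (x, s)"
    using open_slices(2)[OF assms(1), of x] assms(2,3) q
    by (auto simp: eventually_nhds)
  then show ?thesis
    by (simp add: dy_def q deriv_cong_ev)
qed

lemma holomorphic2_on_cong:
  assumes "holomorphic2_on f U" "open U" "\<And>r. r \<in> U \<Longrightarrow> f r = h r"
  shows "holomorphic2_on h U"
  using assms partials_transform unfolding holomorphic2_on_iff_partials by meson

text \<open>
  Near \<open>x\<close> a continuous logarithm is \<open>L x + Ln (g y / g x)\<close>, because \<open>L y - L x\<close> stays in the strip on which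
  \<open>Ln\<close> inverts \<open>exp\<close>.
\<close>

lemma has_derivative_log:
  fixes L g :: "'a::real_normed_vector \<Rightarrow> complex"
  assumes "isCont L x" "\<forall>\<^sub>F y in nhds x. exp (L y) = g y" "(g has_derivative g') (at x)"
  shows "(L has_derivative (\<lambda>h. g' h / g x)) (at x)"
proof -
  have gx: "g x = exp (L x)" "g x \<noteq> 0"
    using eventually_nhds_x_imp_x[OF assms(2)] by (auto simp: exp_not_eq_zero dest: sym)
  have "((\<lambda>y. g y / g x) has_derivative (\<lambda>h. g' h / g x)) (at x)"
    using gx(2) by (auto intro!: derivative_eq_intros assms(3) simp: field_simps)
  moreover have "(Ln has_derivative (*) 1) (at (g x / g x))"
    using has_field_derivative_Ln[of 1] gx(2) by (simp add: has_field_derivative_def)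
  ultimately have "((\<lambda>y. Ln (g y / g x)) has_derivative (\<lambda>h. 1 * (g' h / g x))) (at x)"
    by (rule has_derivative_compose)
  then have "((\<lambda>y. L x + Ln (g y / g x)) has_derivative (\<lambda>h. g' h / g x)) (at x)"
    by (auto intro!: derivative_eq_intros)
  moreover have "\<forall>\<^sub>F y in nhds x. dist (L y) (L x) < 1"
    using assms(1) by (simp add: isCont_def tendsto_at_iff_tendsto_nhds tendstoD)
  with assms(2) have "\<forall>\<^sub>F y in nhds x. L x + Ln (g y / g x) = L y"
  proof eventually_elim
    case (elim y)
    have "\<bar>Im (L y - L x)\<bar> < 1"
      using elim(2) abs_Im_le_cmod[of "L y - L x"] by (simp add: dist_norm)
    then have "Ln (exp (L y - L x)) = L y - L x"
      using pi_gt3 by (intro Ln_exp) auto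
    with elim gx show ?case by (simp add: exp_diff)
  qed
  then have "\<forall>\<^sub>F y in at x. L x + Ln (g y / g x) = L y" "L x + Ln (g x / g x) = L x"
    by (auto simp: eventually_at_filter elim: eventually_mono dest: eventually_nhds_x_imp_x)
  ultimately show ?thesis
    by (rule has_derivative_transform_eventually) simp
qed

lemma log_has_vector_derivative:
  fixes L :: "real \<Rightarrow> complex"
  assumes "open T" "t \<in> T" "continuous_on T L" "\<And>s. s \<in> T \<Longrightarrow> exp (L s) = g s"
    and "(g has_vector_derivative g') (at t)"
  shows "(L has_vector_derivative g' / g t) (at t)"
proof -
  have "(L has_derivative (\<lambda>h. (h *\<^sub>R g') / g t)) (at t)"
    using assms by (intro has_derivative_log)
      (auto simp: continuous_on_eq_continuous_at eventually_nhds has_vector_derivative_def)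
  then show ?thesis
    by (simp add: has_vector_derivative_def scaleR_conv_of_real)
qed

lemma partials_log:
  assumes "isCont L q" "\<forall>\<^sub>F r in nhds q. exp (L r) = g r" "has_partials g A B q"
  shows "has_partials L (A / g q) (B / g q) q"
  using has_derivative_log[OF assms(1,2) assms(3)[unfolded has_partials_def]]
  unfolding has_partials_def by (rule has_derivative_eq_rhs) (auto simp: add_divide_distrib)

lemma log_branch_partials:
  assumes "log_branch L g p"
  obtains U where "open U" "p \<in> U" "\<And>q. q \<in> U \<Longrightarrow> exp (L q) = g q"
    "\<And>q A B. q \<in> U \<Longrightarrow> has_partials g A B q \<Longrightarrow> has_partials L (A / g q) (B / g q) q"
proof -
  obtain U where U: "open U" "p \<in> U" "continuous_on U L" "\<forall>q\<in>U. exp (L q) = g q"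
    using assms by (auto simp: log_branch_def)
  have "has_partials L (A / g q) (B / g q) q" if "q \<in> U" "has_partials g A B q" for q A B
    using U that by (intro partials_log) (auto simp: continuous_on_eq_continuous_at eventually_nhds)
  with U that show ?thesis by blast
qed

text \<open>
  The logarithmic vector fields of \<open>X\<close> and \<open>Y\<close>: in the coordinates \<open>(X, Y)\<close> they are \<open>X d/dX\<close> and \<open>Y d/dY\<close>.
\<close>

section \<open>The system for the gauge transformed unknown\<close>

definition theta_x :: "(complex \<times> complex \<Rightarrow> complex) \<Rightarrow> complex \<times> complex \<Rightarrow> complex"
  where "theta_x f q = fst q * (1 - fst q) * dx f q"

definition theta_y :: "(complex \<times> complex \<Rightarrow> complex) \<Rightarrow> complex \<times> complex \<Rightarrow> complex"
  where "theta_y f q = snd q * (1 - snd q) * dy f q"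

lemma theta_x_cong_open: "open U \<Longrightarrow> q \<in> U \<Longrightarrow> (\<And>r. r \<in> U \<Longrightarrow> f r = h r) \<Longrightarrow> theta_x f q = theta_x h q"
  and theta_y_cong_open: "open U \<Longrightarrow> q \<in> U \<Longrightarrow> (\<And>r. r \<in> U \<Longrightarrow> f r = h r) \<Longrightarrow> theta_y f q = theta_y h q"
  unfolding theta_x_def theta_y_def using dx_cong_open[of U q f h] dy_cong_open[of U q f h] by simp_all

lemma theta_x_partials: "has_partials f A B q \<Longrightarrow> theta_x f q = fst q * (1 - fst q) * A"
  and theta_y_partials: "has_partials f A B q \<Longrightarrow> theta_y f q = snd q * (1 - snd q) * B"
  unfolding theta_x_def theta_y_def by (simp_all add: partials_dx partials_dy)

lemma partials_theta_x:
  assumes "open U" "holomorphic2_on f U" "q \<in> U"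
  shows "has_partials (theta_x f) ((1 - 2 * fst q) * dx f q + fst q * (1 - fst q) * dx (dx f) q)
     (fst q * (1 - fst q) * dx (dy f) q) q"
  unfolding theta_x_def[abs_def]
  by (rule partials_eq[OF partials_mult[OF partials_mult[OF partials_fst partials_diff[OF partials_const partials_fst]]
        holomorphic2_on_partials[OF holomorphic2_on_dx[OF assms(1,2)] assms(3)]]])
    (auto simp: algebra_simps dy_dx_commute[OF assms])

lemma partials_theta_y:
  assumes "open U" "holomorphic2_on f U" "q \<in> U"
  shows "has_partials (theta_y f) (snd q * (1 - snd q) * dx (dy f) q)
     ((1 - 2 * snd q) * dy f q + snd q * (1 - snd q) * dy (dy f) q) q"
  unfolding theta_y_def[abs_def]
  by (rule partials_eq[OF partials_mult[OF partials_mult[OF partials_snd partials_diff[OF partials_const partials_snd]]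
        holomorphic2_on_partials[OF holomorphic2_on_dy[OF assms(1,2)] assms(3)]]])
    (auto simp: algebra_simps)

lemma holomorphic2_on_theta_x: "open U \<Longrightarrow> holomorphic2_on f U \<Longrightarrow> holomorphic2_on (theta_x f) U"
  and holomorphic2_on_theta_y: "open U \<Longrightarrow> holomorphic2_on f U \<Longrightarrow> holomorphic2_on (theta_y f) U"
  using partials_theta_x[of U f] partials_theta_y[of U f] unfolding holomorphic2_on_iff_partials by blast+

lemma theta_y_theta_x:
  assumes "open U" "holomorphic2_on f U" "q \<in> U"
  shows "theta_y (theta_x f) q = theta_x (theta_y f) q"
  unfolding theta_y_partials[OF partials_theta_x[OF assms]] theta_x_partials[OF partials_theta_y[OF assms]] by (simp add: algebra_simps)

text \<open>
  With \<open>\<theta> = theta_x\<close> and \<open>\<theta>' = theta_y\<close>, these are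
  \<open>\<theta> (a - 1 + \<theta>) - X (b + \<theta>) (\<theta> - \<theta>') - T (b + \<theta>) (b' + \<theta>')\<close> and
  \<open>\<theta>' (a - 1 + \<theta>') - Y (b' + \<theta>') (\<theta>' - \<theta>) - T (b + \<theta>) (b' + \<theta>')\<close>, multiplied out.
\<close>

definition gauged_P :: "complex \<Rightarrow> complex \<Rightarrow> complex \<Rightarrow> (complex \<times> complex \<Rightarrow> complex) \<Rightarrow> complex \<times> complex \<Rightarrow> complex"
  where "gauged_P a b b' w q = theta_x (theta_x w) q + (a - 1) * theta_x w q
     - X q * (b * (theta_x w q - theta_y w q) + theta_x (theta_x w) q - theta_x (theta_y w) q)
     - XY q * (b * b' * w q + b * theta_y w q + b' * theta_x w q + theta_x (theta_y w) q)"

definition gauged_Q :: "complex \<Rightarrow> complex \<Rightarrow> complex \<Rightarrow> (complex \<times> complex \<Rightarrow> complex) \<Rightarrow> complex \<times> complex \<Rightarrow> complex"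
  where "gauged_Q a b b' w q = theta_y (theta_y w) q + (a - 1) * theta_y w q
     + Y q * (b' * (theta_x w q - theta_y w q) + theta_x (theta_y w) q - theta_y (theta_y w) q)
     - XY q * (b * b' * w q + b * theta_y w q + b' * theta_x w q + theta_x (theta_y w) q)"

lemma X_eq: "X q = - fst q / (1 - fst q)" and Y_eq: "Y q = - snd q / (1 - snd q)"
  and XY_eq: "XY q = fst q * snd q / ((1 - fst q) * (1 - snd q))"
  by (auto simp: X_def Y_def XY_def split_beta)

lemma XY_eq_mult: "XY q = X q * Y q"
  by (simp add: X_eq Y_eq XY_eq)

lemma P2_partials:
  assumes U: "open U" "holomorphic2_on z U" "q \<in> U"
  shows "P2 a b b' c c' z q = (fst q)\<^sup>2 * dx (dx z) q + c * fst q * dx z q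
    - fst q * (a * b * z q + (a + b + 1) * fst q * dx z q + (fst q)\<^sup>2 * dx (dx z) q
        + b * snd q * dy z q + fst q * snd q * dx (dy z) q)"
proof -
  note z1 = holomorphic2_on_partials[OF holomorphic2_on_dx[OF U(1,2)] U(3)]
  have D: "Dx z = (\<lambda>q. fst q * dx z q)" by (auto simp: Dx_def)
  have 1: "has_partials (shift e Dx z) (e * dx z q + dx z q + fst q * dx (dx z) q) (e * dy z q + fst q * dx (dy z) q) q" for e
    unfolding shift_def D
    by (rule partials_eq[OF partials_add[OF partials_cmult[OF holomorphic2_on_partials[OF U(2,3)]] partials_mult[OF partials_fst z1]]])
      (auto simp: dy_dx_commute[OF U])
  have 2: "Dx f q = fst q * dx f q" "Dy f q = snd q * dy f q" for f
    by (auto simp: Dx_def Dy_def split_beta)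
  show ?thesis
    unfolding P2_def
    by (simp add: shift_def[of a] 2 partials_dx[OF 1] partials_dy[OF 1])
      (simp add: shift_def D algebra_simps power2_eq_square)
qed

lemma Q2_partials:
  assumes U: "open U" "holomorphic2_on z U" "q \<in> U"
  shows "Q2 a b b' c c' z q = (snd q)\<^sup>2 * dy (dy z) q + c' * snd q * dy z q
    - snd q * (a * b' * z q + (a + b' + 1) * snd q * dy z q + (snd q)\<^sup>2 * dy (dy z) q
        + b' * fst q * dx z q + fst q * snd q * dx (dy z) q)"
proof -
  note z1 = holomorphic2_on_partials[OF holomorphic2_on_dy[OF U(1,2)] U(3)]
  have D: "Dy z = (\<lambda>q. snd q * dy z q)" by (auto simp: Dy_def)
  have 1: "has_partials (shift e Dy z) (e * dx z q + snd q * dx (dy z) q) (e * dy z q + dy z q + snd q * dy (dy z) q) q" for e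
    unfolding shift_def D
    by (rule partials_eq[OF partials_add[OF partials_cmult[OF holomorphic2_on_partials[OF U(2,3)]] partials_mult[OF partials_snd z1]]])
      auto
  have 2: "Dx f q = fst q * dx f q" "Dy f q = snd q * dy f q" for f
    by (auto simp: Dx_def Dy_def split_beta)
  show ?thesis
    unfolding Q2_def
    by (simp add: shift_def[of a] 2 partials_dx[OF 1] partials_dy[OF 1])
      (simp add: shift_def D algebra_simps power2_eq_square)
qed

text \<open>
  The denominators to come are exponentials, for which the quotient rule needs no squares.
\<close>

lemma partials_divide_exp:
  assumes "has_partials f A B q" "has_partials g (k * g q) (l * g q) q" "g q \<noteq> 0"
  shows "has_partials (\<lambda>q. f q / g q) ((A - k * f q) / g q) ((B - l * f q) / g q) q"
  by (rule partials_eq[OF partials_divide[OF assms]]) (use assms(3) in \<open>simp_all add: field_simps power2_eq_square\<close>)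

lemma partials_pole:
  shows "fst q \<noteq> 1 \<Longrightarrow> has_partials (\<lambda>q. inverse (1 - fst q)) ((inverse (1 - fst q))\<^sup>2) 0 q"
    and "snd q \<noteq> 1 \<Longrightarrow> has_partials (\<lambda>q. inverse (1 - snd q)) 0 ((inverse (1 - snd q))\<^sup>2) q"
proof -
  assume "fst q \<noteq> 1"
  then show "has_partials (\<lambda>q. inverse (1 - fst q)) ((inverse (1 - fst q))\<^sup>2) 0 q"
    using partials_inverse[OF partials_diff[OF partials_const[of 1 q] partials_fst]]
    by (simp add: divide_inverse power_inverse)
next
  assume "snd q \<noteq> 1"
  then show "has_partials (\<lambda>q. inverse (1 - snd q)) 0 ((inverse (1 - snd q))\<^sup>2) q"
    using partials_inverse[OF partials_diff[OF partials_const[of 1 q] partials_snd]]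
    by (simp add: divide_inverse power_inverse)
qed

text \<open>
  Conjugation by \<open>g = (1 - x)^b (1 - y)^b'\<close>: as \<open>x d/dx g = - b x / (1 - x) g\<close>, the operator \<open>x d/dx\<close> turns into
  \<open>(1 - X) \<theta> - b X\<close> and \<open>b + x d/dx\<close> into \<open>(1 - X) (b + \<theta>)\<close>, and the factors \<open>1 - X\<close> cancel. With
  \<open>u = 1 / (1 - x)\<close> and \<open>v = 1 / (1 - y)\<close> everything is polynomial modulo \<open>x u = u - 1\<close> and \<open>y v = v - 1\<close>.
\<close>

lemma gauged_equations:
  assumes U: "open U" "holomorphic2_on w U" and g: "\<And>q. q \<in> U \<Longrightarrow> g q \<noteq> 0"
    "\<And>q. q \<in> U \<Longrightarrow> has_partials g (- b * inverse (1 - fst q) * g q) (- b' * inverse (1 - snd q) * g q) q"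
    and ne: "\<And>q. q \<in> U \<Longrightarrow> fst q \<noteq> 1 \<and> snd q \<noteq> 1" and q: "q \<in> U"
  defines "z \<equiv> \<lambda>q. w q / g q"
  shows "holomorphic2_on z U" "P2 a b b' a a z q = gauged_P a b b' w q / g q" "Q2 a b b' a a z q = gauged_Q a b b' w q / g q"
proof -
  define u where "u = (\<lambda>q::complex\<times>complex. inverse (1 - fst q))"
  define v where "v = (\<lambda>q::complex\<times>complex. inverse (1 - snd q))"
  define z1 where "z1 = (\<lambda>q. dx w q + b * (u q * w q))"
  define z2 where "z2 = (\<lambda>q. dy w q + b' * (v q * w q))"
  have hg: "has_partials g (- b * u q * g q) (- b' * v q * g q) q" if "q \<in> U" for q
    unfolding u_def v_def using that by (rule g(2))
  have z: "has_partials z (z1 q / g q) (z2 q / g q) q" if "q \<in> U" for q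
    unfolding z_def
    by (rule partials_eq[OF partials_divide_exp[OF holomorphic2_on_partials[OF U(2) that] hg[OF that] g(1)[OF that]]])
      (simp_all add: z1_def z2_def algebra_simps)
  then show hz: "holomorphic2_on z U" by (rule holomorphic2_onI)
  have dz: "dx z q = z1 q / g q" "dy z q = z2 q / g q" if "q \<in> U" for q
    using z[OF that] by (auto dest: partials_dx partials_dy)
  note w = holomorphic2_on_partials[OF U(2) q]
  note wx = holomorphic2_on_partials[OF holomorphic2_on_dx[OF U] q]
  note wy = holomorphic2_on_partials[OF holomorphic2_on_dy[OF U] q]
  have hu: "has_partials u ((u q)\<^sup>2) 0 q" and hv: "has_partials v 0 ((v q)\<^sup>2) q"
    using partials_pole ne[OF q] by (auto simp: u_def v_def)
  have h1: "has_partials (\<lambda>q. z1 q / g q) ((dx (dx w) q + 2 * b * u q * dx w q + b * (b + 1) * (u q)\<^sup>2 * w q) / g q)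
      ((dx (dy w) q + b' * v q * dx w q + b * u q * dy w q + b * b' * u q * v q * w q) / g q) q"
    unfolding z1_def
    by (rule partials_eq[OF partials_divide_exp[OF partials_add[OF wx partials_cmult[OF partials_mult[OF hu w]]] hg[OF q] g(1)[OF q]]])
      (simp_all add: dy_dx_commute[OF U q] algebra_simps power2_eq_square)
  have h2: "has_partials (\<lambda>q. z2 q / g q) ((dx (dy w) q + b' * v q * dx w q + b * u q * dy w q + b * b' * u q * v q * w q) / g q)
     ((dy (dy w) q + 2 * b' * v q * dy w q + b' * (b' + 1) * (v q)\<^sup>2 * w q) / g q) q"
    unfolding z2_def
    by (rule partials_eq[OF partials_divide_exp[OF partials_add[OF wy partials_cmult[OF partials_mult[OF hv w]]] hg[OF q] g(1)[OF q]]])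
      (simp_all add: dy_dx_commute[OF U q] algebra_simps power2_eq_square)
  have dd: "dx (dx z) q = dx (\<lambda>q. z1 q / g q) q" "dx (dy z) q = dx (\<lambda>q. z2 q / g q) q" "dy (dy z) q = dy (\<lambda>q. z2 q / g q) q"
    by (intro dx_cong_open[OF U(1) q] dy_cong_open[OF U(1) q] dz; assumption)+
  note th = theta_x_partials[OF partials_theta_x[OF U q]] theta_x_partials[OF partials_theta_y[OF U q]] theta_y_partials[OF partials_theta_y[OF U q]] theta_x_def[of w] theta_y_def[of w]
  have rel: "fst q * u q = u q - 1" "snd q * v q = v q - 1"
    using ne[OF q] by (auto simp: u_def v_def field_simps)
  have XYuv: "X q = - (fst q * u q)" "Y q = - (snd q * v q)"
    by (simp_all add: X_eq Y_eq u_def v_def divide_inverse)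
  note dd' = dd[unfolded partials_dx[OF h1] partials_dx[OF h2] partials_dy[OF h2]]
  define gi where "gi = inverse (g q)"
  show "P2 a b b' a a z q = gauged_P a b b' w q / g q"
    unfolding P2_partials[OF U(1) hz q] gauged_P_def dd' dz[OF q] th XY_eq_mult XYuv
      z1_def z2_def divide_inverse gi_def[symmetric]
    unfolding z_def divide_inverse gi_def[symmetric]
    using rel by algebra
  show "Q2 a b b' a a z q = gauged_Q a b b' w q / g q"
    unfolding Q2_partials[OF U(1) hz q] gauged_Q_def dd' dz[OF q] th XY_eq_mult XYuv
      z1_def z2_def divide_inverse gi_def[symmetric]
    unfolding z_def divide_inverse gi_def[symmetric]
    using rel by algebra
qed

lemma P2_cong_open:
  assumes "open U" "holomorphic2_on z U" "q \<in> U" and eq: "\<And>r. r \<in> U \<Longrightarrow> z r = z' r"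
  shows "P2 a b b' c c' z q = P2 a b b' c c' z' q" "Q2 a b b' c c' z q = Q2 a b b' c c' z' q"
proof -
  have z': "holomorphic2_on z' U"
    using holomorphic2_on_cong[OF assms(2,1) eq] .
  have 1: "dx z r = dx z' r" "dy z r = dy z' r" if "r \<in> U" for r
    using dx_cong_open[OF assms(1) that eq] dy_cong_open[OF assms(1) that eq] by auto
  have 2: "dx (dx z) q = dx (dx z') q" "dx (dy z) q = dx (dy z') q" "dy (dy z) q = dy (dy z') q"
    using dx_cong_open[OF assms(1,3), of "dx z" "dx z'"] dx_cong_open[OF assms(1,3), of "dy z" "dy z'"]
      dy_cong_open[OF assms(1,3), of "dy z" "dy z'"] 1 by auto
  show "P2 a b b' c c' z q = P2 a b b' c c' z' q" "Q2 a b b' c c' z q = Q2 a b b' c c' z' q"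
    unfolding P2_partials[OF assms(1,2,3)] P2_partials[OF assms(1) z' assms(3)]
      Q2_partials[OF assms(1,2,3)] Q2_partials[OF assms(1) z' assms(3)]
    using 1[OF assms(3)] 2 eq[OF assms(3)] by simp_all
qed

lemma gauged_cong_open:
  assumes "open U" "q \<in> U" and eq: "\<And>r. r \<in> U \<Longrightarrow> w r = w' r"
  shows "gauged_P a b b' w q = gauged_P a b b' w' q" "gauged_Q a b b' w q = gauged_Q a b b' w' q"
proof -
  have 1: "theta_x w r = theta_x w' r" "theta_y w r = theta_y w' r" if "r \<in> U" for r
    using theta_x_cong_open[OF assms(1) that eq] theta_y_cong_open[OF assms(1) that eq] by auto
  have 2: "theta_x (theta_x w) q = theta_x (theta_x w') q" "theta_x (theta_y w) q = theta_x (theta_y w') q" "theta_y (theta_y w) q = theta_y (theta_y w') q"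
    using theta_x_cong_open[OF assms(1,2), of "theta_x w" "theta_x w'"] theta_x_cong_open[OF assms(1,2), of "theta_y w" "theta_y w'"]
      theta_y_cong_open[OF assms(1,2), of "theta_y w" "theta_y w'"] 1 by auto
  show "gauged_P a b b' w q = gauged_P a b b' w' q" "gauged_Q a b b' w q = gauged_Q a b b' w' q"
    unfolding gauged_P_def gauged_Q_def using 1[OF assms(2)] 2 eq[OF assms(2)] by simp_all
qed

definition gauged_solutions :: "complex \<Rightarrow> complex \<Rightarrow> complex \<Rightarrow> complex \<times> complex \<Rightarrow> (complex \<times> complex \<Rightarrow> complex) set"
  where "gauged_solutions a b b' p = {w. \<exists>U. open U \<and> p \<in> U \<and> holomorphic2_on w U \<and>
    (\<forall>q\<in>U. gauged_P a b b' w q = 0 \<and> gauged_Q a b b' w q = 0)}"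

lemma gauged_solutionsI:
  assumes "open U" "p \<in> U" "holomorphic2_on w U" "\<And>q. q \<in> U \<Longrightarrow> gauged_P a b b' w q = 0 \<and> gauged_Q a b b' w q = 0"
    and "\<forall>\<^sub>F q in nhds p. w' q = w q"
  shows "w' \<in> gauged_solutions a b b' p"
proof -
  obtain N where N: "open N" "p \<in> N" "\<And>q. q \<in> N \<Longrightarrow> w q = w' q"
    using assms(5) by (auto simp: eventually_nhds)
  have UN: "open (U \<inter> N)" using assms N by auto
  have "holomorphic2_on w' (U \<inter> N)"
    using holomorphic2_on_cong[OF holomorphic2_on_subset[OF assms(3)] UN] N by auto
  moreover have "gauged_P a b b' w' q = 0 \<and> gauged_Q a b b' w' q = 0" if "q \<in> U \<inter> N" for q
    using gauged_cong_open[OF UN that, of w w'] N(3) assms(4)[of q] that by auto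
  ultimately show ?thesis
    unfolding gauged_solutions_def using UN assms(2) N(2) by blast
qed

lemma gauge_factor_partials:
  fixes b b' :: complex
  assumes "log_branch L (\<lambda>(x, y). 1 - x) p" "log_branch L' (\<lambda>(x, y). 1 - y) p"
    and g_def: "g = (\<lambda>q. exp (b' * L' q) * exp (b * L q))"
  obtains U where "open U" "p \<in> U" "\<And>q. q \<in> U \<Longrightarrow> fst q \<noteq> 1 \<and> snd q \<noteq> 1"
    "\<And>q. q \<in> U \<Longrightarrow> has_partials g (- b * inverse (1 - fst q) * g q) (- b' * inverse (1 - snd q) * g q) q"
proof -
  obtain U where U: "open U" "p \<in> U" "\<And>q. q \<in> U \<Longrightarrow> exp (L q) = 1 - fst q"
    "\<And>q A B. q \<in> U \<Longrightarrow> has_partials (\<lambda>q. 1 - fst q) A B q \<Longrightarrow> has_partials L (A / (1 - fst q)) (B / (1 - fst q)) q"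
    by (rule log_branch_partials[OF assms(1)[unfolded case_prod_beta']], rule that)
  obtain V where V: "open V" "p \<in> V" "\<And>q. q \<in> V \<Longrightarrow> exp (L' q) = 1 - snd q"
    "\<And>q A B. q \<in> V \<Longrightarrow> has_partials (\<lambda>q. 1 - snd q) A B q \<Longrightarrow> has_partials L' (A / (1 - snd q)) (B / (1 - snd q)) q"
    by (rule log_branch_partials[OF assms(2)[unfolded case_prod_beta']], rule that)
  show ?thesis
  proof (rule that[of "U \<inter> V"])
    show "fst q \<noteq> 1 \<and> snd q \<noteq> 1" if "q \<in> U \<inter> V" for q
      using U(3)[of q] V(3)[of q] that by auto
    show "has_partials g (- b * inverse (1 - fst q) * g q) (- b' * inverse (1 - snd q) * g q) q" if "q \<in> U \<inter> V" for q
      unfolding g_def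
      by (rule partials_eq[OF partials_mult[OF partials_exp[OF partials_cmult[OF V(4)[OF _ partials_diff[OF partials_const partials_snd]]]]
             partials_exp[OF partials_cmult[OF U(4)[OF _ partials_diff[OF partials_const partials_fst]]]]]])
        (use that in \<open>auto simp: divide_inverse algebra_simps\<close>)
  qed (use U V in auto)
qed

text \<open>
  Passing from \<open>z\<close> to \<open>w = g z\<close> is a bijection of germs since \<open>g\<close> does not vanish near \<open>p\<close>; from here on only \<open>w\<close> is
  considered.
\<close>

lemma multiples_S2_eq_gauged:
  fixes b b' :: complex
  assumes "log_branch L (\<lambda>(x, y). 1 - x) p" "log_branch L' (\<lambda>(x, y). 1 - y) p"
    and g_def: "g = (\<lambda>q. exp (b' * L' q) * exp (b * L q))"
  shows "multiples g (S2 a b b' a a p) p = gauged_solutions a b b' p"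
proof (intro equalityI subsetI)
  obtain U where U: "open U" "p \<in> U" "\<And>q. q \<in> U \<Longrightarrow> fst q \<noteq> 1 \<and> snd q \<noteq> 1"
    "\<And>q. q \<in> U \<Longrightarrow> has_partials g (- b * inverse (1 - fst q) * g q) (- b' * inverse (1 - snd q) * g q) q"
    by (rule gauge_factor_partials[OF assms(1,2) g_def], rule that)
  have g: "g q \<noteq> 0" for q by (simp add: g_def)
  {
    fix w assume "w \<in> multiples g (S2 a b b' a a p) p"
    then obtain z V where z: "\<forall>\<^sub>F q in nhds p. w q = g q * z q" "open V" "p \<in> V" "holomorphic2_on z V"
        "\<And>q. q \<in> V \<Longrightarrow> P2 a b b' a a z q = 0 \<and> Q2 a b b' a a z q = 0"
      unfolding multiples_def S2_def by blast
    define W where "W = U \<inter> V"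
    have W: "open W" "p \<in> W" "W \<subseteq> U" "W \<subseteq> V" using U z by (auto simp: W_def)
    have gz: "holomorphic2_on (\<lambda>q. g q * z q) W"
    proof (rule holomorphic2_onI)
      fix q assume "q \<in> W"
      then have "q \<in> U" "q \<in> V" using W by auto
      then show "has_partials (\<lambda>q. g q * z q) (- b * inverse (1 - fst q) * g q * z q + g q * dx z q)
          (- b' * inverse (1 - snd q) * g q * z q + g q * dy z q) q"
        by (intro partials_mult U(4) holomorphic2_on_partials[OF z(4)])
    qed
    show "w \<in> gauged_solutions a b b' p"
    proof (rule gauged_solutionsI[OF W(1,2) gz _ z(1)])
      fix q assume q: "q \<in> W"
      have qUV: "q \<in> U" "q \<in> V" using q W by auto
      have UW: "has_partials g (- b * inverse (1 - fst q) * g q) (- b' * inverse (1 - snd q) * g q) q"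
        "fst q \<noteq> 1 \<and> snd q \<noteq> 1" if "q \<in> W" for q
        using U(3)[of q] U(4)[of q] subsetD[OF W(3) that] by simp_all
      note c = gauged_equations[OF W(1) gz g UW(1) UW(2) q]
      have eq: "z r = g r * z r / g r" for r using g by simp
      have cong: "P2 a b b' a a z q = P2 a b b' a a (\<lambda>q. g q * z q / g q) q"
        "Q2 a b b' a a z q = Q2 a b b' a a (\<lambda>q. g q * z q / g q) q"
        by (rule P2_cong_open[OF W(1) holomorphic2_on_subset[OF z(4) W(4)] q], rule eq)+
      have "gauged_P a b b' (\<lambda>q. g q * z q) q / g q = 0" "gauged_Q a b b' (\<lambda>q. g q * z q) q / g q = 0"
        using c(2,3)[of a] unfolding cong[symmetric] by (simp_all only: z(5)[OF qUV(2)])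
      then show "gauged_P a b b' (\<lambda>q. g q * z q) q = 0 \<and> gauged_Q a b b' (\<lambda>q. g q * z q) q = 0"
        using g[of q] by simp
    qed
  }
  {
    fix w assume "w \<in> gauged_solutions a b b' p"
    then obtain V where w: "open V" "p \<in> V" "holomorphic2_on w V"
        "\<And>q. q \<in> V \<Longrightarrow> gauged_P a b b' w q = 0 \<and> gauged_Q a b b' w q = 0"
      unfolding gauged_solutions_def by blast
    define W where "W = U \<inter> V"
    have W: "open W" "p \<in> W" "W \<subseteq> U" "W \<subseteq> V" using U w by (auto simp: W_def)
    have UW: "has_partials g (- b * inverse (1 - fst q) * g q) (- b' * inverse (1 - snd q) * g q) q"
      "fst q \<noteq> 1 \<and> snd q \<noteq> 1" if "q \<in> W" for q
      using U(3)[of q] U(4)[of q] subsetD[OF W(3) that] by simp_all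
    note c = gauged_equations[OF W(1) holomorphic2_on_subset[OF w(3) W(4)] g UW(1) UW(2)]
    have "P2 a b b' a a (\<lambda>q. w q / g q) q = 0 \<and> Q2 a b b' a a (\<lambda>q. w q / g q) q = 0" if "q \<in> W" for q
    proof -
      have "q \<in> V" using that W by auto
      then show ?thesis using c(2,3)[OF _ _ that, of a] w(4) by simp
    qed
    moreover have "holomorphic2_on (\<lambda>q. w q / g q) W"
      using c(1)[OF _ _ W(2)] by simp
    ultimately have "(\<lambda>q. w q / g q) \<in> S2 a b b' a a p"
      unfolding S2_def using W by blast
    then show "w \<in> multiples g (S2 a b b' a a p) p"
      unfolding multiples_def by (intro CollectI bexI[of _ "\<lambda>q. w q / g q"]) (simp_all add: g)
  }
qed

section \<open>The inclusions between the spaces of solutions\<close>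

lemma partials_X: "fst q \<noteq> 1 \<Longrightarrow> has_partials X (- (inverse (1 - fst q))\<^sup>2) 0 q"
proof -
  assume q: "fst q \<noteq> 1"
  have "has_partials (\<lambda>q. 1 - inverse (1 - fst q)) (- (inverse (1 - fst q))\<^sup>2) 0 q"
    using partials_diff[OF partials_const[of 1] partials_pole(1)[OF q]] by simp
  moreover have "open {q::complex \<times> complex. fst q \<noteq> 1}"
    by (intro open_Collect_neq continuous_intros)
  ultimately show ?thesis
    by (rule partials_transform) (use q in \<open>auto simp: X_eq divide_inverse[symmetric] divide_simps\<close>)
qed

lemma partials_Y: "snd q \<noteq> 1 \<Longrightarrow> has_partials Y 0 (- (inverse (1 - snd q))\<^sup>2) q"
proof -
  assume q: "snd q \<noteq> 1"
  have "has_partials (\<lambda>q. 1 - inverse (1 - snd q)) 0 (- (inverse (1 - snd q))\<^sup>2) q"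
    using partials_diff[OF partials_const[of 1] partials_pole(2)[OF q]] by simp
  moreover have "open {q::complex \<times> complex. snd q \<noteq> 1}"
    by (intro open_Collect_neq continuous_intros)
  ultimately show ?thesis
    by (rule partials_transform) (use q in \<open>auto simp: Y_eq divide_inverse[symmetric] divide_simps\<close>)
qed

lemma partials_XY:
  "fst q \<noteq> 1 \<Longrightarrow> snd q \<noteq> 1 \<Longrightarrow>
    has_partials XY (- (inverse (1 - fst q))\<^sup>2 * Y q) (X q * - (inverse (1 - snd q))\<^sup>2) q"
  using partials_mult[OF partials_X partials_Y, of q] by (simp add: XY_eq_mult[abs_def])

lemma theta_X: "fst q \<noteq> 1 \<Longrightarrow> theta_x X q = X q" "fst q \<noteq> 1 \<Longrightarrow> theta_y X q = 0"
  and theta_Y: "snd q \<noteq> 1 \<Longrightarrow> theta_x Y q = 0" "snd q \<noteq> 1 \<Longrightarrow> theta_y Y q = Y q"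
  and theta_XY: "fst q \<noteq> 1 \<Longrightarrow> snd q \<noteq> 1 \<Longrightarrow> theta_x XY q = XY q"
    "fst q \<noteq> 1 \<Longrightarrow> snd q \<noteq> 1 \<Longrightarrow> theta_y XY q = XY q"
  by (simp_all add: theta_x_partials[OF partials_X] theta_y_partials[OF partials_X] theta_x_partials[OF partials_Y] theta_y_partials[OF partials_Y]
      theta_x_partials[OF partials_XY] theta_y_partials[OF partials_XY] XY_eq_mult)
    (simp_all add: X_eq Y_eq divide_simps power2_eq_square)

abbreviation domain_XY :: "(complex \<times> complex) set"
  where "domain_XY \<equiv> {q. fst q \<noteq> 1 \<and> snd q \<noteq> 1}"

lemma open_domain_XY: "open domain_XY"
  by (intro open_Collect_conj open_Collect_neq continuous_intros)

lemma holomorphic2_X: "holomorphic2_on X domain_XY" and holomorphic2_Y: "holomorphic2_on Y domain_XY"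
  and holomorphic2_XY: "holomorphic2_on XY domain_XY"
  unfolding holomorphic2_on_iff_partials using partials_X partials_Y partials_XY by blast+

lemma theta_composition:
  assumes v: "holomorphic2_on v V" and F: "holomorphic2_on F U" and G: "holomorphic2_on G U"
    and into: "\<And>q. q \<in> U \<Longrightarrow> (F q, G q) \<in> V"
  shows "holomorphic2_on (\<lambda>q. v (F q, G q)) U"
    and "q \<in> U \<Longrightarrow> theta_x (\<lambda>q. v (F q, G q)) q = theta_x F q * dx v (F q, G q) + theta_x G q * dy v (F q, G q)"
    and "q \<in> U \<Longrightarrow> theta_y (\<lambda>q. v (F q, G q)) q = theta_y F q * dx v (F q, G q) + theta_y G q * dy v (F q, G q)"
proof -
  have *: "has_partials (\<lambda>q. v (F q, G q)) (dx v (F q, G q) * dx F q + dy v (F q, G q) * dx G q)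
      (dx v (F q, G q) * dy F q + dy v (F q, G q) * dy G q) q" if "q \<in> U" for q
    by (intro partials_chain2 holomorphic2_on_partials[OF v] holomorphic2_on_partials[OF F]
         holomorphic2_on_partials[OF G] that into)
  then show "holomorphic2_on (\<lambda>q. v (F q, G q)) U" by (rule holomorphic2_onI)
  show "q \<in> U \<Longrightarrow> theta_x (\<lambda>q. v (F q, G q)) q = theta_x F q * dx v (F q, G q) + theta_x G q * dy v (F q, G q)"
    and "q \<in> U \<Longrightarrow> theta_y (\<lambda>q. v (F q, G q)) q = theta_y F q * dx v (F q, G q) + theta_y G q * dy v (F q, G q)"
    by (simp_all add: theta_x_partials[OF *] theta_y_partials[OF *]) (simp_all add: theta_x_def theta_y_def algebra_simps)
qed

text \<open>
  Chain rule to second order for a substitution whose components are eigenfunctions of \<open>\<theta>\<close> and \<open>\<theta>'\<close>: in the new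
  variables \<open>F\<close>, \<open>G\<close> the fields are \<open>m F d/dF + n G d/dG\<close> and \<open>m' F d/dF + n' G d/dG\<close>, and \<open>E\<close> collects the second
  order terms of a product of two such fields.
\<close>

lemma theta_monomials:
  fixes m n m' n' :: complex
  assumes U: "open U" and V: "open V" and v: "holomorphic2_on v V"
    and F: "holomorphic2_on F U" and G: "holomorphic2_on G U"
    and maps: "\<forall>q\<in>U. (F q, G q) \<in> V"
    and monomials: "\<forall>q\<in>U. theta_x F q = m * F q" "\<forall>q\<in>U. theta_x G q = n * G q"
      "\<forall>q\<in>U. theta_y F q = m' * F q" "\<forall>q\<in>U. theta_y G q = n' * G q"
  defines "w \<equiv> \<lambda>q. v (F q, G q)"
    and "E \<equiv> \<lambda>k l k' l' q. k * F q * (k' * dx v (F q, G q) + k' * F q * dx (dx v) (F q, G q) + l' * G q * dx (dy v) (F q, G q))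
      + l * G q * (k' * F q * dx (dy v) (F q, G q) + l' * dy v (F q, G q) + l' * G q * dy (dy v) (F q, G q))"
  shows "holomorphic2_on w U"
    "q \<in> U \<Longrightarrow> theta_x w q = m * F q * dx v (F q, G q) + n * G q * dy v (F q, G q)"
    "q \<in> U \<Longrightarrow> theta_y w q = m' * F q * dx v (F q, G q) + n' * G q * dy v (F q, G q)"
    "q \<in> U \<Longrightarrow> theta_x (theta_x w) q = E m n m n q"
    "q \<in> U \<Longrightarrow> theta_x (theta_y w) q = E m n m' n' q"
    "q \<in> U \<Longrightarrow> theta_y (theta_y w) q = E m' n' m' n' q"
proof -
  have into: "(F q, G q) \<in> V" if "q \<in> U" for q using maps that by blast
  have th: "theta_x F q = m * F q" "theta_x G q = n * G q" "theta_y F q = m' * F q" "theta_y G q = n' * G q"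
    if "q \<in> U" for q
    using monomials that by auto
  define e where "e = (\<lambda>k l r. k * (fst r * dx v r) + l * (snd r * dy v r))"
  have he: "has_partials (e k l) (k * dx v r + k * fst r * dx (dx v) r + l * snd r * dx (dy v) r)
      (k * fst r * dx (dy v) r + l * dy v r + l * snd r * dy (dy v) r) r" if "r \<in> V" for k l r
    unfolding e_def
    by (rule partials_eq[OF partials_add[OF
          partials_cmult[OF partials_mult[OF partials_fst holomorphic2_on_partials[OF holomorphic2_on_dx[OF V v] that]]]
          partials_cmult[OF partials_mult[OF partials_snd holomorphic2_on_partials[OF holomorphic2_on_dy[OF V v] that]]]]])
      (simp_all add: dy_dx_commute[OF V v that] algebra_simps)
  have hole: "holomorphic2_on (e k l) V" for k l by (rule holomorphic2_onI[OF he])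
  note c = theta_composition[OF v F G into] and ce = theta_composition[OF hole F G into]
  show "holomorphic2_on w U" unfolding w_def by (rule c(1))
  have t: "theta_x w q = e m n (F q, G q)" "theta_y w q = e m' n' (F q, G q)" if "q \<in> U" for q
    using c(2,3)[OF _ that] th[OF that] by (simp_all add: w_def e_def)
  then show "q \<in> U \<Longrightarrow> theta_x w q = m * F q * dx v (F q, G q) + n * G q * dy v (F q, G q)"
    "q \<in> U \<Longrightarrow> theta_y w q = m' * F q * dx v (F q, G q) + n' * G q * dy v (F q, G q)"
    by (simp_all add: e_def)
  show "theta_x (theta_x w) q = E m n m n q" "theta_x (theta_y w) q = E m n m' n' q"
    "theta_y (theta_y w) q = E m' n' m' n' q" if q: "q \<in> U"
    using theta_x_cong_open[OF U q t(1)] theta_x_cong_open[OF U q t(2)] theta_y_cong_open[OF U q t(2)]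
      ce(2,3)[OF _ q] th[OF q] partials_dx[OF he[OF into[OF q]]] partials_dy[OF he[OF into[OF q]]]
    by (simp_all add: E_def)
qed

text \<open>
  In the variables \<open>(X, T)\<close>, where \<open>\<theta> = X d/dX + T d/dT\<close> and \<open>\<theta>' = T d/dT\<close>, the two equations are
  \<open>X P\<^sub>1 + T Q\<^sub>1\<close> and \<open>T Q\<^sub>1 - T R\<^sub>1\<close>.
\<close>

lemma S1_XT_subset_gauged:
  assumes p: "p \<in> domain_XY"
  shows "pullback (\<lambda>q. (X q, XY q)) (S1 b 0 b' a (X p, XY p)) p \<subseteq> gauged_solutions a b b' p"
proof
  fix w assume "w \<in> pullback (\<lambda>q. (X q, XY q)) (S1 b 0 b' a (X p, XY p)) p"
  then obtain v V where w: "\<forall>\<^sub>F q in nhds p. w q = v (X q, XY q)"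
    and V: "open V" "(X p, XY p) \<in> V" "holomorphic2_on v V"
    and eqs: "\<And>q. q \<in> V \<Longrightarrow> P1 b 0 b' a v q = 0 \<and> Q1 b 0 b' a v q = 0 \<and> R1 b 0 b' a v q = 0"
    unfolding pullback_def S1_def by blast
  define U where "U = domain_XY \<inter> (\<lambda>q. (X q, XY q)) -` V"
  have U: "open U" unfolding U_def
    by (intro continuous_open_preimage open_domain_XY V(1) continuous_on_Pair
         holomorphic2_on_continuous holomorphic2_X holomorphic2_XY)
  have pU: "p \<in> U" using p V by (simp add: U_def)
  have sub: "U \<subseteq> domain_XY" "\<forall>q\<in>U. (X q, XY q) \<in> V" by (auto simp: U_def)
  have th: "\<forall>q\<in>U. theta_x X q = 1 * X q" "\<forall>q\<in>U. theta_x XY q = 1 * XY q"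
    "\<forall>q\<in>U. theta_y X q = 0 * X q" "\<forall>q\<in>U. theta_y XY q = 1 * XY q"
    using sub(1) by (auto simp: theta_X theta_Y theta_XY)
  note c = theta_monomials[OF U V(1,3) holomorphic2_on_subset[OF holomorphic2_X sub(1)]
      holomorphic2_on_subset[OF holomorphic2_XY sub(1)] sub(2) th]
  let ?w = "\<lambda>q. v (X q, XY q)"
  show "w \<in> gauged_solutions a b b' p"
  proof (rule gauged_solutionsI[OF U pU _ _ w])
    show "holomorphic2_on ?w U" by (rule c(1))
    fix q assume q: "q \<in> U"
    note cq = c(2-6)[OF q]
    have "gauged_P a b b' ?w q = X q * P1 b 0 b' a v (X q, XY q) + XY q * Q1 b 0 b' a v (X q, XY q)"
      and "gauged_Q a b b' ?w q = XY q * Q1 b 0 b' a v (X q, XY q) - XY q * R1 b 0 b' a v (X q, XY q)"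
      unfolding gauged_P_def gauged_Q_def cq P1_def Q1_def R1_def prod.case
        dy_dx_commute[OF V(1,3) bspec[OF sub(2) q]]
      by (simp_all add: algebra_simps XY_eq_mult[of q])
    then show "gauged_P a b b' ?w q = 0 \<and> gauged_Q a b b' ?w q = 0"
      using eqs[OF bspec[OF sub(2) q]] by simp
  qed
qed

text \<open>
  The mirror image: now \<open>\<theta> = T d/dT\<close> and \<open>\<theta>' = T d/dT + Y d/dY\<close>, and the two equations are \<open>T P\<^sub>1 + T R\<^sub>1\<close> and
  \<open>T P\<^sub>1 + Y Q\<^sub>1\<close>.
\<close>

lemma S1_TY_subset_gauged:
  assumes p: "p \<in> domain_XY"
  shows "pullback (\<lambda>q. (XY q, Y q)) (S1 b' b 0 a (XY p, Y p)) p \<subseteq> gauged_solutions a b b' p"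
proof
  fix w assume "w \<in> pullback (\<lambda>q. (XY q, Y q)) (S1 b' b 0 a (XY p, Y p)) p"
  then obtain v V where w: "\<forall>\<^sub>F q in nhds p. w q = v (XY q, Y q)"
    and V: "open V" "(XY p, Y p) \<in> V" "holomorphic2_on v V"
    and eqs: "\<And>q. q \<in> V \<Longrightarrow> P1 b' b 0 a v q = 0 \<and> Q1 b' b 0 a v q = 0 \<and> R1 b' b 0 a v q = 0"
    unfolding pullback_def S1_def by blast
  define U where "U = domain_XY \<inter> (\<lambda>q. (XY q, Y q)) -` V"
  have U: "open U" unfolding U_def
    by (intro continuous_open_preimage open_domain_XY V(1) continuous_on_Pair
         holomorphic2_on_continuous holomorphic2_XY holomorphic2_Y)
  have pU: "p \<in> U" using p V by (simp add: U_def)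
  have sub: "U \<subseteq> domain_XY" "\<forall>q\<in>U. (XY q, Y q) \<in> V" by (auto simp: U_def)
  have th: "\<forall>q\<in>U. theta_x XY q = 1 * XY q" "\<forall>q\<in>U. theta_x Y q = 0 * Y q"
    "\<forall>q\<in>U. theta_y XY q = 1 * XY q" "\<forall>q\<in>U. theta_y Y q = 1 * Y q"
    using sub(1) by (auto simp: theta_X theta_Y theta_XY)
  note c = theta_monomials[OF U V(1,3) holomorphic2_on_subset[OF holomorphic2_XY sub(1)]
      holomorphic2_on_subset[OF holomorphic2_Y sub(1)] sub(2) th]
  let ?w = "\<lambda>q. v (XY q, Y q)"
  show "w \<in> gauged_solutions a b b' p"
  proof (rule gauged_solutionsI[OF U pU _ _ w])
    show "holomorphic2_on ?w U" by (rule c(1))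
    fix q assume q: "q \<in> U"
    note cq = c(2-6)[OF q]
    have "gauged_P a b b' ?w q = XY q * P1 b' b 0 a v (XY q, Y q) + XY q * R1 b' b 0 a v (XY q, Y q)"
      and "gauged_Q a b b' ?w q = XY q * P1 b' b 0 a v (XY q, Y q) + Y q * Q1 b' b 0 a v (XY q, Y q)"
      unfolding gauged_P_def gauged_Q_def cq P1_def Q1_def R1_def prod.case
        dy_dx_commute[OF V(1,3) bspec[OF sub(2) q]]
      by (simp_all add: algebra_simps XY_eq_mult[of q])
    then show "gauged_P a b b' ?w q = 0 \<and> gauged_Q a b b' ?w q = 0"
      using eqs[OF bspec[OF sub(2) q]] by simp
  qed
qed

lemma gauss_op_expand:
  assumes U: "open U" "u holomorphic_on U" "t \<in> U"
  shows "gauss_op a b c u t = t * (t * (1 - t) * deriv (deriv u) t + (c - (a + b + 1) * t) * deriv u t - a * b * u t)"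
proof -
  have 1: "(u has_field_derivative deriv u t) (at t)"
    using U by (intro holomorphic_derivI)
  have 2: "(deriv u has_field_derivative deriv (deriv u) t) (at t)"
    using U by (intro holomorphic_derivI holomorphic_deriv)
  have "(shift e Dt u has_field_derivative e * deriv u t + (deriv u t + t * deriv (deriv u) t)) (at t)" for e
    unfolding shift_def Dt_def by (rule derivative_eq_intros 1 2 refl | simp)+
  from DERIV_imp_deriv[OF this]
  show ?thesis by (simp add: gauss_op_def shift_def[of a] Dt_def) (simp add: shift_def Dt_def algebra_simps)
qed

text \<open>
  The Gauss operator carries a factor \<open>t\<close>, whereas \<open>P\<^sub>1\<close> and \<open>Q\<^sub>1\<close> do not. At \<open>t = 0\<close>, which is the value of \<open>T\<close> at
  every point on the axes, the factor is removed by continuity.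
\<close>

lemma gauss_reduced:
  assumes U: "open U" "u holomorphic_on U" "t \<in> U" and z: "\<And>t. t \<in> U \<Longrightarrow> gauss_op a b c u t = 0"
  shows "t * (1 - t) * deriv (deriv u) t + (c - (a + b + 1) * t) * deriv u t - a * b * u t = 0" (is "?H t = 0")
proof (cases "t = 0")
  case False
  then show ?thesis using gauss_op_expand[OF U, of a b c] z[OF U(3)] by simp
next
  case True
  have "continuous_on U ?H"
    by (intro continuous_intros holomorphic_on_imp_continuous_on[of _ U] holomorphic_deriv U)
  then have "isCont ?H t" using U by (simp add: continuous_on_eq_continuous_at)
  then have "(?H \<longlongrightarrow> ?H t) (at t)" by (simp add: isCont_def)
  moreover have "(?H \<longlongrightarrow> 0) (at t)"
  proof (rule tendsto_eventually)
    have "\<forall>\<^sub>F s in at t. s \<in> U \<and> s \<noteq> t"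
      using U by (intro eventually_conj eventually_at_in_open' eventually_neq_at_within)
    then show "\<forall>\<^sub>F s in at t. ?H s = 0"
      by eventually_elim (use gauss_op_expand[OF U(1,2), of _ a b c] z True in auto)
  qed
  ultimately show "?H t = 0"
    by (rule LIM_unique)
qed

lemma S_subset_S1_XT:
  "pullback XY (S b b' a (XY p)) p \<subseteq> pullback (\<lambda>q. (X q, XY q)) (S1 b 0 b' a (X p, XY p)) p"
proof
  fix w assume "w \<in> pullback XY (S b b' a (XY p)) p"
  then obtain u V where w: "\<forall>\<^sub>F q in nhds p. w q = u (XY q)" and V: "open V" "XY p \<in> V" "u holomorphic_on V"
    and z: "\<And>t. t \<in> V \<Longrightarrow> gauss_op b b' a u t = 0"
    unfolding pullback_def S_def by blast
  define v where "v = (\<lambda>r::complex \<times> complex. u (snd r))"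
  have U: "open (UNIV \<times> V)" using V by (simp add: open_Times)
  have d: "dx v = (\<lambda>r. 0)" "dy v = (\<lambda>r. deriv u (snd r))" "dx (\<lambda>r. 0) = (\<lambda>r. 0)" "dy (\<lambda>r. 0) = (\<lambda>r. 0)"
    "dx (\<lambda>r. deriv u (snd r)) = (\<lambda>r. 0)" "dy (\<lambda>r. deriv u (snd r)) = (\<lambda>r. deriv (deriv u) (snd r))"
    by (auto simp: v_def dx_def dy_def fun_eq_iff)
  have "has_partials v (deriv u (snd r) * 0) (deriv u (snd r) * 1) r" if "r \<in> UNIV \<times> V" for r
    unfolding v_def using that by (intro partials_chain1 partials_snd holomorphic_derivI[OF V(3,1)]) auto
  then have "holomorphic2_on v (UNIV \<times> V)" by (rule holomorphic2_onI)
  moreover have "P1 b 0 b' a v r = 0 \<and> Q1 b 0 b' a v r = 0 \<and> R1 b 0 b' a v r = 0" if "r \<in> UNIV \<times> V" for r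
    using gauss_reduced[OF V(1,3) _ z, of "snd r"] that
    by (auto simp: P1_def Q1_def R1_def d fun_cong[OF v_def])
  ultimately have "v \<in> S1 b 0 b' a (X p, XY p)"
    unfolding S1_def using U V(2) by blast
  then show "w \<in> pullback (\<lambda>q. (X q, XY q)) (S1 b 0 b' a (X p, XY p)) p"
    unfolding pullback_def using w by (intro CollectI bexI[of _ v]) (simp_all add: v_def)
qed

lemma S_subset_S1_TY:
  "pullback XY (S b b' a (XY p)) p \<subseteq> pullback (\<lambda>q. (XY q, Y q)) (S1 b' b 0 a (XY p, Y p)) p"
proof
  fix w assume "w \<in> pullback XY (S b b' a (XY p)) p"
  then obtain u V where w: "\<forall>\<^sub>F q in nhds p. w q = u (XY q)" and V: "open V" "XY p \<in> V" "u holomorphic_on V"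
    and z: "\<And>t. t \<in> V \<Longrightarrow> gauss_op b b' a u t = 0"
    unfolding pullback_def S_def by blast
  define v where "v = (\<lambda>r::complex \<times> complex. u (fst r))"
  have U: "open (V \<times> UNIV)" using V by (simp add: open_Times)
  have d: "dy v = (\<lambda>r. 0)" "dx v = (\<lambda>r. deriv u (fst r))" "dx (\<lambda>r. 0) = (\<lambda>r. 0)" "dy (\<lambda>r. 0) = (\<lambda>r. 0)"
    "dy (\<lambda>r. deriv u (fst r)) = (\<lambda>r. 0)" "dx (\<lambda>r. deriv u (fst r)) = (\<lambda>r. deriv (deriv u) (fst r))"
    by (auto simp: v_def dx_def dy_def fun_eq_iff)
  have "has_partials v (deriv u (fst r) * 1) (deriv u (fst r) * 0) r" if "r \<in> V \<times> UNIV" for r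
    unfolding v_def using that by (intro partials_chain1 partials_fst holomorphic_derivI[OF V(3,1)]) auto
  then have "holomorphic2_on v (V \<times> UNIV)" by (rule holomorphic2_onI)
  moreover have "P1 b' b 0 a v r = 0 \<and> Q1 b' b 0 a v r = 0 \<and> R1 b' b 0 a v r = 0" if "r \<in> V \<times> UNIV" for r
    using gauss_reduced[OF V(1,3) _ z, of "fst r"] that
    by (auto simp: P1_def Q1_def R1_def d fun_cong[OF v_def] algebra_simps)
  ultimately have "v \<in> S1 b' b 0 a (XY p, Y p)"
    unfolding S1_def using U V(2) by blast
  then show "w \<in> pullback (\<lambda>q. (XY q, Y q)) (S1 b' b 0 a (XY p, Y p)) p"
    unfolding pullback_def using w by (intro CollectI bexI[of _ v]) (simp_all add: v_def)
qed

section \<open>Calculus along the two vector fields\<close>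

text \<open>
  Where \<open>\<theta>\<close> and \<open>\<theta>'\<close> do not vanish, they are as good as the partial derivatives, and \<open>X\<close>, \<open>Y\<close>, \<open>T\<close> and
  their powers are eigenfunctions.
\<close>

definition has_thetas :: "(complex \<times> complex \<Rightarrow> complex) \<Rightarrow> complex \<Rightarrow> complex \<Rightarrow> complex \<times> complex \<Rightarrow> bool"
  where "has_thetas f A B q \<longleftrightarrow> has_partials f (A / (fst q * (1 - fst q))) (B / (snd q * (1 - snd q))) q"

abbreviation generic :: "(complex \<times> complex) set"
  where "generic \<equiv> {q. fst q \<noteq> 1 \<and> snd q \<noteq> 1 \<and> fst q \<noteq> 0 \<and> snd q \<noteq> 0}"

lemma thetas_eq: "has_thetas f A B q \<Longrightarrow> A = A' \<Longrightarrow> B = B' \<Longrightarrow> has_thetas f A' B' q"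
  by simp

lemma thetas_const: "has_thetas (\<lambda>q. c) 0 0 q"
  using partials_const by (simp add: has_thetas_def)

lemma thetas_add: "has_thetas f A B q \<Longrightarrow> has_thetas g C D q \<Longrightarrow> has_thetas (\<lambda>q. f q + g q) (A + C) (B + D) q"
  and thetas_diff: "has_thetas f A B q \<Longrightarrow> has_thetas g C D q \<Longrightarrow> has_thetas (\<lambda>q. f q - g q) (A - C) (B - D) q"
  unfolding has_thetas_def using partials_add partials_diff by (simp_all add: add_divide_distrib diff_divide_distrib)

lemma thetas_mult:
  assumes "has_thetas f A B q" "has_thetas g C D q"
  shows "has_thetas (\<lambda>q. f q * g q) (A * g q + f q * C) (B * g q + f q * D) q"
  using partials_mult[OF assms[unfolded has_thetas_def]] unfolding has_thetas_def by (simp add: add_divide_distrib)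

lemma thetas_cmult: "has_thetas f A B q \<Longrightarrow> has_thetas (\<lambda>q. c * f q) (c * A) (c * B) q"
  using thetas_mult[OF thetas_const[of c q], of f A B] by simp

lemma thetas_divide_const: "has_thetas f A B q \<Longrightarrow> has_thetas (\<lambda>q. f q / c) (A / c) (B / c) q"
  using thetas_cmult[of f A B q "inverse c"] by (simp add: divide_inverse mult.commute)

lemma thetas_exp: "has_thetas f A B q \<Longrightarrow> has_thetas (\<lambda>q. exp (f q)) (A * exp (f q)) (B * exp (f q)) q"
  unfolding has_thetas_def by (drule partials_exp) simp

lemma thetas_D: "has_thetas f A B q \<Longrightarrow> q \<in> generic \<Longrightarrow> theta_x f q = A \<and> theta_y f q = B"
  unfolding has_thetas_def using theta_x_partials[of f _ _ q] theta_y_partials[of f _ _ q] by auto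

lemma thetas_unique: "has_thetas f A B q \<Longrightarrow> has_thetas f C D q \<Longrightarrow> q \<in> generic \<Longrightarrow> A = C \<and> B = D"
  using thetas_D[of f A B q] thetas_D[of f C D q] by simp

lemma thetas_chain:
  assumes "(u has_field_derivative u') (at (f q))" "has_thetas f A B q"
  shows "has_thetas (\<lambda>q. u (f q)) (u' * A) (u' * B) q"
  using partials_chain1[OF assms(1) assms(2)[unfolded has_thetas_def]] by (simp add: has_thetas_def)

lemma thetas_of_partials:
  "has_partials f A B q \<Longrightarrow> q \<in> generic \<Longrightarrow> has_thetas f (fst q * (1 - fst q) * A) (snd q * (1 - snd q) * B) q"
  unfolding has_thetas_def by simp

lemma holomorphic2_on_thetas:
  assumes "holomorphic2_on f U" "q \<in> U" "q \<in> generic"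
  shows "has_thetas f (theta_x f q) (theta_y f q) q"
  using thetas_of_partials[OF holomorphic2_on_partials[OF assms(1,2)] assms(3)] by (simp add: theta_x_def theta_y_def)

lemma holomorphic2_onI_thetas: "(\<And>q. q \<in> U \<Longrightarrow> has_thetas f (A q) (B q) q) \<Longrightarrow> holomorphic2_on f U"
  unfolding has_thetas_def by (rule holomorphic2_onI)

lemma thetas_X: "q \<in> generic \<Longrightarrow> has_thetas X (X q) 0 q"
  and thetas_Y: "q \<in> generic \<Longrightarrow> has_thetas Y 0 (Y q) q"
  and thetas_XY: "q \<in> generic \<Longrightarrow> has_thetas XY (XY q) (XY q) q"
  using holomorphic2_on_thetas[OF holomorphic2_X, of q] holomorphic2_on_thetas[OF holomorphic2_Y, of q]
    holomorphic2_on_thetas[OF holomorphic2_XY, of q] by (simp_all add: theta_X theta_Y theta_XY)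

lemma thetas_log:
  assumes "isCont L q" "\<forall>\<^sub>F r in nhds q. exp (L r) = g r" "has_thetas g A B q"
  shows "has_thetas L (A / g q) (B / g q) q"
  using partials_log[OF assms(1,2) assms(3)[unfolded has_thetas_def]]
  unfolding has_thetas_def by (simp add: field_simps)

lemma thetas_transform:
  "has_thetas f A B q \<Longrightarrow> open U \<Longrightarrow> q \<in> U \<Longrightarrow> (\<And>r. r \<in> U \<Longrightarrow> f r = h r) \<Longrightarrow> has_thetas h A B q"
  unfolding has_thetas_def by (rule partials_transform)

section \<open>The integrand near the branch point\<close>

text \<open>
  A path \<open>\<tau>\<close> from \<open>0\<close> to \<open>1\<close>, carried to \<open>s = X q * \<tau> t\<close>, with logarithms \<open>l0\<close>, \<open>l1\<close>, \<open>l2\<close> of \<open>s\<close>, \<open>1 - s\<close>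
  and \<open>T - s\<close>. The derivative \<open>d\<tau>\<close> does not vanish at \<open>0\<close>, so that \<open>s\<close> does not wind infinitely often
  about the branch point.
\<close>

locale integration_path =
  fixes U :: "(complex \<times> complex) set" and \<tau> d\<tau> :: "real \<Rightarrow> complex"
    and l0 l1 l2 :: "complex \<times> complex \<Rightarrow> real \<Rightarrow> complex"
  assumes U: "open U" and generic: "U \<subseteq> generic"
    and \<tau>: "\<And>t. t \<in> {0..1} \<Longrightarrow> (\<tau> has_vector_derivative d\<tau> t) (at t)"
    and d\<tau>: "continuous_on {0..1} d\<tau>" "d\<tau> 0 \<noteq> 0"
    and ends: "\<tau> 0 = 0" "\<tau> 1 = 1"
    and l0: "continuous_on (U \<times> {0<..1}) (\<lambda>(q, t). l0 q t)"
      "\<And>q t. q \<in> U \<Longrightarrow> t \<in> {0<..1} \<Longrightarrow> exp (l0 q t) = X q * \<tau> t"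
    and l1: "continuous_on (U \<times> {0..1}) (\<lambda>(q, t). l1 q t)"
      "\<And>q t. q \<in> U \<Longrightarrow> t \<in> {0..1} \<Longrightarrow> exp (l1 q t) = 1 - X q * \<tau> t"
    and l2: "continuous_on (U \<times> {0..1}) (\<lambda>(q, t). l2 q t)"
      "\<And>q t. q \<in> U \<Longrightarrow> t \<in> {0..1} \<Longrightarrow> exp (l2 q t) = XY q - X q * \<tau> t"
begin

text \<open>
  The branch of \<open>s^\<nu>\<close>. Its value at \<open>t = 0\<close>, where \<open>l0\<close> is not specified, is chosen as the limit for \<open>Re \<nu> > 0\<close>.
\<close>

definition start_power :: "complex \<Rightarrow> complex \<times> complex \<Rightarrow> real \<Rightarrow> complex"
  where "start_power \<nu> q t = (if t = 0 then 0 else exp (\<nu> * l0 q t))"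

definition integrand :: "complex \<Rightarrow> complex \<Rightarrow> complex \<Rightarrow> complex \<times> complex \<Rightarrow> real \<Rightarrow> complex"
  where "integrand \<nu> \<beta> \<delta> q t = start_power \<nu> q t * exp (\<beta> * l1 q t + \<delta> * l2 q t) * (X q * d\<tau> t)"

lemma \<tau>_continuous: "continuous_on {0..1} \<tau>"
  by (meson \<tau> continuous_at_imp_continuous_on has_vector_derivative_continuous)

lemma X_nonzero: "q \<in> U \<Longrightarrow> X q \<noteq> 0"
  using l0(2)[of q 1] ends exp_not_eq_zero by (metis greaterThanAtMost_iff less_numeral_extra(1) mult_eq_0_iff order_refl)

lemma X_continuous: "continuous_on U X"
  using generic by (intro holomorphic2_on_continuous holomorphic2_on_subset[OF holomorphic2_X]) auto

text \<open>
  The quotient \<open>\<tau> t / t\<close> tends to \<open>d\<tau> 0 \<noteq> 0\<close>, so \<open>l0 q t - ln t\<close> is, up to an additive constant, the principal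
  logarithm of a function close to \<open>1\<close>. In particular the imaginary part of \<open>l0\<close> is bounded, without which
  \<open>exp (\<nu> * l0 q t)\<close> need not tend to \<open>0\<close> for a complex \<open>\<nu>\<close>.
\<close>

lemma l0_near_start:
  assumes q0: "q0 \<in> U"
  obtains r M where "0 < r" "r \<le> 1" "ball q0 r \<subseteq> U"
    "\<And>q t. q \<in> ball q0 r \<Longrightarrow> 0 < t \<Longrightarrow> t < r \<Longrightarrow> norm (l0 q t - of_real (ln t)) \<le> M"
proof -
  define \<phi> where "\<phi> = (\<lambda>(q, t::real). X q * (\<tau> t / of_real t) / (X q0 * d\<tau> 0))"
  define g where "g = (\<lambda>t::real. if t = 0 then d\<tau> 0 else \<tau> t / of_real t)"
  have "(\<tau> has_vector_derivative d\<tau> 0) (at 0)" using \<tau> by simp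
  then have "((\<lambda>t. norm (\<tau> t - t *\<^sub>R d\<tau> 0) / norm t) \<longlongrightarrow> 0) (at 0)"
    by (simp add: has_vector_derivative_def has_derivative_at ends)
  then have "((\<lambda>t. norm (\<tau> t / of_real t - d\<tau> 0)) \<longlongrightarrow> 0) (at 0)"
  proof (rule Lim_transform_eventually)
    show "\<forall>\<^sub>F t in at 0. norm (\<tau> t - t *\<^sub>R d\<tau> 0) / norm t = norm (\<tau> t / of_real t - d\<tau> 0)"
      unfolding eventually_at_filter
    proof (intro always_eventually allI impI)
      fix t :: real assume "t \<noteq> 0"
      then have "\<tau> t / of_real t - d\<tau> 0 = (\<tau> t - t *\<^sub>R d\<tau> 0) / of_real t"
        by (simp add: field_simps scaleR_conv_of_real)
      then show "norm (\<tau> t - t *\<^sub>R d\<tau> 0) / norm t = norm (\<tau> t / of_real t - d\<tau> 0)"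
        by (simp add: norm_divide)
    qed
  qed
  then have "((\<lambda>t. \<tau> t / of_real t) \<longlongrightarrow> d\<tau> 0) (at 0)"
    by (rule LIM_zero_cancel[OF tendsto_norm_zero_cancel])
  then have "(g \<longlongrightarrow> d\<tau> 0) (at 0)"
    by (rule Lim_transform_eventually) (auto simp: g_def eventually_at_filter)
  then have g: "isCont g 0" by (simp add: isCont_def g_def)
  have X: "isCont X q0"
    using X_continuous U q0 by (simp add: continuous_on_eq_continuous_at)
  have c: "X q0 * d\<tau> 0 \<noteq> 0" using X_nonzero[OF q0] d\<tau>(2) by simp
  have "((\<lambda>z. fst z) \<longlongrightarrow> q0) (at (q0, 0::real))" "((\<lambda>z. snd z) \<longlongrightarrow> 0) (at (q0, 0::real))"
    using tendsto_fst[OF tendsto_ident_at, of "(q0, 0::real)" UNIV] tendsto_snd[OF tendsto_ident_at, of "(q0, 0::real)" UNIV] by simp_all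
  then have "((\<lambda>z. X (fst z) * g (snd z) / (X q0 * d\<tau> 0)) \<longlongrightarrow> X q0 * g 0 / (X q0 * d\<tau> 0)) (at (q0, 0))"
    by (intro tendsto_divide tendsto_mult isCont_tendsto_compose[OF X] isCont_tendsto_compose[OF g] tendsto_const c)
  then have "((\<lambda>z. X (fst z) * g (snd z) / (X q0 * d\<tau> 0)) \<longlongrightarrow> 1) (at (q0, 0))"
    using c by (simp add: g_def)
  then have "\<forall>\<^sub>F z in at (q0, 0). X (fst z) * g (snd z) / (X q0 * d\<tau> 0) \<in> ball 1 (1/2)"
    by (rule topological_tendstoD) auto
  then obtain \<rho> where \<rho>: "\<rho> > 0" "\<And>z. z \<noteq> (q0, 0) \<Longrightarrow> dist z (q0, 0) < \<rho> \<Longrightarrow>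
      X (fst z) * g (snd z) / (X q0 * d\<tau> 0) \<in> ball 1 (1/2)"
    unfolding eventually_at by auto
  obtain r0 where r0: "r0 > 0" "ball q0 r0 \<subseteq> U"
    using U q0 open_contains_ball by blast
  define r where "r = min (min (\<rho> / 2) r0) 1"
  have r: "0 < r" "r \<le> 1" "ball q0 r \<subseteq> U"
    "\<And>q t. q \<in> ball q0 r \<Longrightarrow> 0 < t \<Longrightarrow> t < r \<Longrightarrow> \<phi> (q, t) \<in> ball 1 (1/2)"
  proof -
    show "0 < r" "r \<le> 1" "ball q0 r \<subseteq> U"
      using \<rho>(1) r0 by (auto simp: r_def subset_iff)
    fix q and t :: real assume qt: "q \<in> ball q0 r" "0 < t" "t < r"
    have "dist (q, t) (q0, 0) \<le> dist q q0 + \<bar>t\<bar>"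
      using sqrt_sum_squares_le_sum_abs[of "dist q q0" "dist t 0"] by (simp add: dist_Pair_Pair)
    also have "\<dots> < \<rho>"
      using qt by (auto simp: r_def dist_commute)
    finally show "\<phi> (q, t) \<in> ball 1 (1/2)"
      using \<rho>(2)[of "(q, t)"] qt by (simp add: \<phi>_def g_def)
  qed
  define N where "N = ball q0 r \<times> {0<..<r}"
  define h where "h = (\<lambda>(q, t). l0 q t - of_real (ln t) - Ln (\<phi> (q, t)))"
  have NU: "N \<subseteq> U \<times> {0<..1}" using r by (auto simp: N_def)
  have \<phi>N: "\<phi> z \<in> ball 1 (1/2)" if "z \<in> N" for z using r(4) that by (auto simp: N_def)
  have \<phi>0: "\<phi> z \<notin> \<real>\<^sub>\<le>\<^sub>0" if "z \<in> N" for z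
  proof
    assume "\<phi> z \<in> \<real>\<^sub>\<le>\<^sub>0"
    then have "Re (\<phi> z) \<le> 0" by (auto simp: complex_nonpos_Reals_iff)
    moreover have "\<bar>Re (1 - \<phi> z)\<bar> < 1/2"
      using \<phi>N[OF that] abs_Re_le_cmod[of "1 - \<phi> z"] by (simp add: dist_norm)
    ultimately show False by simp
  qed
  have c\<phi>: "continuous_on N \<phi>"
  proof -
    have "continuous_on N (\<lambda>z. X (fst z))"
      by (rule continuous_on_compose2[OF X_continuous]) (use NU in \<open>auto intro!: continuous_intros\<close>)
    moreover have "continuous_on N (\<lambda>z. \<tau> (snd z))"
      by (rule continuous_on_compose2[OF \<tau>_continuous]) (use NU in \<open>auto intro!: continuous_intros\<close>)
    ultimately show ?thesis
      unfolding \<phi>_def case_prod_beta' using X_nonzero[OF q0] d\<tau>(2)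
      by (intro continuous_on_mult continuous_on_divide continuous_on_const continuous_on_of_real continuous_on_snd continuous_on_id)
        (auto simp: N_def)
  qed
  have "continuous_on N h"
    unfolding h_def case_prod_beta' prod.collapse
    by (intro continuous_on_diff continuous_on_Ln' c\<phi> \<phi>0 continuous_on_of_real continuous_on_ln continuous_on_snd continuous_on_id
         continuous_on_subset[OF l0(1)[unfolded case_prod_beta'] NU]) (auto simp: N_def)
  have exp_h: "exp (h z) = X q0 * d\<tau> 0" if "z \<in> N" for z
  proof -
    obtain q t where z: "z = (q, t)" by (cases z)
    have "(q, t) \<in> U \<times> {0<..1}" using that NU z by blast
    then have qt: "q \<in> U" "0 < t" "t \<in> {0<..1}" by auto
    have "\<phi> z \<noteq> 0" using \<phi>0[OF that] by auto
    moreover have "exp (of_real (ln t) :: complex) = of_real t"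
      using qt by (simp add: exp_of_real)
    ultimately have "exp (h z) = X q * \<tau> t / of_real t / \<phi> z"
      using qt l0(2)[of q t] by (simp add: h_def z exp_diff)
    also have "\<dots> = X q0 * d\<tau> 0"
      using \<open>\<phi> z \<noteq> 0\<close> qt by (auto simp: \<phi>_def z field_simps)
    finally show ?thesis .
  qed
  \<comment> \<open>Two logarithms of the same number differ by at least \<open>2 \<pi>\<close> or coincide, and \<open>N\<close> is connected.\<close>
  have "h constant_on N"
  proof (rule continuous_discrete_range_constant[OF _ \<open>continuous_on N h\<close>])
    show "connected N"
      unfolding N_def by (intro connected_Times) auto
    fix z assume z: "z \<in> N"
    have "2 * pi \<le> norm (h y - h z)" if "y \<in> N" "h y \<noteq> h z" for y
    proof (rule ccontr)
      assume "\<not> 2 * pi \<le> norm (h y - h z)"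
      then have "\<bar>Im (h y) - Im (h z)\<bar> < 2 * pi"
        using abs_Im_le_cmod[of "h y - h z"] by simp
      then have "h y = h z"
        by (rule exp_complex_eqI) (simp only: exp_h[OF z] exp_h[OF that(1)])
      with that show False by simp
    qed
    then show "\<exists>e>0. \<forall>y. y \<in> N \<and> h y \<noteq> h z \<longrightarrow> e \<le> norm (h y - h z)"
      using pi_gt_zero by (intro exI[of _ "2 * pi"]) auto
  qed
  then obtain h0 where h0: "\<And>z. z \<in> N \<Longrightarrow> h z = h0" by (auto simp: constant_on_def)
  have "compact (Ln ` cball 1 (1/2))"
  proof (intro compact_continuous_image continuous_on_Ln continuous_on_id compact_cball)
    fix w :: complex assume "w \<in> cball 1 (1/2)"
    then have "\<bar>Re (1 - w)\<bar> \<le> 1/2"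
      using abs_Re_le_cmod[of "1 - w"] by (simp add: dist_norm)
    then show "w \<notin> \<real>\<^sub>\<le>\<^sub>0" by (auto simp: complex_nonpos_Reals_iff)
  qed
  then obtain M where M: "\<And>w. w \<in> cball 1 (1/2) \<Longrightarrow> norm (Ln w) \<le> M"
    using compact_imp_bounded bounded_iff by (metis imageI)
  show ?thesis
  proof (rule that[of r "norm h0 + M"])
    fix q t assume qt: "q \<in> ball q0 r" "0 < t" "t < r"
    then have z: "(q, t) \<in> N" by (simp add: N_def)
    have "l0 q t - of_real (ln t) = h0 + Ln (\<phi> (q, t))"
      using h0[OF z] by (simp add: h_def algebra_simps)
    also have "norm \<dots> \<le> norm h0 + M"
      using \<phi>N[OF z] M[of "\<phi> (q, t)"] by (intro order.trans[OF norm_triangle_ineq]) auto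
    finally show "norm (l0 q t - of_real (ln t)) \<le> norm h0 + M" .
  qed (use r in auto)
qed

text \<open>
  With a bound \<open>M\<close> for \<open>l0 q t - ln t\<close> the modulus of \<open>exp (\<nu> * l0 q t)\<close> is at most
  \<open>t^(Re \<nu>) exp (\<bar>\<nu>\<bar> M)\<close>, and \<open>Re \<nu>\<close> may be replaced by a positive constant near the given exponent.
\<close>

lemma start_power_tendsto_0:
  assumes q0: "q0 \<in> U" and \<nu>0: "Re \<nu>0 > 0"
  shows "((\<lambda>(\<nu>, q, t). start_power \<nu> q t) \<longlongrightarrow> 0) (at (\<nu>0, q0, 0) within UNIV \<times> U \<times> {0..1})"
proof -
  obtain r M where r: "0 < r" "r \<le> 1" "ball q0 r \<subseteq> U"
    "\<And>q t. q \<in> ball q0 r \<Longrightarrow> 0 < t \<Longrightarrow> t < r \<Longrightarrow> norm (l0 q t - of_real (ln t)) \<le> M"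
    using l0_near_start[OF q0] by blast
  define e where "e = Re \<nu>0 / 2"
  have e: "e > 0" using \<nu>0 by (simp add: e_def)
  define B where "B = {\<nu>. e < Re \<nu>} \<inter> {\<nu>. norm \<nu> < norm \<nu>0 + 1}"
  have B: "open B" "\<nu>0 \<in> B"
    using \<nu>0 by (auto simp: B_def e_def intro!: open_Int open_Collect_less continuous_intros)
  have bound: "norm (start_power \<nu> q t) \<le> t powr e * exp ((norm \<nu>0 + 1) * M)"
    if "\<nu> \<in> B" "q \<in> ball q0 r" "0 \<le> t" "t < r" for \<nu> q t
  proof (cases "t = 0")
    case False
    then have t: "0 < t" "t < 1" using that r by auto
    have lt: "norm (l0 q t - of_real (ln t)) \<le> M" using r(4) that t by auto
    have "Re (\<nu> * l0 q t) = Re \<nu> * ln t + Re (\<nu> * (l0 q t - of_real (ln t)))"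
      by (simp add: algebra_simps)
    also have "\<dots> \<le> e * ln t + (norm \<nu>0 + 1) * M"
    proof (rule add_mono)
      show "Re \<nu> * ln t \<le> e * ln t"
        using that(1) t by (intro mult_right_mono_neg) (auto simp: B_def)
      have "Re (\<nu> * (l0 q t - of_real (ln t))) \<le> norm \<nu> * norm (l0 q t - of_real (ln t))"
        using complex_Re_le_cmod by (metis norm_mult)
      also have "\<dots> \<le> (norm \<nu>0 + 1) * M"
        using that(1) lt by (intro mult_mono) (auto simp: B_def)
      finally show "Re (\<nu> * (l0 q t - of_real (ln t))) \<le> (norm \<nu>0 + 1) * M" .
    qed
    finally have "exp (Re (\<nu> * l0 q t)) \<le> exp (e * ln t + (norm \<nu>0 + 1) * M)"
      by (simp only: exp_le_cancel_iff)
    then show ?thesis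
      using False t by (simp add: start_power_def norm_exp_eq_Re powr_def exp_add)
  qed (simp add: start_power_def)
  let ?F = "at (\<nu>0, q0, 0) within UNIV \<times> U \<times> {0..1::real}"
  have "\<forall>\<^sub>F z in ?F. z \<in> B \<times> ball q0 r \<times> {-r<..<r}"
    using B r by (intro topological_tendstoD[OF tendsto_ident_at]) (auto simp: open_Times)
  moreover have ev_in: "\<forall>\<^sub>F z in ?F. z \<in> UNIV \<times> U \<times> {0..1}"
    by (simp add: eventually_at_filter)
  ultimately have ev: "\<forall>\<^sub>F z in ?F. norm ((\<lambda>(\<nu>, q, t). start_power \<nu> q t) z) \<le> snd (snd z) powr e * exp ((norm \<nu>0 + 1) * M)"
    by eventually_elim (use bound in auto)
  have "((\<lambda>z. snd (snd z) powr e * exp ((norm \<nu>0 + 1) * M)) \<longlongrightarrow> 0 * exp ((norm \<nu>0 + 1) * M)) ?F"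
  proof (intro tendsto_mult tendsto_const tendsto_zero_powrI[where b=e] e)
    show "((\<lambda>z. snd (snd z)) \<longlongrightarrow> 0) ?F"
      by (auto intro!: tendsto_eq_intros)
    show "\<forall>\<^sub>F z in ?F. 0 \<le> snd (snd z)"
      by (rule eventually_mono[OF ev_in]) auto
  qed
  then show ?thesis
    using Lim_null_comparison[OF ev] by simp
qed

lemma start_power_continuous:
  "continuous_on ({\<nu>. 0 < Re \<nu>} \<times> U \<times> {0..1}) (\<lambda>(\<nu>, q, t). start_power \<nu> q t)"
  unfolding continuous_on_def
proof clarify
  fix \<nu>0 q0 and t0 :: real assume a: "0 < Re \<nu>0" "q0 \<in> U" "t0 \<in> {0..1}"
  let ?D = "{\<nu>. 0 < Re \<nu>} \<times> U \<times> {0..1::real}"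
  show "((\<lambda>(\<nu>, q, t). start_power \<nu> q t) \<longlongrightarrow> start_power \<nu>0 q0 t0) (at (\<nu>0, q0, t0) within ?D)"
  proof (cases "t0 = 0")
    case True
    then show ?thesis
      using tendsto_within_subset[OF start_power_tendsto_0[OF a(2,1)], of ?D] by (auto simp: start_power_def)
  next
    case False
    let ?E = "{\<nu>. 0 < Re \<nu>} \<times> U \<times> {0<..1::real}"
    have "continuous_on ?E (\<lambda>z. exp (fst z * (\<lambda>(q, t). l0 q t) (snd z)))"
      by (intro continuous_intros continuous_on_compose2[OF l0(1)]) auto
    then have "continuous_on ?E (\<lambda>(\<nu>, q, t). start_power \<nu> q t)"
      by (rule continuous_on_eq) (auto simp: start_power_def)
    then have "((\<lambda>(\<nu>, q, t). start_power \<nu> q t) \<longlongrightarrow> start_power \<nu>0 q0 t0) (at (\<nu>0, q0, t0) within ?E)"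
      using a False unfolding continuous_on_def by force
    moreover have "at (\<nu>0, q0, t0) within ?E = at (\<nu>0, q0, t0) within ?D"
      using a False by (intro at_within_nhd[of _ "UNIV \<times> UNIV \<times> {0<..}"]) (auto simp: open_Times)
    ultimately show ?thesis by simp
  qed
qed

lemma integrand_continuous:
  "continuous_on ({\<nu>. 0 < Re \<nu>} \<times> U \<times> {0..1}) (\<lambda>(\<nu>, q, t). integrand \<nu> \<beta> \<delta> q t)"
proof -
  let ?D = "{\<nu>. 0 < Re \<nu>} \<times> U \<times> {0..1::real}"
  have "continuous_on ?D (\<lambda>z. (\<lambda>(\<nu>, q, t). start_power \<nu> q t) z * exp (\<beta> * (\<lambda>(q, t). l1 q t) (snd z) + \<delta> * (\<lambda>(q, t). l2 q t) (snd z))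
      * (X (fst (snd z)) * d\<tau> (snd (snd z))))"
    by (intro continuous_intros start_power_continuous continuous_on_compose2[OF l1(1)] continuous_on_compose2[OF l2(1)]
        continuous_on_compose2[OF X_continuous] continuous_on_compose2[OF d\<tau>(1)]) auto
  then show ?thesis
    by (rule continuous_on_eq) (auto simp: integrand_def)
qed

section \<open>Convergent Euler integrals\<close>

definition end_value :: "complex \<Rightarrow> complex \<Rightarrow> complex \<Rightarrow> complex \<times> complex \<Rightarrow> complex"
  where "end_value \<nu> \<beta> \<delta> q = exp (\<nu> * l0 q 1 + \<beta> * l1 q 1 + \<delta> * l2 q 1)"

definition euler_conv :: "complex \<Rightarrow> complex \<Rightarrow> complex \<Rightarrow> complex \<times> complex \<Rightarrow> complex"
  where "euler_conv \<nu> \<beta> \<delta> q = integral {0..1} (integrand \<nu> \<beta> \<delta> q)"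

text \<open>
  After \<open>n\<close> integrations by parts the integral is expressed by convergent ones as soon as \<open>Re \<nu> > - n\<close> and \<open>\<nu>\<close> is not
  a negative integer.
\<close>

primrec euler_cont :: "nat \<Rightarrow> complex \<Rightarrow> complex \<Rightarrow> complex \<Rightarrow> complex \<times> complex \<Rightarrow> complex"
  where "euler_cont 0 \<nu> \<beta> \<delta> q = euler_conv \<nu> \<beta> \<delta> q"
  | "euler_cont (Suc n) \<nu> \<beta> \<delta> q =
      (end_value (\<nu> + 1) \<beta> \<delta> q + \<beta> * euler_cont n (\<nu> + 1) (\<beta> - 1) \<delta> q + \<delta> * euler_cont n (\<nu> + 1) \<beta> (\<delta> - 1) q) / (\<nu> + 1)"

lemma genericD: "q \<in> U \<Longrightarrow> q \<in> generic"
  using generic by blast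

lemma isCont_slice:
  assumes "continuous_on (U \<times> S') (\<lambda>(q, t). l q t)" "q \<in> U" "t \<in> S'"
  shows "isCont (\<lambda>q. l q t) q"
proof -
  have "continuous_on U (\<lambda>q. l q t)"
    by (rule continuous_on_compose2[OF assms(1), of _ "\<lambda>q. (q, t)", simplified])
      (use assms(3) in \<open>auto intro!: continuous_intros\<close>)
  then show ?thesis using U assms(2) by (simp add: continuous_on_eq_continuous_at)
qed

lemma eventually_nhds_U: "q \<in> U \<Longrightarrow> (\<And>r. r \<in> U \<Longrightarrow> P r) \<Longrightarrow> \<forall>\<^sub>F r in nhds q. P r"
  using U by (auto simp: eventually_nhds)

lemma thetas_l0: "q \<in> U \<Longrightarrow> t \<in> {0<..1} \<Longrightarrow> has_thetas (\<lambda>q. l0 q t) 1 0 q"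
proof -
  assume q: "q \<in> U" and t: "t \<in> {0<..1}"
  have ne: "X q * \<tau> t \<noteq> 0" using l0(2)[OF q t] by (metis exp_not_eq_zero)
  show ?thesis
    by (rule thetas_eq[OF thetas_log[OF isCont_slice[OF l0(1) q t] eventually_nhds_U[OF q l0(2)[OF _ t]]
       thetas_mult[OF thetas_X[OF genericD[OF q]] thetas_const]]]) (use ne in auto)
qed

lemma thetas_l1: "q \<in> U \<Longrightarrow> t \<in> {0..1} \<Longrightarrow> has_thetas (\<lambda>q. l1 q t) (- (X q * \<tau> t) / (1 - X q * \<tau> t)) 0 q"
proof -
  assume q: "q \<in> U" and t: "t \<in> {0..1}"
  show ?thesis
    by (rule thetas_eq[OF thetas_log[OF isCont_slice[OF l1(1) q t] eventually_nhds_U[OF q l1(2)[OF _ t]]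
       thetas_diff[OF thetas_const thetas_mult[OF thetas_X[OF genericD[OF q]] thetas_const]]]]) auto
qed

lemma thetas_l2: "q \<in> U \<Longrightarrow> t \<in> {0..1} \<Longrightarrow> has_thetas (\<lambda>q. l2 q t) 1 (XY q / (XY q - X q * \<tau> t)) q"
proof -
  assume q: "q \<in> U" and t: "t \<in> {0..1}"
  have ne: "XY q - X q * \<tau> t \<noteq> 0" using l2(2)[OF q t] by (metis exp_not_eq_zero)
  show ?thesis
    by (rule thetas_eq[OF thetas_log[OF isCont_slice[OF l2(1) q t] eventually_nhds_U[OF q l2(2)[OF _ t]]
       thetas_diff[OF thetas_XY[OF genericD[OF q]] thetas_mult[OF thetas_X[OF genericD[OF q]] thetas_const]]]]) (use ne in auto)
qed

lemma factors_nonzero: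
  assumes "q \<in> U" "t \<in> {0..1}"
  shows "1 - X q * \<tau> t \<noteq> 0" "XY q - X q * \<tau> t \<noteq> 0"
  using l1(2)[OF assms] l2(2)[OF assms] by (metis exp_not_eq_zero)+

lemma exp_shift:
  assumes "q \<in> U" "t \<in> {0<..1}"
  shows "exp ((\<nu> + 1) * l0 q t + \<beta> * l1 q t + \<delta> * l2 q t) = X q * \<tau> t * exp (\<nu> * l0 q t + \<beta> * l1 q t + \<delta> * l2 q t)"
    "exp (\<nu> * l0 q t + (\<beta> - 1) * l1 q t + \<delta> * l2 q t) = exp (\<nu> * l0 q t + \<beta> * l1 q t + \<delta> * l2 q t) / (1 - X q * \<tau> t)"
    "exp (\<nu> * l0 q t + \<beta> * l1 q t + (\<delta> - 1) * l2 q t) = exp (\<nu> * l0 q t + \<beta> * l1 q t + \<delta> * l2 q t) / (XY q - X q * \<tau> t)"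
proof -
  have t: "t \<in> {0..1}" using assms by auto
  show "exp ((\<nu> + 1) * l0 q t + \<beta> * l1 q t + \<delta> * l2 q t) = X q * \<tau> t * exp (\<nu> * l0 q t + \<beta> * l1 q t + \<delta> * l2 q t)"
    unfolding l0(2)[OF assms, symmetric] exp_add[symmetric] by (simp add: algebra_simps)
  show "exp (\<nu> * l0 q t + (\<beta> - 1) * l1 q t + \<delta> * l2 q t) = exp (\<nu> * l0 q t + \<beta> * l1 q t + \<delta> * l2 q t) / (1 - X q * \<tau> t)"
    unfolding l1(2)[OF assms(1) t, symmetric] exp_diff[symmetric] by (simp add: algebra_simps)
  show "exp (\<nu> * l0 q t + \<beta> * l1 q t + (\<delta> - 1) * l2 q t) = exp (\<nu> * l0 q t + \<beta> * l1 q t + \<delta> * l2 q t) / (XY q - X q * \<tau> t)"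
    unfolding l2(2)[OF assms(1) t, symmetric] exp_diff[symmetric] by (simp add: algebra_simps)
qed

lemma integrand_eq: "t \<noteq> 0 \<Longrightarrow> integrand \<nu> \<beta> \<delta> q t = exp (\<nu> * l0 q t + \<beta> * l1 q t + \<delta> * l2 q t) * (X q * d\<tau> t)"
  by (simp add: integrand_def start_power_def exp_add)

lemma integrand_0: "integrand \<nu> \<beta> \<delta> q 0 = 0"
  by (simp add: integrand_def start_power_def)

lemma integrand_shift:
  assumes "q \<in> U" "t \<in> {0..1}"
  shows "integrand (\<nu> + 1) \<beta> \<delta> q t = X q * \<tau> t * integrand \<nu> \<beta> \<delta> q t"
    "integrand \<nu> (\<beta> - 1) \<delta> q t = integrand \<nu> \<beta> \<delta> q t / (1 - X q * \<tau> t)"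
    "integrand \<nu> \<beta> (\<delta> - 1) q t = integrand \<nu> \<beta> \<delta> q t / (XY q - X q * \<tau> t)"
  using exp_shift[OF assms(1), of t] assms(2) by (cases "t = 0"; simp add: integrand_0 integrand_eq)+

lemma thetas_exps:
  assumes "q \<in> U" "t \<in> {0<..1}"
  shows "has_thetas (\<lambda>q. exp (\<nu> * l0 q t + \<beta> * l1 q t + \<delta> * l2 q t))
    ((\<nu> + \<delta>) * exp (\<nu> * l0 q t + \<beta> * l1 q t + \<delta> * l2 q t) - \<beta> * exp ((\<nu> + 1) * l0 q t + (\<beta> - 1) * l1 q t + \<delta> * l2 q t))
    (\<delta> * XY q * exp (\<nu> * l0 q t + \<beta> * l1 q t + (\<delta> - 1) * l2 q t)) q"
proof -
  have t: "t \<in> {0..1}" using assms by auto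
  show ?thesis
    unfolding exp_shift[OF assms]
    by (rule thetas_eq[OF thetas_exp[OF thetas_add[OF thetas_add[OF thetas_cmult[OF thetas_l0[OF assms]] thetas_cmult[OF thetas_l1[OF assms(1) t]]]
          thetas_cmult[OF thetas_l2[OF assms(1) t]]]]])
       (use factors_nonzero[OF assms(1) t] in \<open>simp_all add: field_simps\<close>)
qed

text \<open>
  Here \<open>\<theta> s = s\<close>, \<open>\<theta> (1 - s) = - s\<close>, \<open>\<theta> (T - s) = T - s\<close>, while \<open>\<theta>'\<close> affects only \<open>T\<close>. The summand \<open>1\<close> in the first
  coefficient stems from \<open>ds = X d\<tau>\<close>.
\<close>

lemma thetas_integrand:
  assumes "q \<in> U" "t \<in> {0..1}"
  shows "has_thetas (\<lambda>q. integrand \<nu> \<beta> \<delta> q t)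
    ((\<nu> + \<delta> + 1) * integrand \<nu> \<beta> \<delta> q t - \<beta> * integrand (\<nu> + 1) (\<beta> - 1) \<delta> q t) (\<delta> * XY q * integrand \<nu> \<beta> (\<delta> - 1) q t) q"
proof (cases "t = 0")
  case True
  then show ?thesis using thetas_const[of 0 q] by (simp add: integrand_0)
next
  case False
  then have t: "t \<in> {0<..1}" using assms by auto
  show ?thesis
    unfolding integrand_eq[OF False]
    by (rule thetas_eq[OF thetas_mult[OF thetas_exps[OF assms(1) t] thetas_mult[OF thetas_X[OF genericD[OF assms(1)]] thetas_const[of "d\<tau> t"]]]])
      (simp_all add: algebra_simps)
qed

lemma thetas_end_value:
  assumes "q \<in> U"
  shows "has_thetas (end_value \<nu> \<beta> \<delta>) ((\<nu> + \<delta>) * end_value \<nu> \<beta> \<delta> q - \<beta> * end_value (\<nu> + 1) (\<beta> - 1) \<delta> q)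
    (\<delta> * XY q * end_value \<nu> \<beta> (\<delta> - 1) q) q"
  using thetas_exps[OF assms, of 1 \<nu> \<beta> \<delta>] by (simp add: end_value_def[abs_def])

lemma end_value_shift:
  assumes "q \<in> U"
  shows "end_value (\<nu> + 1) \<beta> \<delta> q = X q * end_value \<nu> \<beta> \<delta> q"
    "end_value \<nu> (\<beta> - 1) \<delta> q = end_value \<nu> \<beta> \<delta> q / (1 - X q)"
    "end_value \<nu> \<beta> (\<delta> - 1) q = end_value \<nu> \<beta> \<delta> q / (XY q - X q)"
  using exp_shift[OF assms, of 1] ends by (simp_all add: end_value_def)

lemma integrand_continuous_t:
  assumes "0 < Re \<nu>" "q \<in> U"
  shows "continuous_on {0..1} (integrand \<nu> \<beta> \<delta> q)"
proof -
  have "continuous_on {0..1} (\<lambda>t. (\<lambda>(\<nu>, q, t). integrand \<nu> \<beta> \<delta> q t) (\<nu>, q, t))"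
    by (rule continuous_on_compose2[OF integrand_continuous]) (use assms in \<open>auto intro!: continuous_intros\<close>)
  then show ?thesis by simp
qed

lemma integrand_integrable:
  "0 < Re \<nu> \<Longrightarrow> q \<in> U \<Longrightarrow> integrand \<nu> \<beta> \<delta> q integrable_on {0..1}"
  by (intro integrable_continuous_interval integrand_continuous_t)

lemma integrand_has_integral:
  "0 < Re \<nu> \<Longrightarrow> q \<in> U \<Longrightarrow> (integrand \<nu> \<beta> \<delta> q has_integral euler_conv \<nu> \<beta> \<delta> q) {0..1}"
  unfolding euler_conv_def by (intro integrable_integral integrand_integrable)

lemma integrand_continuous_q:
  assumes "0 < Re \<nu>"
  shows "continuous_on (U \<times> {0..1}) (\<lambda>(q, t). integrand \<nu> \<beta> \<delta> q t)"
proof -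
  have "continuous_on (U \<times> {0..1}) (\<lambda>z. (\<lambda>(\<nu>, q, t). integrand \<nu> \<beta> \<delta> q t) (\<nu>, z))"
    by (rule continuous_on_compose2[OF integrand_continuous]) (use assms in \<open>auto intro!: continuous_intros\<close>)
  then show ?thesis by (simp add: case_prod_beta')
qed

lemma euler_conv_slices:
  assumes \<nu>: "0 < Re \<nu>" and q: "(x, y) \<in> U"
  shows "((\<lambda>x. euler_conv \<nu> \<beta> \<delta> (x, y)) has_field_derivative integral {0..1} (\<lambda>t. dx (\<lambda>q. integrand \<nu> \<beta> \<delta> q t) (x, y))) (at x)"
    "((\<lambda>y. euler_conv \<nu> \<beta> \<delta> (x, y)) has_field_derivative integral {0..1} (\<lambda>t. dy (\<lambda>q. integrand \<nu> \<beta> \<delta> q t) (x, y))) (at y)"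
proof -
  have hol: "holomorphic2_on (\<lambda>q. integrand \<nu> \<beta> \<delta> q t) U" if "t \<in> {0..1}" for t
    by (rule holomorphic2_onI_thetas[OF thetas_integrand[OF _ that]])
  note slices = holomorphic2_on_slices[OF hol]
  have c1: "continuous_on ({x. (x, y) \<in> U} \<times> {0..1}) (\<lambda>z. (\<lambda>(q, t). integrand \<nu> \<beta> \<delta> q t) ((fst z, y), snd z))"
    by (rule continuous_on_compose2[OF integrand_continuous_q[OF \<nu>]]) (auto intro!: continuous_intros)
  have c2: "continuous_on ({y. (x, y) \<in> U} \<times> {0..1}) (\<lambda>z. (\<lambda>(q, t). integrand \<nu> \<beta> \<delta> q t) ((x, fst z), snd z))"
    by (rule continuous_on_compose2[OF integrand_continuous_q[OF \<nu>]]) (auto intro!: continuous_intros)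
  show "((\<lambda>x. euler_conv \<nu> \<beta> \<delta> (x, y)) has_field_derivative integral {0..1} (\<lambda>t. dx (\<lambda>q. integrand \<nu> \<beta> \<delta> q t) (x, y))) (at x)"
    unfolding euler_conv_def dx_def prod.case
    by (rule has_field_derivative_integral_param[where V="{x. (x, y) \<in> U}" and f="\<lambda>x t. integrand \<nu> \<beta> \<delta> (x, y) t"])
      (use c1 q slices(1) open_slices(1)[OF U] in \<open>auto simp: case_prod_beta'\<close>)
  show "((\<lambda>y. euler_conv \<nu> \<beta> \<delta> (x, y)) has_field_derivative integral {0..1} (\<lambda>t. dy (\<lambda>q. integrand \<nu> \<beta> \<delta> q t) (x, y))) (at y)"
    unfolding euler_conv_def dy_def prod.case
    by (rule has_field_derivative_integral_param[where V="{y. (x, y) \<in> U}" and f="\<lambda>y t. integrand \<nu> \<beta> \<delta> (x, y) t"])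
      (use c2 q slices(2) open_slices(2)[OF U] in \<open>auto simp: case_prod_beta'\<close>)
qed

lemma thetas_euler_conv:
  assumes \<nu>: "0 < Re \<nu>" and q: "q \<in> U"
  shows "has_thetas (euler_conv \<nu> \<beta> \<delta>) ((\<nu> + \<delta> + 1) * euler_conv \<nu> \<beta> \<delta> q - \<beta> * euler_conv (\<nu> + 1) (\<beta> - 1) \<delta> q) (\<delta> * XY q * euler_conv \<nu> \<beta> (\<delta> - 1) q) q"
proof -
  have cont: "continuous_on U (euler_conv \<nu> \<beta> \<delta>)"
    unfolding euler_conv_def[abs_def] using integral_continuous_on_param[of U 0 1 "integrand \<nu> \<beta> \<delta>"] integrand_continuous_q[OF \<nu>] by simp
  have "has_partials (euler_conv \<nu> \<beta> \<delta>) (dx (euler_conv \<nu> \<beta> \<delta>) q) (dy (euler_conv \<nu> \<beta> \<delta>) q) q"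
  proof (rule osgood_partials[OF U cont _ _ q])
    show "(\<lambda>x. euler_conv \<nu> \<beta> \<delta> (x, y)) holomorphic_on {x. (x, y) \<in> U}" for y
      unfolding holomorphic_on_def field_differentiable_def
      using euler_conv_slices(1)[OF \<nu>] has_field_derivative_at_within by blast
    show "(\<lambda>y. euler_conv \<nu> \<beta> \<delta> (x, y)) holomorphic_on {y. (x, y) \<in> U}" for x
      unfolding holomorphic_on_def field_differentiable_def
      using euler_conv_slices(2)[OF \<nu>] has_field_derivative_at_within by blast
  qed
  moreover have "dx (euler_conv \<nu> \<beta> \<delta>) q = ((\<nu> + \<delta> + 1) * euler_conv \<nu> \<beta> \<delta> q - \<beta> * euler_conv (\<nu> + 1) (\<beta> - 1) \<delta> q) / (fst q * (1 - fst q))"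
  proof -
    have "dx (euler_conv \<nu> \<beta> \<delta>) q = integral {0..1} (\<lambda>t. dx (\<lambda>q. integrand \<nu> \<beta> \<delta> q t) q)"
      using DERIV_imp_deriv[OF euler_conv_slices(1)[OF \<nu>, of "fst q" "snd q"]] q by (simp add: dx_def case_prod_beta')
    also have "\<dots> = ((\<nu> + \<delta> + 1) * euler_conv \<nu> \<beta> \<delta> q - \<beta> * euler_conv (\<nu> + 1) (\<beta> - 1) \<delta> q) / (fst q * (1 - fst q))"
    proof (rule integral_unique, rule has_integral_eq)
      show "((\<lambda>t. ((\<nu> + \<delta> + 1) * integrand \<nu> \<beta> \<delta> q t - \<beta> * integrand (\<nu> + 1) (\<beta> - 1) \<delta> q t) / (fst q * (1 - fst q))) has_integral
         ((\<nu> + \<delta> + 1) * euler_conv \<nu> \<beta> \<delta> q - \<beta> * euler_conv (\<nu> + 1) (\<beta> - 1) \<delta> q) / (fst q * (1 - fst q))) {0..1}"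
        by (intro has_integral_divide has_integral_diff has_integral_mult_right integrand_has_integral) (use \<nu> q in auto)
    qed (use partials_dx[OF thetas_integrand[OF q, unfolded has_thetas_def]] in auto)
    finally show ?thesis .
  qed
  moreover have "dy (euler_conv \<nu> \<beta> \<delta>) q = (\<delta> * XY q * euler_conv \<nu> \<beta> (\<delta> - 1) q) / (snd q * (1 - snd q))"
  proof -
    have "dy (euler_conv \<nu> \<beta> \<delta>) q = integral {0..1} (\<lambda>t. dy (\<lambda>q. integrand \<nu> \<beta> \<delta> q t) q)"
      using DERIV_imp_deriv[OF euler_conv_slices(2)[OF \<nu>, of "fst q" "snd q"]] q by (simp add: dy_def case_prod_beta')
    also have "\<dots> = (\<delta> * XY q * euler_conv \<nu> \<beta> (\<delta> - 1) q) / (snd q * (1 - snd q))"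
    proof (rule integral_unique, rule has_integral_eq)
      show "((\<lambda>t. (\<delta> * XY q * integrand \<nu> \<beta> (\<delta> - 1) q t) / (snd q * (1 - snd q))) has_integral
         (\<delta> * XY q * euler_conv \<nu> \<beta> (\<delta> - 1) q) / (snd q * (1 - snd q))) {0..1}"
        by (intro has_integral_divide has_integral_mult_right integrand_has_integral) (use \<nu> q in auto)
    qed (use partials_dy[OF thetas_integrand[OF q, unfolded has_thetas_def]] in auto)
    finally show ?thesis .
  qed
  ultimately show ?thesis by (simp add: has_thetas_def)
qed

text \<open>
  The function \<open>s^(\<nu>+1) (1 - s)^\<beta> (T - s)^\<delta>\<close> is continuous up to \<open>t = 0\<close> already for \<open>Re \<nu> > - 1\<close>, so the
  fundamental theorem also yields the integrability of \<open>s^\<nu> (1 - s)^\<beta> (T - s)^\<delta>\<close> in the range where it is unbounded.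
\<close>

lemma integration_by_parts:
  assumes \<nu>: "-1 < Re \<nu>" and q: "q \<in> U"
  shows "((\<lambda>t. (\<nu> + 1) * integrand \<nu> \<beta> \<delta> q t - \<beta> * integrand (\<nu> + 1) (\<beta> - 1) \<delta> q t - \<delta> * integrand (\<nu> + 1) \<beta> (\<delta> - 1) q t)
    has_integral end_value (\<nu> + 1) \<beta> \<delta> q) {0..1}"
proof -
  define F where "F = (\<lambda>t. start_power (\<nu> + 1) q t * exp (\<beta> * l1 q t + \<delta> * l2 q t))"
  have c0: "continuous_on {0<..1} (l0 q)" and c1: "continuous_on {0..1} (l1 q)" and c2: "continuous_on {0..1} (l2 q)"
  proof -
    have "continuous_on {0<..1} (\<lambda>t. (\<lambda>(q, t). l0 q t) (q, t))"
      by (rule continuous_on_compose2[OF l0(1)]) (use q in \<open>auto intro!: continuous_intros\<close>)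
    moreover have "continuous_on {0..1} (\<lambda>t. (\<lambda>(q, t). l1 q t) (q, t))"
      by (rule continuous_on_compose2[OF l1(1)]) (use q in \<open>auto intro!: continuous_intros\<close>)
    moreover have "continuous_on {0..1} (\<lambda>t. (\<lambda>(q, t). l2 q t) (q, t))"
      by (rule continuous_on_compose2[OF l2(1)]) (use q in \<open>auto intro!: continuous_intros\<close>)
    ultimately show "continuous_on {0<..1} (l0 q)" "continuous_on {0..1} (l1 q)" "continuous_on {0..1} (l2 q)"
      by simp_all
  qed
  have cpw: "continuous_on {0..1} (\<lambda>t. (\<lambda>(\<nu>, q, t). start_power \<nu> q t) (\<nu> + 1, q, t))"
    by (rule continuous_on_compose2[OF start_power_continuous]) (use \<nu> q in \<open>auto intro!: continuous_intros\<close>)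
  have "continuous_on {0..1} F"
    unfolding F_def using cpw c1 c2 by (intro continuous_intros) simp_all
  moreover have "(F has_vector_derivative ((\<nu> + 1) * integrand \<nu> \<beta> \<delta> q t - \<beta> * integrand (\<nu> + 1) (\<beta> - 1) \<delta> q t - \<delta> * integrand (\<nu> + 1) \<beta> (\<delta> - 1) q t)) (at t)"
    if t: "t \<in> {0<..<1}" for t
  proof -
    have tt: "t \<in> {0<..1}" "t \<in> {0..1}" using t by auto
    have d\<tau>: "(\<tau> has_vector_derivative d\<tau> t) (at t)" using \<tau> tt by auto
    have v0: "(l0 q has_vector_derivative (X q * d\<tau> t) / (X q * \<tau> t)) (at t)"
      by (rule log_has_vector_derivative[OF _ t continuous_on_subset[OF c0]])
        (use l0(2)[OF q] d\<tau> in \<open>auto intro!: derivative_eq_intros\<close>)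
    have v1: "(l1 q has_vector_derivative (- (X q * d\<tau> t)) / (1 - X q * \<tau> t)) (at t)"
      by (rule log_has_vector_derivative[OF _ t continuous_on_subset[OF c1]])
        (use l1(2)[OF q] d\<tau> in \<open>auto intro!: derivative_eq_intros\<close>)
    have v2: "(l2 q has_vector_derivative (- (X q * d\<tau> t)) / (XY q - X q * \<tau> t)) (at t)"
      by (rule log_has_vector_derivative[OF _ t continuous_on_subset[OF c2]])
        (use l2(2)[OF q] d\<tau> in \<open>auto intro!: derivative_eq_intros\<close>)
    define e where "e = exp (\<nu> * l0 q t + \<beta> * l1 q t + \<delta> * l2 q t)"
    have \<tau>ne: "X q * \<tau> t \<noteq> 0" using l0(2)[OF q tt(1)] by (metis exp_not_eq_zero)
    have "((\<lambda>t. (\<nu> + 1) * l0 q t + \<beta> * l1 q t + \<delta> * l2 q t) has_vector_derivative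
      (\<nu> + 1) * ((X q * d\<tau> t) / (X q * \<tau> t)) + \<beta> * ((- (X q * d\<tau> t)) / (1 - X q * \<tau> t)) + \<delta> * ((- (X q * d\<tau> t)) / (XY q - X q * \<tau> t))) (at t)"
      by (intro has_vector_derivative_add has_vector_derivative_mult_right v0 v1 v2)
    from field_vector_diff_chain_at[OF this DERIV_exp]
    have D: "((\<lambda>t. exp ((\<nu> + 1) * l0 q t + \<beta> * l1 q t + \<delta> * l2 q t)) has_vector_derivative
      ((\<nu> + 1) * ((X q * d\<tau> t) / (X q * \<tau> t)) + \<beta> * ((- (X q * d\<tau> t)) / (1 - X q * \<tau> t))
         + \<delta> * ((- (X q * d\<tau> t)) / (XY q - X q * \<tau> t))) * exp ((\<nu> + 1) * l0 q t + \<beta> * l1 q t + \<delta> * l2 q t)) (at t)"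
      unfolding o_def .
    have alg: "((\<nu> + 1) * (w / s) + \<beta> * (- w / A) + \<delta> * (- w / B)) * (s * e)
       = (\<nu> + 1) * (e * w) - \<beta> * (s * (e * w) / A) - \<delta> * (s * (e * w) / B)"
      if "s \<noteq> 0" "A \<noteq> 0" "B \<noteq> 0" for w s A B e :: complex
      using that by (simp add: field_simps)
    have k: "integrand \<nu> \<beta> \<delta> q t = e * (X q * d\<tau> t)" "integrand (\<nu> + 1) (\<beta> - 1) \<delta> q t = X q * \<tau> t * (e * (X q * d\<tau> t)) / (1 - X q * \<tau> t)"
      "integrand (\<nu> + 1) \<beta> (\<delta> - 1) q t = X q * \<tau> t * (e * (X q * d\<tau> t)) / (XY q - X q * \<tau> t)"
      unfolding integrand_shift(2,3)[OF q tt(2)] integrand_shift(1)[OF q tt(2)] using t by (simp_all add: integrand_eq e_def)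
    have "((\<lambda>t. exp ((\<nu> + 1) * l0 q t + \<beta> * l1 q t + \<delta> * l2 q t)) has_vector_derivative
      ((\<nu> + 1) * integrand \<nu> \<beta> \<delta> q t - \<beta> * integrand (\<nu> + 1) (\<beta> - 1) \<delta> q t - \<delta> * integrand (\<nu> + 1) \<beta> (\<delta> - 1) q t)) (at t)"
      using D unfolding exp_shift(1)[OF q tt(1)] e_def[symmetric] alg[OF \<tau>ne factors_nonzero[OF q tt(2)]] k .
    then show ?thesis
    proof (rule has_vector_derivative_transform_within_open[where S="{0<..<1}"])
      show "exp ((\<nu> + 1) * l0 q s + \<beta> * l1 q s + \<delta> * l2 q s) = F s" if "s \<in> {0<..<1}" for s
        using that by (simp add: F_def start_power_def exp_add)
    qed (use t in auto)
  qed
  ultimately have "((\<lambda>t. (\<nu> + 1) * integrand \<nu> \<beta> \<delta> q t - \<beta> * integrand (\<nu> + 1) (\<beta> - 1) \<delta> q t - \<delta> * integrand (\<nu> + 1) \<beta> (\<delta> - 1) q t)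
    has_integral F 1 - F 0) {0..1}"
    by (intro fundamental_theorem_of_calculus_interior) auto
  then show ?thesis
    by (simp add: F_def start_power_def end_value_def exp_add mult.assoc)
qed

end

section \<open>Analytic continuation in the exponent\<close>

lemma admissible_Suc: "(\<nu>::complex) + 1 \<notin> \<int>\<^sub>\<le>\<^sub>0 \<Longrightarrow> \<nu> + 1 + 1 \<notin> \<int>\<^sub>\<le>\<^sub>0"
  using plus_one_in_nonpos_Ints_imp by blast

lemma admissible_nonzero: "(\<nu>::complex) + 1 \<notin> \<int>\<^sub>\<le>\<^sub>0 \<Longrightarrow> \<nu> + 1 \<noteq> 0"
  by auto

lemma admissible_Re:
  assumes "-1 < Re \<nu>"
  shows "\<nu> + 1 \<notin> \<int>\<^sub>\<le>\<^sub>0"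
proof
  assume "\<nu> + 1 \<in> \<int>\<^sub>\<le>\<^sub>0"
  then obtain n where "\<nu> + 1 = of_int n" "n \<le> 0" by (auto simp: nonpos_Ints_def)
  then have "Re (\<nu> + 1) \<le> 0" by simp
  with assms show False by simp
qed

text \<open>
  Transport of a statement from the half plane of convergence to all exponents that are not negative integers,
  one unit strip at a time.
\<close>

lemma admissible_induct [consumes 1, case_names convergent step]:
  fixes P :: "complex \<Rightarrow> complex \<Rightarrow> complex \<Rightarrow> bool"
  assumes "\<nu> + 1 \<notin> \<int>\<^sub>\<le>\<^sub>0"
    and convergent: "\<And>\<nu> \<beta> \<delta>. 0 < Re \<nu> \<Longrightarrow> P \<nu> \<beta> \<delta>"
    and step: "\<And>\<nu> \<beta> \<delta>. \<nu> + 1 \<notin> \<int>\<^sub>\<le>\<^sub>0 \<Longrightarrow> (\<And>\<beta> \<delta>. P (\<nu> + 1) \<beta> \<delta>) \<Longrightarrow> P \<nu> \<beta> \<delta>"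
  shows "P \<nu> \<beta> \<delta>"
proof -
  have "P \<nu> \<beta> \<delta>" if "\<nu> + 1 \<notin> \<int>\<^sub>\<le>\<^sub>0" "- real n < Re \<nu>" for n \<nu> \<beta> \<delta>
    using that
  proof (induction n arbitrary: \<nu> \<beta> \<delta>)
    case 0
    then show ?case using convergent by simp
  next
    case (Suc n)
    show ?case
      by (rule step[OF Suc.prems(1)], rule Suc.IH) (use Suc.prems admissible_Suc in auto)
  qed
  moreover obtain n where "- Re \<nu> < real n" using reals_Archimedean2 by blast
  ultimately show ?thesis using assms(1) by (metis minus_less_iff)
qed

context integration_path
begin

lemma euler_conv_rec:
  assumes "0 < Re \<nu>" "q \<in> U"
  shows "(\<nu> + 1) * euler_conv \<nu> \<beta> \<delta> q = end_value (\<nu> + 1) \<beta> \<delta> q + \<beta> * euler_conv (\<nu> + 1) (\<beta> - 1) \<delta> q + \<delta> * euler_conv (\<nu> + 1) \<beta> (\<delta> - 1) q"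
proof -
  have "((\<lambda>t. (\<nu> + 1) * integrand \<nu> \<beta> \<delta> q t - \<beta> * integrand (\<nu> + 1) (\<beta> - 1) \<delta> q t - \<delta> * integrand (\<nu> + 1) \<beta> (\<delta> - 1) q t)
    has_integral (\<nu> + 1) * euler_conv \<nu> \<beta> \<delta> q - \<beta> * euler_conv (\<nu> + 1) (\<beta> - 1) \<delta> q - \<delta> * euler_conv (\<nu> + 1) \<beta> (\<delta> - 1) q) {0..1}"
    by (intro has_integral_diff has_integral_mult_right integrand_has_integral) (use assms in auto)
  from has_integral_unique[OF this integration_by_parts[of \<nu> q \<beta> \<delta>]] show ?thesis
    using assms by (simp add: algebra_simps)
qed

lemma euler_cont_Suc_eq:
  assumes "- real n < Re \<nu>" "\<nu> + 1 \<notin> \<int>\<^sub>\<le>\<^sub>0" "q \<in> U"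
  shows "euler_cont (Suc n) \<nu> \<beta> \<delta> q = euler_cont n \<nu> \<beta> \<delta> q"
  using assms
proof (induction n arbitrary: \<nu> \<beta> \<delta>)
  case 0
  then show ?case
    using euler_conv_rec[of \<nu> q \<beta> \<delta>] admissible_nonzero[of \<nu>] by (simp add: field_simps)
next
  case (Suc n)
  have IH: "euler_cont (Suc n) (\<nu> + 1) \<beta> \<delta> q = euler_cont n (\<nu> + 1) \<beta> \<delta> q" for \<beta> \<delta>
    by (rule Suc.IH) (use Suc.prems admissible_Suc in auto)
  show ?case
    by (subst (1 2) euler_cont.simps(2)) (simp only: IH)
qed

text \<open>
  The number of integrations by parts is one that suffices for the given exponent; by \<open>euler_cont_Suc_eq\<close> any
  larger one gives the same value.
\<close>

definition euler :: "complex \<Rightarrow> complex \<Rightarrow> complex \<Rightarrow> complex \<times> complex \<Rightarrow> complex"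
  where "euler \<nu> \<beta> \<delta> q = euler_cont (nat \<lceil>1 - Re \<nu>\<rceil>) \<nu> \<beta> \<delta> q"

lemma euler_eq:
  assumes "- real n < Re \<nu>" "\<nu> + 1 \<notin> \<int>\<^sub>\<le>\<^sub>0" "q \<in> U"
  shows "euler \<nu> \<beta> \<delta> q = euler_cont n \<nu> \<beta> \<delta> q"
proof -
  have le: "euler_cont m \<nu> \<beta> \<delta> q = euler_cont k \<nu> \<beta> \<delta> q" if "k \<le> m" "- real k < Re \<nu>" for k m
    using that(1)
  proof (induction m rule: dec_induct)
    case (step m)
    then show ?case using euler_cont_Suc_eq[of m \<nu> q \<beta> \<delta>] assms that(2) by simp
  qed simp
  define k where "k = nat \<lceil>1 - Re \<nu>\<rceil>"
  have "1 - Re \<nu> \<le> real k" unfolding k_def by linarith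
  then have k: "- real k < Re \<nu>" by simp
  have "euler_cont (max n k) \<nu> \<beta> \<delta> q = euler_cont n \<nu> \<beta> \<delta> q" "euler_cont (max n k) \<nu> \<beta> \<delta> q = euler_cont k \<nu> \<beta> \<delta> q"
    by (intro le assms k; simp)+
  then show ?thesis by (simp add: euler_def k_def)
qed

lemma euler_convergent: "0 < Re \<nu> \<Longrightarrow> q \<in> U \<Longrightarrow> euler \<nu> \<beta> \<delta> q = euler_conv \<nu> \<beta> \<delta> q"
  using euler_eq[of 0 \<nu> q \<beta> \<delta>] admissible_Re[of \<nu>] by simp

lemma euler_rec:
  assumes "\<nu> + 1 \<notin> \<int>\<^sub>\<le>\<^sub>0" "q \<in> U"
  shows "(\<nu> + 1) * euler \<nu> \<beta> \<delta> q = end_value (\<nu> + 1) \<beta> \<delta> q + \<beta> * euler (\<nu> + 1) (\<beta> - 1) \<delta> q + \<delta> * euler (\<nu> + 1) \<beta> (\<delta> - 1) q"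
proof -
  obtain n where n: "- Re (\<nu> + 1) < real n" using reals_Archimedean2 by blast
  have "euler \<nu> \<beta> \<delta> q = euler_cont (Suc n) \<nu> \<beta> \<delta> q" using n assms by (intro euler_eq) auto
  moreover have "euler (\<nu> + 1) \<beta> \<delta> q = euler_cont n (\<nu> + 1) \<beta> \<delta> q" for \<beta> \<delta>
    using n assms admissible_Suc by (intro euler_eq) auto
  ultimately show ?thesis using admissible_nonzero[OF assms(1)] by simp
qed

text \<open>
  Multiplication of the integrand by \<open>1 - s\<close>. In the inductive step the boundary terms of the two sides differ by
  \<open>end_value (\<nu> + 2) \<beta> \<delta>\<close>, which is the boundary term of the recursion at \<open>\<nu> + 1\<close>.
\<close>

lemma euler_shift_\<beta>:
  assumes "\<nu> + 1 \<notin> \<int>\<^sub>\<le>\<^sub>0" "q \<in> U"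
  shows "euler \<nu> (\<beta> + 1) \<delta> q = euler \<nu> \<beta> \<delta> q - euler (\<nu> + 1) \<beta> \<delta> q"
  using assms(1)
proof (induction \<nu> \<beta> \<delta> rule: admissible_induct)
  case (convergent \<nu> \<beta> \<delta>)
  have "((\<lambda>t. integrand \<nu> \<beta> \<delta> q t - integrand (\<nu> + 1) \<beta> \<delta> q t) has_integral (euler_conv \<nu> \<beta> \<delta> q - euler_conv (\<nu> + 1) \<beta> \<delta> q)) {0..1}"
    by (intro has_integral_diff integrand_has_integral) (use convergent assms in auto)
  then have "(integrand \<nu> (\<beta> + 1) \<delta> q has_integral (euler_conv \<nu> \<beta> \<delta> q - euler_conv (\<nu> + 1) \<beta> \<delta> q)) {0..1}"
  proof (rule has_integral_eq[rotated])
    fix t :: real assume t: "t \<in> {0..1}"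
    show "integrand \<nu> \<beta> \<delta> q t - integrand (\<nu> + 1) \<beta> \<delta> q t = integrand \<nu> (\<beta> + 1) \<delta> q t"
      using integrand_shift(2)[OF assms(2) t, of \<nu> "\<beta> + 1" \<delta>] factors_nonzero[OF assms(2) t]
      unfolding integrand_shift(1)[OF assms(2) t] by (simp add: field_simps)
  qed
  then have "euler_conv \<nu> (\<beta> + 1) \<delta> q = euler_conv \<nu> \<beta> \<delta> q - euler_conv (\<nu> + 1) \<beta> \<delta> q"
    using integrand_has_integral[of \<nu> q "\<beta> + 1" \<delta>] convergent assms has_integral_unique by blast
  then show ?case using convergent assms by (simp add: euler_convergent)
next
  case (step \<nu> \<beta> \<delta>)
  note a2 = admissible_Suc[OF step.hyps]
  have e: "end_value (\<nu> + 1) (\<beta> + 1) \<delta> q = (1 - X q) * end_value (\<nu> + 1) \<beta> \<delta> q"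
    using end_value_shift(2)[OF assms(2), of "\<nu> + 1" "\<beta> + 1" \<delta>] factors_nonzero(1)[OF assms(2), of 1] ends by simp
  have 1: "euler (\<nu> + 1) \<beta> \<delta> q = euler (\<nu> + 1) (\<beta> - 1) \<delta> q - euler (\<nu> + 1 + 1) (\<beta> - 1) \<delta> q"
    "euler (\<nu> + 1) (\<beta> + 1) (\<delta> - 1) q = euler (\<nu> + 1) \<beta> (\<delta> - 1) q - euler (\<nu> + 1 + 1) \<beta> (\<delta> - 1) q"
    "(\<nu> + 1) * euler \<nu> (\<beta> + 1) \<delta> q = end_value (\<nu> + 1) (\<beta> + 1) \<delta> q + (\<beta> + 1) * euler (\<nu> + 1) \<beta> \<delta> q + \<delta> * euler (\<nu> + 1) (\<beta> + 1) (\<delta> - 1) q"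
    using step.IH[of "\<beta> - 1" \<delta>] step.IH[of \<beta> "\<delta> - 1"] euler_rec[OF step.hyps assms(2), of "\<beta> + 1" \<delta>] by simp_all
  have "(\<nu> + 1) * (euler \<nu> (\<beta> + 1) \<delta> q - (euler \<nu> \<beta> \<delta> q - euler (\<nu> + 1) \<beta> \<delta> q)) = 0"
    using euler_rec[OF a2 assms(2), of \<beta> \<delta>] euler_rec[OF step.hyps assms(2), of \<beta> \<delta>] e 1
      end_value_shift(1)[OF assms(2), of "\<nu> + 1" \<beta> \<delta>] by algebra
  then show ?case using admissible_nonzero[OF step.hyps] by simp
qed

lemma euler_shift_\<delta>:
  assumes "\<nu> + 1 \<notin> \<int>\<^sub>\<le>\<^sub>0" "q \<in> U"
  shows "euler \<nu> \<beta> (\<delta> + 1) q = XY q * euler \<nu> \<beta> \<delta> q - euler (\<nu> + 1) \<beta> \<delta> q"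
  using assms(1)
proof (induction \<nu> \<beta> \<delta> rule: admissible_induct)
  case (convergent \<nu> \<beta> \<delta>)
  have "((\<lambda>t. XY q * integrand \<nu> \<beta> \<delta> q t - integrand (\<nu> + 1) \<beta> \<delta> q t) has_integral (XY q * euler_conv \<nu> \<beta> \<delta> q - euler_conv (\<nu> + 1) \<beta> \<delta> q)) {0..1}"
    by (intro has_integral_diff has_integral_mult_right integrand_has_integral) (use convergent assms in auto)
  then have "(integrand \<nu> \<beta> (\<delta> + 1) q has_integral (XY q * euler_conv \<nu> \<beta> \<delta> q - euler_conv (\<nu> + 1) \<beta> \<delta> q)) {0..1}"
  proof (rule has_integral_eq[rotated])
    fix t :: real assume t: "t \<in> {0..1}"
    show "XY q * integrand \<nu> \<beta> \<delta> q t - integrand (\<nu> + 1) \<beta> \<delta> q t = integrand \<nu> \<beta> (\<delta> + 1) q t"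
      using integrand_shift(3)[OF assms(2) t, of \<nu> \<beta> "\<delta> + 1"] factors_nonzero[OF assms(2) t]
      unfolding integrand_shift(1)[OF assms(2) t] by (simp add: field_simps)
  qed
  then have "euler_conv \<nu> \<beta> (\<delta> + 1) q = XY q * euler_conv \<nu> \<beta> \<delta> q - euler_conv (\<nu> + 1) \<beta> \<delta> q"
    using integrand_has_integral[of \<nu> q \<beta> "\<delta> + 1"] convergent assms has_integral_unique by blast
  then show ?case using convergent assms by (simp add: euler_convergent)
next
  case (step \<nu> \<beta> \<delta>)
  note a2 = admissible_Suc[OF step.hyps]
  have e: "end_value (\<nu> + 1) \<beta> (\<delta> + 1) q = (XY q - X q) * end_value (\<nu> + 1) \<beta> \<delta> q"
    using end_value_shift(3)[OF assms(2), of "\<nu> + 1" \<beta> "\<delta> + 1"] factors_nonzero(2)[OF assms(2), of 1] ends by simp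
  have 1: "euler (\<nu> + 1) (\<beta> - 1) (\<delta> + 1) q = XY q * euler (\<nu> + 1) (\<beta> - 1) \<delta> q - euler (\<nu> + 1 + 1) (\<beta> - 1) \<delta> q"
    "euler (\<nu> + 1) \<beta> \<delta> q = XY q * euler (\<nu> + 1) \<beta> (\<delta> - 1) q - euler (\<nu> + 1 + 1) \<beta> (\<delta> - 1) q"
    "(\<nu> + 1) * euler \<nu> \<beta> (\<delta> + 1) q = end_value (\<nu> + 1) \<beta> (\<delta> + 1) q + \<beta> * euler (\<nu> + 1) (\<beta> - 1) (\<delta> + 1) q + (\<delta> + 1) * euler (\<nu> + 1) \<beta> \<delta> q"
    using step.IH[of "\<beta> - 1" \<delta>] step.IH[of \<beta> "\<delta> - 1"] euler_rec[OF step.hyps assms(2), of \<beta> "\<delta> + 1"] by simp_all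
  have "(\<nu> + 1) * (euler \<nu> \<beta> (\<delta> + 1) q - (XY q * euler \<nu> \<beta> \<delta> q - euler (\<nu> + 1) \<beta> \<delta> q)) = 0"
    using euler_rec[OF a2 assms(2), of \<beta> \<delta>] euler_rec[OF step.hyps assms(2), of \<beta> \<delta>] e 1
      end_value_shift(1)[OF assms(2), of "\<nu> + 1" \<beta> \<delta>] by algebra
  then show ?case using admissible_nonzero[OF step.hyps] by simp
qed

text \<open>
  In the inductive step the recursion is differentiated term by term; the result is the recursion for the claimed
  derivatives, for \<open>\<theta>\<close> after one more use of it at \<open>(\<nu> + 1, \<beta> - 1, \<delta>)\<close>.
\<close>

lemma thetas_euler:
  assumes "\<nu> + 1 \<notin> \<int>\<^sub>\<le>\<^sub>0" "q \<in> U"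
  shows "has_thetas (euler \<nu> \<beta> \<delta>) ((\<nu> + \<delta> + 1) * euler \<nu> \<beta> \<delta> q - \<beta> * euler (\<nu> + 1) (\<beta> - 1) \<delta> q) (\<delta> * XY q * euler \<nu> \<beta> (\<delta> - 1) q) q"
  using assms(1)
proof (induction \<nu> \<beta> \<delta> rule: admissible_induct)
  case (convergent \<nu> \<beta> \<delta>)
  have "has_thetas (euler \<nu> \<beta> \<delta>) ((\<nu> + \<delta> + 1) * euler_conv \<nu> \<beta> \<delta> q - \<beta> * euler_conv (\<nu> + 1) (\<beta> - 1) \<delta> q) (\<delta> * XY q * euler_conv \<nu> \<beta> (\<delta> - 1) q) q"
    by (rule thetas_transform[OF thetas_euler_conv[OF convergent assms(2)] U assms(2)]) (use convergent in \<open>simp add: euler_convergent\<close>)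
  then show ?case using convergent assms(2) by (simp add: euler_convergent)
next
  case (step \<nu> \<beta> \<delta>)
  note a2 = admissible_Suc[OF step.hyps] and n0 = admissible_nonzero[OF step.hyps]
  have "has_thetas (\<lambda>q. (end_value (\<nu> + 1) \<beta> \<delta> q + \<beta> * euler (\<nu> + 1) (\<beta> - 1) \<delta> q + \<delta> * euler (\<nu> + 1) \<beta> (\<delta> - 1) q) / (\<nu> + 1))
     ((\<nu> + \<delta> + 1) * euler \<nu> \<beta> \<delta> q - \<beta> * euler (\<nu> + 1) (\<beta> - 1) \<delta> q) (\<delta> * XY q * euler \<nu> \<beta> (\<delta> - 1) q) q"
  proof (rule thetas_eq[OF thetas_divide_const[OF thetas_add[OF thetas_add[OF thetas_end_value[OF assms(2)] thetas_cmult[OF step.IH]] thetas_cmult[OF step.IH]]]])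
    show "((\<nu> + 1 + \<delta>) * end_value (\<nu> + 1) \<beta> \<delta> q - \<beta> * end_value (\<nu> + 1 + 1) (\<beta> - 1) \<delta> q
      + \<beta> * ((\<nu> + 1 + \<delta> + 1) * euler (\<nu> + 1) (\<beta> - 1) \<delta> q - (\<beta> - 1) * euler (\<nu> + 1 + 1) (\<beta> - 1 - 1) \<delta> q)
      + \<delta> * ((\<nu> + 1 + (\<delta> - 1) + 1) * euler (\<nu> + 1) \<beta> (\<delta> - 1) q - \<beta> * euler (\<nu> + 1 + 1) (\<beta> - 1) (\<delta> - 1) q)) / (\<nu> + 1)
      = (\<nu> + \<delta> + 1) * euler \<nu> \<beta> \<delta> q - \<beta> * euler (\<nu> + 1) (\<beta> - 1) \<delta> q"
      unfolding divide_eq_eq if_P[OF n0]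
      using euler_rec[OF step.hyps assms(2), of \<beta> \<delta>] euler_rec[OF a2 assms(2), of "\<beta> - 1" \<delta>] by algebra
    show "(\<delta> * XY q * end_value (\<nu> + 1) \<beta> (\<delta> - 1) q + \<beta> * (\<delta> * XY q * euler (\<nu> + 1) (\<beta> - 1) (\<delta> - 1) q)
      + \<delta> * ((\<delta> - 1) * XY q * euler (\<nu> + 1) \<beta> (\<delta> - 1 - 1) q)) / (\<nu> + 1) = \<delta> * XY q * euler \<nu> \<beta> (\<delta> - 1) q"
      unfolding divide_eq_eq if_P[OF n0]
      using euler_rec[OF step.hyps assms(2), of \<beta> "\<delta> - 1"] by algebra
  qed
  then show ?case
    by (rule thetas_transform[OF _ U assms(2)]) (use euler_rec[OF step.hyps] n0 in \<open>simp add: field_simps\<close>)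
qed

lemma euler_conv_holomorphic_exponent: "q \<in> U \<Longrightarrow> (\<lambda>\<nu>. euler_conv \<nu> \<beta> \<delta> q) holomorphic_on {\<nu>. 0 < Re \<nu>}"
proof -
  assume q: "q \<in> U"
  have op: "open {\<nu>. 0 < Re \<nu>}" by (intro open_Collect_less continuous_intros)
  have "continuous_on ({\<nu>. 0 < Re \<nu>} \<times> {0..1}) (\<lambda>z. (\<lambda>(\<nu>, q, t). integrand \<nu> \<beta> \<delta> q t) (fst z, q, snd z))"
    by (rule continuous_on_compose2[OF integrand_continuous]) (use q in \<open>auto intro!: continuous_intros\<close>)
  then have c: "continuous_on ({\<nu>. 0 < Re \<nu>} \<times> {0..1}) (\<lambda>(\<nu>, t). integrand \<nu> \<beta> \<delta> q t)"
    by (simp add: case_prod_beta')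
  have h: "(\<lambda>\<nu>. integrand \<nu> \<beta> \<delta> q t) holomorphic_on {\<nu>. 0 < Re \<nu>}" for t
    unfolding integrand_def start_power_def by (cases "t = 0") (auto intro!: holomorphic_intros)
  show ?thesis
    unfolding euler_conv_def holomorphic_on_def field_differentiable_def
    using has_field_derivative_integral_param[OF op _ c h] has_field_derivative_at_within by blast
qed

lemma euler_cont_holomorphic:
  assumes "q \<in> U"
  shows "(\<lambda>\<nu>. euler_cont n \<nu> \<beta> \<delta> q) holomorphic_on {\<nu>. - real n < Re \<nu> \<and> \<nu> + 1 \<notin> \<int>\<^sub>\<le>\<^sub>0}"
proof (induction n arbitrary: \<beta> \<delta>)
  case 0
  then show ?case
    by (auto intro!: holomorphic_on_subset[OF euler_conv_holomorphic_exponent[OF assms]])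
next
  case (Suc n)
  have "(\<lambda>\<nu>. euler_cont n (\<nu> + 1) \<beta> \<delta> q) holomorphic_on {\<nu>. - real (Suc n) < Re \<nu> \<and> \<nu> + 1 \<notin> \<int>\<^sub>\<le>\<^sub>0}" for \<beta> \<delta>
  proof -
    have "(\<lambda>\<nu>. euler_cont n \<nu> \<beta> \<delta> q) \<circ> (\<lambda>\<nu>. \<nu> + 1) holomorphic_on {\<nu>. - real (Suc n) < Re \<nu> \<and> \<nu> + 1 \<notin> \<int>\<^sub>\<le>\<^sub>0}"
    proof (rule holomorphic_on_compose_gen[OF _ Suc.IH])
      show "(\<lambda>\<nu>. \<nu> + 1) ` {\<nu>. - real (Suc n) < Re \<nu> \<and> \<nu> + 1 \<notin> \<int>\<^sub>\<le>\<^sub>0} \<subseteq> {\<nu>. - real n < Re \<nu> \<and> \<nu> + 1 \<notin> \<int>\<^sub>\<le>\<^sub>0}"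
        using admissible_Suc by fastforce
    qed (intro holomorphic_intros)
    then show ?thesis by (simp add: o_def)
  qed
  then show ?case
    unfolding euler_cont.simps end_value_def by (intro holomorphic_intros) auto
qed

lemma euler_holomorphic:
  assumes "q \<in> U"
  shows "(\<lambda>\<nu>. euler \<nu> \<beta> \<delta> q) holomorphic_on {\<nu>. \<nu> + 1 \<notin> \<int>\<^sub>\<le>\<^sub>0}"
  unfolding holomorphic_on_def
proof
  fix \<nu>0 :: complex assume \<nu>0: "\<nu>0 \<in> {\<nu>. \<nu> + 1 \<notin> \<int>\<^sub>\<le>\<^sub>0}"
  obtain n where n: "- Re \<nu>0 < real n" using reals_Archimedean2 by blast
  let ?D = "{\<nu>. - real n < Re \<nu> \<and> \<nu> + 1 \<notin> \<int>\<^sub>\<le>\<^sub>0}"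
  have "open ((\<lambda>\<nu>::complex. \<nu> + 1) -` (- \<int>\<^sub>\<le>\<^sub>0))"
    by (intro open_vimage continuous_intros) (simp add: open_Compl)
  moreover have "?D = {\<nu>. - real n < Re \<nu>} \<inter> (\<lambda>\<nu>::complex. \<nu> + 1) -` (- \<int>\<^sub>\<le>\<^sub>0)" by auto
  ultimately have D: "open ?D"
    by (auto intro!: open_Int open_Collect_less continuous_intros)
  have "(\<lambda>\<nu>. euler \<nu> \<beta> \<delta> q) holomorphic_on ?D"
    by (rule holomorphic_transform[OF euler_cont_holomorphic[OF assms, of n \<beta> \<delta>]]) (use euler_eq[of n _ q \<beta> \<delta>] assms in auto)
  then show "(\<lambda>\<nu>. euler \<nu> \<beta> \<delta> q) field_differentiable (at \<nu>0 within {\<nu>. \<nu> + 1 \<notin> \<int>\<^sub>\<le>\<^sub>0})"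
    using D \<nu>0 n by (intro field_differentiable_at_within[OF holomorphic_on_imp_differentiable_at[OF _ D]]) auto
qed

lemma euler_has_integral:
  assumes \<nu>: "-1 < Re \<nu>" and q: "q \<in> U"
  shows "((\<lambda>t. exp (\<nu> * l0 q t + \<beta> * l1 q t + \<delta> * l2 q t) * vector_derivative (\<lambda>t. X q * \<tau> t) (at t)) has_integral euler \<nu> \<beta> \<delta> q) {0..1}"
proof -
  note a = admissible_Re[OF \<nu>] and n0 = admissible_nonzero[OF admissible_Re[OF \<nu>]]
  have "((\<lambda>t. ((\<nu> + 1) * integrand \<nu> \<beta> \<delta> q t - \<beta> * integrand (\<nu> + 1) (\<beta> - 1) \<delta> q t - \<delta> * integrand (\<nu> + 1) \<beta> (\<delta> - 1) q t
        + \<beta> * integrand (\<nu> + 1) (\<beta> - 1) \<delta> q t + \<delta> * integrand (\<nu> + 1) \<beta> (\<delta> - 1) q t) / (\<nu> + 1))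
    has_integral (end_value (\<nu> + 1) \<beta> \<delta> q + \<beta> * euler_conv (\<nu> + 1) (\<beta> - 1) \<delta> q + \<delta> * euler_conv (\<nu> + 1) \<beta> (\<delta> - 1) q) / (\<nu> + 1)) {0..1}"
    by (intro has_integral_divide has_integral_add has_integral_mult_right integration_by_parts integrand_has_integral)
      (use \<nu> q in auto)
  moreover have "(end_value (\<nu> + 1) \<beta> \<delta> q + \<beta> * euler_conv (\<nu> + 1) (\<beta> - 1) \<delta> q + \<delta> * euler_conv (\<nu> + 1) \<beta> (\<delta> - 1) q) / (\<nu> + 1) = euler \<nu> \<beta> \<delta> q"
    using euler_rec[OF a q, of \<beta> \<delta>] n0 \<nu> q by (simp add: euler_convergent field_simps)
  ultimately have "(integrand \<nu> \<beta> \<delta> q has_integral euler \<nu> \<beta> \<delta> q) {0..1}"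
    using n0 by simp
  then show ?thesis
  proof (rule has_integral_spike[of "{0}", rotated 2])
    fix t :: real assume t: "t \<in> {0..1} - {0}"
    have "((\<lambda>t. X q * \<tau> t) has_vector_derivative X q * d\<tau> t) (at t)"
      using t by (intro has_vector_derivative_mult_right \<tau>) auto
    then show "exp (\<nu> * l0 q t + \<beta> * l1 q t + \<delta> * l2 q t) * vector_derivative (\<lambda>t. X q * \<tau> t) (at t) = integrand \<nu> \<beta> \<delta> q t"
      using t by (simp add: integrand_eq vector_derivative_at)
  qed simp
qed

text \<open>
  The exponents that are not negative integers form a connected set, so the continuation from \<open>Re \<nu> > - 1\<close> is
  unique.
\<close>

lemma reg_integral_eq_euler:
  assumes \<mu>: "\<mu> + 1 \<notin> \<int>\<^sub>\<le>\<^sub>0" and q: "q \<in> U"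
  shows "reg_integral (\<lambda>t. X q * \<tau> t) (l0 q) (l1 q) (l2 q) \<mu> \<beta> \<delta> = euler \<mu> \<beta> \<delta> q"
  unfolding reg_integral_def
proof (rule the_equality)
  let ?D = "{\<nu>::complex. \<nu> + 1 \<notin> \<int>\<^sub>\<le>\<^sub>0}"
  show "\<exists>G. G holomorphic_on ?D \<and> (\<forall>\<nu>. - 1 < Re \<nu> \<longrightarrow> ((\<lambda>t. exp (\<nu> * l0 q t + \<beta> * l1 q t + \<delta> * l2 q t) *
       vector_derivative (\<lambda>t. X q * \<tau> t) (at t)) has_integral G \<nu>) {0..1}) \<and> euler \<mu> \<beta> \<delta> q = G \<mu>"
    using euler_holomorphic[OF q, of \<beta> \<delta>] euler_has_integral[OF _ q, of _ \<beta> \<delta>] by (intro exI[of _ "\<lambda>\<nu>. euler \<nu> \<beta> \<delta> q"]) auto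
  fix v assume "\<exists>G. G holomorphic_on ?D \<and> (\<forall>\<nu>. - 1 < Re \<nu> \<longrightarrow> ((\<lambda>t. exp (\<nu> * l0 q t + \<beta> * l1 q t + \<delta> * l2 q t) *
       vector_derivative (\<lambda>t. X q * \<tau> t) (at t)) has_integral G \<nu>) {0..1}) \<and> v = G \<mu>"
  then obtain G where G: "G holomorphic_on ?D" "v = G \<mu>"
    "\<And>\<nu>. - 1 < Re \<nu> \<Longrightarrow> ((\<lambda>t. exp (\<nu> * l0 q t + \<beta> * l1 q t + \<delta> * l2 q t) *
       vector_derivative (\<lambda>t. X q * \<tau> t) (at t)) has_integral G \<nu>) {0..1}"
    by blast
  have D: "?D = UNIV - {\<nu>. \<nu> + 1 \<in> \<int>\<^sub>\<le>\<^sub>0}" by auto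
  have "{\<nu>::complex. \<nu> + 1 \<in> \<int>\<^sub>\<le>\<^sub>0} \<subseteq> (\<lambda>n. of_int n - 1) ` UNIV"
    by (force simp: nonpos_Ints_def algebra_simps)
  then have "countable {\<nu>::complex. \<nu> + 1 \<in> \<int>\<^sub>\<le>\<^sub>0}"
    by (rule countable_subset) auto
  then have "connected ?D"
    unfolding D by (intro connected_open_diff_countable) auto
  moreover have "open ((\<lambda>\<nu>::complex. \<nu> + 1) -` (- \<int>\<^sub>\<le>\<^sub>0))"
    by (intro open_vimage continuous_intros) (simp add: open_Compl)
  then have "open ?D" by (simp add: vimage_def)
  moreover have "open {\<nu>. - 1 < Re \<nu>}" by (intro open_Collect_less continuous_intros)
  moreover have "(0::complex) \<in> {\<nu>. - 1 < Re \<nu>}" by simp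
  then have "{\<nu>. - 1 < Re \<nu>} \<noteq> {}" by blast
  moreover have "{\<nu>. - 1 < Re \<nu>} \<subseteq> ?D" using admissible_Re by blast
  ultimately have "G \<mu> = euler \<mu> \<beta> \<delta> q"
    using \<mu> by (intro analytic_continuation_open[of "{\<nu>. - 1 < Re \<nu>}" ?D G "\<lambda>\<nu>. euler \<nu> \<beta> \<delta> q" \<mu>] G(1) euler_holomorphic[OF q])
      (blast, auto intro: has_integral_unique[OF G(3) euler_has_integral[OF _ q]])
  with G(2) show "v = euler \<mu> \<beta> \<delta> q" by simp
qed

section \<open>The integrals solve the system\<close>

lemma end_value_nonzero: "end_value \<nu> \<beta> \<delta> q \<noteq> 0"
  by (simp add: end_value_def)

text \<open>
  These ratios come from the derivatives of the logarithms of \<open>1 - s\<close> and \<open>T - s\<close> at the end point \<open>s = X\<close>; being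
  \<open>- x\<close> and \<open>y\<close>, they make the coefficients of the first order equations for the end values linear in \<open>x\<close> and \<open>y\<close>.
\<close>

lemma X_T_ratios:
  assumes "q \<in> U"
  shows "X q / (1 - X q) = - fst q" "XY q / (XY q - X q) = snd q" "XY q - X q \<noteq> 0" "1 - X q \<noteq> 0"
proof -
  have "fst q \<noteq> 1" "snd q \<noteq> 1" "fst q \<noteq> 0" using genericD[OF assms] by auto
  then show "X q / (1 - X q) = - fst q" "XY q / (XY q - X q) = snd q"
    by (simp_all add: X_eq XY_eq divide_simps) (simp_all add: algebra_simps)
  show "XY q - X q \<noteq> 0" "1 - X q \<noteq> 0"
    using factors_nonzero[OF assms, of 1] ends by simp_all
qed

lemma thetas_end_value_xy:
  assumes "q \<in> U"
  shows "has_thetas (end_value \<nu> \<beta> \<delta>) ((\<nu> + \<delta> + \<beta> * fst q) * end_value \<nu> \<beta> \<delta> q) (\<delta> * snd q * end_value \<nu> \<beta> \<delta> q) q"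
proof (rule thetas_eq[OF thetas_end_value[OF assms]])
  have "end_value (\<nu> + 1) (\<beta> - 1) \<delta> q = X q / (1 - X q) * end_value \<nu> \<beta> \<delta> q"
    unfolding end_value_shift(2)[OF assms] end_value_shift(1)[OF assms] by simp
  then show "(\<nu> + \<delta>) * end_value \<nu> \<beta> \<delta> q - \<beta> * end_value (\<nu> + 1) (\<beta> - 1) \<delta> q = (\<nu> + \<delta> + \<beta> * fst q) * end_value \<nu> \<beta> \<delta> q"
    unfolding X_T_ratios(1)[OF assms] by (simp add: algebra_simps)
  have "XY q * end_value \<nu> \<beta> (\<delta> - 1) q = XY q / (XY q - X q) * end_value \<nu> \<beta> \<delta> q"
    unfolding end_value_shift(3)[OF assms] by simp
  then show "\<delta> * XY q * end_value \<nu> \<beta> (\<delta> - 1) q = \<delta> * snd q * end_value \<nu> \<beta> \<delta> q"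
    unfolding X_T_ratios(2)[OF assms] by (simp add: algebra_simps)
qed

text \<open>
  The field \<open>\<theta> - \<theta>' = X d/dX\<close> moves only the end point of the path, whence the boundary term.
\<close>

lemma theta_euler:
  assumes "\<nu> + 1 \<notin> \<int>\<^sub>\<le>\<^sub>0" "q \<in> U"
  shows "theta_y (euler \<nu> \<beta> \<delta>) q = \<delta> * XY q * euler \<nu> \<beta> (\<delta> - 1) q"
    "theta_x (euler \<nu> \<beta> \<delta>) q = theta_y (euler \<nu> \<beta> \<delta>) q + end_value (\<nu> + 1) \<beta> \<delta> q"
proof -
  note h = thetas_D[OF thetas_euler[OF assms] genericD[OF assms(2)]]
  show 2: "theta_y (euler \<nu> \<beta> \<delta>) q = \<delta> * XY q * euler \<nu> \<beta> (\<delta> - 1) q" using h by simp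
  show "theta_x (euler \<nu> \<beta> \<delta>) q = theta_y (euler \<nu> \<beta> \<delta>) q + end_value (\<nu> + 1) \<beta> \<delta> q"
  proof -
    have "theta_x (euler \<nu> \<beta> \<delta>) q = (\<nu> + \<delta> + 1) * euler \<nu> \<beta> \<delta> q - \<beta> * euler (\<nu> + 1) (\<beta> - 1) \<delta> q" using h by simp
    moreover have "euler \<nu> \<beta> \<delta> q = XY q * euler \<nu> \<beta> (\<delta> - 1) q - euler (\<nu> + 1) \<beta> (\<delta> - 1) q"
      using euler_shift_\<delta>[OF assms, of \<beta> "\<delta> - 1"] by simp
    ultimately show ?thesis
      unfolding 2 using euler_rec[OF assms, of \<beta> \<delta>] by algebra
  qed
qed

text \<open>
  Integration of the derivative of \<open>s^(\<nu>+1) (1 - s)^(\<beta>+1) (T - s)^(\<delta>-1)\<close>, rewritten by the relations for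
  multiplication with \<open>1 - s\<close> and \<open>T - s\<close> in terms of integrals that differ only in the exponent of \<open>T - s\<close>.
\<close>

lemma euler_contiguous:
  fixes \<nu> \<beta> \<delta> :: complex
  assumes "\<nu> + 1 \<notin> \<int>\<^sub>\<le>\<^sub>0" "q \<in> U"
  defines "e \<equiv> end_value (\<nu> + 1) \<beta> (\<delta> - 1) q"
    and "J0 \<equiv> euler \<nu> \<beta> \<delta> q" and "J1 \<equiv> euler \<nu> \<beta> (\<delta> - 1) q" and "J2 \<equiv> euler \<nu> \<beta> (\<delta> - 1 - 1) q"
  shows "(\<nu> + 1) * (J1 - (XY q * J1 - J0)) = (1 - X q) * e + (\<beta> + 1) * (XY q * J1 - J0)
     + (\<delta> - 1) * ((XY q * J2 - J1) - (XY q * (XY q * J2 - J1) - (XY q * J1 - J0)))"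
proof -
  note a2 = admissible_Suc[OF assms(1)]
  have "euler (\<nu> + 1) \<beta> (\<delta> - 1) q = XY q * J1 - J0" "euler (\<nu> + 1) \<beta> (\<delta> - 1 - 1) q = XY q * J2 - J1"
    "euler (\<nu> + 1 + 1) \<beta> (\<delta> - 1 - 1) q = XY q * euler (\<nu> + 1) \<beta> (\<delta> - 1 - 1) q - euler (\<nu> + 1) \<beta> (\<delta> - 1) q"
    using euler_shift_\<delta>[OF assms(1,2), of \<beta> "\<delta> - 1"] euler_shift_\<delta>[OF assms(1,2), of \<beta> "\<delta> - 1 - 1"]
      euler_shift_\<delta>[OF a2 assms(2), of \<beta> "\<delta> - 1 - 1"]
    by (simp_all add: J0_def J1_def J2_def)
  moreover have "euler \<nu> (\<beta> + 1) (\<delta> - 1) q = J1 - euler (\<nu> + 1) \<beta> (\<delta> - 1) q"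
    "euler (\<nu> + 1) (\<beta> + 1) (\<delta> - 1 - 1) q = euler (\<nu> + 1) \<beta> (\<delta> - 1 - 1) q - euler (\<nu> + 1 + 1) \<beta> (\<delta> - 1 - 1) q"
    using euler_shift_\<beta>[OF assms(1,2), of \<beta> "\<delta> - 1"] euler_shift_\<beta>[OF a2 assms(2), of \<beta> "\<delta> - 1 - 1"]
    by (simp_all add: J1_def)
  moreover have "end_value (\<nu> + 1) (\<beta> + 1) (\<delta> - 1) q = (1 - X q) * e"
    using end_value_shift(2)[OF assms(2), of "\<nu> + 1" "\<beta> + 1" "\<delta> - 1"] X_T_ratios(4)[OF assms(2)] by (simp add: e_def)
  moreover have "(\<nu> + 1) * euler \<nu> (\<beta> + 1) (\<delta> - 1) q = end_value (\<nu> + 1) (\<beta> + 1) (\<delta> - 1) q + (\<beta> + 1) * euler (\<nu> + 1) \<beta> (\<delta> - 1) q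
     + (\<delta> - 1) * euler (\<nu> + 1) (\<beta> + 1) (\<delta> - 1 - 1) q"
    using euler_rec[OF assms(1,2), of "\<beta> + 1" "\<delta> - 1"] by simp
  ultimately show ?thesis by simp
qed

lemma holomorphic2_euler: "\<nu> + 1 \<notin> \<int>\<^sub>\<le>\<^sub>0 \<Longrightarrow> holomorphic2_on (euler \<nu> \<beta> \<delta>) U"
  by (rule holomorphic2_onI_thetas[OF thetas_euler])

text \<open>
  The first equation is, up to sign, the contiguity relation times \<open>\<delta> T\<close>. The difference of the two equations is the first order
  equation \<open>(a - 1 + (1 - X) \<theta> + (1 - Y) \<theta>' - b X - b' Y) \<phi> = 0\<close> for the boundary term
  \<open>\<phi> = \<theta> w - \<theta>' w\<close>, whose derivatives are explicit.
\<close>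

lemma euler_solves:
  assumes "b' - a + 1 \<notin> \<int>\<^sub>\<le>\<^sub>0" "q \<in> U"
  shows "gauged_Q a b b' (euler (b' - a) (a - b - 1) (- b')) q = 0"
    and "gauged_P a b b' (euler (b' - a) (a - b - 1) (- b')) q = 0"
proof -
  define \<mu> \<beta> \<delta> where "\<mu> = b' - a" and "\<beta> = a - b - 1" and "\<delta> = - b'"
  note par = \<mu>_def[symmetric] \<beta>_def[symmetric] \<delta>_def[symmetric]
  have \<mu>: "\<mu> + 1 \<notin> \<int>\<^sub>\<le>\<^sub>0" using assms by (simp add: \<mu>_def)
  define w where "w = euler \<mu> \<beta> \<delta>"
  define \<phi> where "\<phi> = end_value (\<mu> + 1) \<beta> \<delta>"
  note r = genericD[OF assms(2)]
  have w: "holomorphic2_on w U" unfolding w_def by (rule holomorphic2_euler[OF \<mu>])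
  have t2: "theta_y w s = \<delta> * (XY s * euler \<mu> \<beta> (\<delta> - 1) s)" if "s \<in> U" for s
    using theta_euler(1)[OF \<mu> that] by (simp add: w_def)
  have t1: "theta_x w s = theta_y w s + \<phi> s" if "s \<in> U" for s
    using theta_euler(2)[OF \<mu> that] by (simp add: w_def \<phi>_def)
  have h2: "has_thetas (theta_y w) (theta_x (theta_y w) q) (theta_y (theta_y w) q) q"
    using holomorphic2_on_thetas[OF holomorphic2_on_theta_y[OF U w] assms(2) r] .
  have h\<phi>: "has_thetas \<phi> ((\<mu> + 1 + \<delta> + \<beta> * fst q) * \<phi> q) (\<delta> * snd q * \<phi> q) q"
    unfolding \<phi>_def by (rule thetas_end_value_xy[OF assms(2)])
  have sum: "theta_x (\<lambda>s. theta_y w s + \<phi> s) q = theta_x (theta_y w) q + (\<mu> + 1 + \<delta> + \<beta> * fst q) * \<phi> q"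
    "theta_y (\<lambda>s. theta_y w s + \<phi> s) q = theta_y (theta_y w) q + \<delta> * snd q * \<phi> q"
    using thetas_D[OF thetas_add[OF h2 h\<phi>] r] by auto
  have t11: "theta_x (theta_x w) q = theta_x (theta_y w) q + (\<mu> + 1 + \<delta> + \<beta> * fst q) * \<phi> q"
    using theta_x_cong_open[OF U assms(2) t1] sum by simp
  have t12: "theta_x (theta_y w) q = theta_y (theta_y w) q + \<delta> * snd q * \<phi> q"
    using theta_y_cong_open[OF U assms(2) t1] sum theta_y_theta_x[OF U w assms(2)] by simp
  have t22: "theta_y (theta_y w) q = \<delta> * (XY q * euler \<mu> \<beta> (\<delta> - 1) q + XY q * ((\<delta> - 1) * XY q * euler \<mu> \<beta> (\<delta> - 1 - 1) q))"
    using theta_y_cong_open[OF U assms(2) t2] thetas_D[OF thetas_cmult[OF thetas_mult[OF thetas_XY[OF r] thetas_euler[OF \<mu> assms(2)]]] r] by simp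
  define e where "e = end_value (\<mu> + 1) \<beta> (\<delta> - 1) q"
  have \<phi>e: "\<phi> q = (XY q - X q) * e"
    using end_value_shift(3)[OF assms(2)] X_T_ratios(3)[OF assms(2)] by (simp add: \<phi>_def e_def)
  have ye: "snd q * \<phi> q = XY q * e"
    unfolding \<phi>e X_T_ratios(2)[OF assms(2), symmetric] using X_T_ratios(3)[OF assms(2)] by simp
  have t12': "theta_x (theta_y w) q = theta_y (theta_y w) q + \<delta> * (XY q * e)"
    using t12 ye by (simp add: mult.assoc)
  have YXY: "Y q * X q = XY q" by (simp add: XY_eq_mult)
  have abc: "b' = - \<delta>" "b = a - \<beta> - 1" "a = - \<delta> - \<mu>" by (simp_all add: \<mu>_def \<beta>_def \<delta>_def)
  show gauged_Q: "gauged_Q a b b' (euler (b' - a) (a - b - 1) (- b')) q = 0"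
    unfolding par w_def[symmetric] gauged_Q_def t12' t22 t1[OF assms(2)] t2[OF assms(2)] \<phi>e
    using euler_contiguous[OF \<mu> assms(2), of \<beta> \<delta>, folded w_def e_def] YXY abc
    by algebra
  have "X q * (1 - fst q) = - fst q" "Y q * (1 - snd q) = - snd q"
    using r by (simp_all add: X_eq Y_eq)
  then have "gauged_P a b b' w q - gauged_Q a b b' w q = 0"
    unfolding gauged_P_def gauged_Q_def t11 t1[OF assms(2)] t12 using abc by algebra
  with gauged_Q show "gauged_P a b b' (euler (b' - a) (a - b - 1) (- b')) q = 0"
    unfolding par w_def[symmetric] by simp
qed

end

section \<open>The space of solutions\<close>

lemma gauged_P_pullback:
  assumes V: "open V" "u holomorphic_on V" and U: "open U" "U \<subseteq> generic" "\<And>q. q \<in> U \<Longrightarrow> XY q \<in> V" and q: "q \<in> U"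
  shows "gauged_P a b b' (\<lambda>q. u (XY q)) q = gauss_op b b' a u (XY q)"
proof -
  have r: "s \<in> generic" if "s \<in> U" for s using U that by auto
  have 1: "has_thetas (\<lambda>q. u (XY q)) (XY s * deriv u (XY s)) (XY s * deriv u (XY s)) s" if "s \<in> U" for s
    using thetas_chain[OF holomorphic_derivI[OF V(2,1) U(3)[OF that]] thetas_XY[OF r[OF that]]]
    by (simp add: mult.commute)
  have 2: "has_thetas (\<lambda>s. XY s * deriv u (XY s)) (XY q * deriv u (XY q) + XY q * (deriv (deriv u) (XY q) * XY q))
     (XY q * deriv u (XY q) + XY q * (deriv (deriv u) (XY q) * XY q)) q"
    by (rule thetas_mult[OF thetas_XY[OF r[OF q]] thetas_chain[OF holomorphic_derivI[OF holomorphic_deriv[OF V(2,1)] V(1) U(3)[OF q]] thetas_XY[OF r[OF q]]]])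
  have t: "theta_x (\<lambda>q. u (XY q)) s = XY s * deriv u (XY s)" "theta_y (\<lambda>q. u (XY q)) s = XY s * deriv u (XY s)" if "s \<in> U" for s
    using thetas_D[OF 1[OF that] r[OF that]] by auto
  have tt: "theta_x (theta_x (\<lambda>q. u (XY q))) q = XY q * deriv u (XY q) + XY q * (deriv (deriv u) (XY q) * XY q)"
    "theta_x (theta_y (\<lambda>q. u (XY q))) q = XY q * deriv u (XY q) + XY q * (deriv (deriv u) (XY q) * XY q)"
    using theta_x_cong_open[OF U(1) q t(1)] theta_x_cong_open[OF U(1) q t(2)] thetas_D[OF 2 r[OF q]] by auto
  show ?thesis
    unfolding gauged_P_def tt t[OF q] gauss_op_expand[OF V U(3)[OF q]] by (simp add: algebra_simps)
qed

lemma thetas_power_mult: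
  assumes U: "open U" "U \<subseteq> generic" and K: "\<And>q. q \<in> U \<Longrightarrow> has_thetas K 1 1 q" and w: "holomorphic2_on w U" and q: "q \<in> U"
  shows "has_thetas (\<lambda>q. exp (c * K q) * w q) (exp (c * K q) * (c * w q + theta_x w q)) (exp (c * K q) * (c * w q + theta_y w q)) q"
proof -
  have r: "q \<in> generic" using U q by auto
  show ?thesis
    by (rule thetas_eq[OF thetas_mult[OF thetas_exp[OF thetas_cmult[OF K[OF q]]] holomorphic2_on_thetas[OF w q r]]])
      (simp_all add: algebra_simps)
qed

text \<open>
  Multiplication by \<open>T^(1-a)\<close> replaces both \<open>\<theta>\<close> and \<open>\<theta>'\<close> by themselves plus \<open>1 - a\<close>. Thus \<open>\<theta> - \<theta>'\<close> is unchanged and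
  \<open>\<theta> (a - 1 + \<theta>)\<close> becomes \<open>(1 - a + \<theta>) \<theta>\<close>, which is the same operator for \<open>2 - a\<close>, while \<open>b + \<theta>\<close> becomes \<open>b - a + 1 + \<theta>\<close>.
\<close>

lemma power_T_mult:
  fixes a b b' :: complex
  assumes U: "open U" "U \<subseteq> generic" and K: "\<And>q. q \<in> U \<Longrightarrow> has_thetas K 1 1 q" and w: "holomorphic2_on w U" and q: "q \<in> U"
  defines "f \<equiv> \<lambda>q. exp ((1 - a) * K q) * w q"
  shows "holomorphic2_on f U"
    "theta_x f q - theta_y f q = exp ((1 - a) * K q) * (theta_x w q - theta_y w q)"
    "gauged_P a b b' f q = exp ((1 - a) * K q) * gauged_P (2 - a) (b - a + 1) (b' - a + 1) w q"
    "gauged_Q a b b' f q = exp ((1 - a) * K q) * gauged_Q (2 - a) (b - a + 1) (b' - a + 1) w q"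
proof -
  define c where "c = 1 - a"
  have f: "f = (\<lambda>q. exp (c * K q) * w q)" by (simp add: f_def c_def)
  have r: "s \<in> generic" if "s \<in> U" for s using U that by auto
  note tw = thetas_power_mult[OF U K]
  have th: "theta_x (\<lambda>q. exp (c * K q) * g q) s = exp (c * K s) * (c * g s + theta_x g s)"
    "theta_y (\<lambda>q. exp (c * K q) * g q) s = exp (c * K s) * (c * g s + theta_y g s)"
    if "holomorphic2_on g U" "s \<in> U" for g s
    using thetas_D[OF tw[OF _ that] r[OF that(2)]] by auto
  show hf: "holomorphic2_on f U"
    unfolding f by (rule holomorphic2_onI_thetas[OF tw[OF _ w]])
  note t = th[OF w, folded f]
  show "theta_x f q - theta_y f q = exp ((1 - a) * K q) * (theta_x w q - theta_y w q)"
    unfolding t[OF q] by (simp add: c_def algebra_simps)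
  have w1: "holomorphic2_on (theta_x w) U" and w2: "holomorphic2_on (theta_y w) U"
    using U w by (auto intro: holomorphic2_on_theta_x holomorphic2_on_theta_y)
  have h1: "holomorphic2_on (\<lambda>q. c * w q + theta_x w q) U" and h2: "holomorphic2_on (\<lambda>q. c * w q + theta_y w q) U"
    by (intro holomorphic2_on_add holomorphic2_on_cmult w w1 w2)+
  have s: "theta_x (\<lambda>q. c * w q + theta_x w q) q = c * theta_x w q + theta_x (theta_x w) q"
    "theta_x (\<lambda>q. c * w q + theta_y w q) q = c * theta_x w q + theta_x (theta_y w) q"
    "theta_y (\<lambda>q. c * w q + theta_y w q) q = c * theta_y w q + theta_y (theta_y w) q"
    using thetas_D[OF thetas_add[OF thetas_cmult[OF holomorphic2_on_thetas[OF w q r[OF q]]] holomorphic2_on_thetas[OF w1 q r[OF q]]] r[OF q]]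
      thetas_D[OF thetas_add[OF thetas_cmult[OF holomorphic2_on_thetas[OF w q r[OF q]]] holomorphic2_on_thetas[OF w2 q r[OF q]]] r[OF q]]
    by auto
  have tt: "theta_x (theta_x f) q = exp (c * K q) * (c * (c * w q + theta_x w q) + (c * theta_x w q + theta_x (theta_x w) q))"
    "theta_x (theta_y f) q = exp (c * K q) * (c * (c * w q + theta_y w q) + (c * theta_x w q + theta_x (theta_y w) q))"
    "theta_y (theta_y f) q = exp (c * K q) * (c * (c * w q + theta_y w q) + (c * theta_y w q + theta_y (theta_y w) q))"
    using theta_x_cong_open[OF U(1) q t(1)] theta_x_cong_open[OF U(1) q t(2)] theta_y_cong_open[OF U(1) q t(2)]
      th[OF h1 q] th[OF h2 q] s by auto
  have a: "a = 1 - c" by (simp add: c_def)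
  show "gauged_P a b b' f q = exp ((1 - a) * K q) * gauged_P (2 - a) (b - a + 1) (b' - a + 1) w q"
    "gauged_Q a b b' f q = exp ((1 - a) * K q) * gauged_Q (2 - a) (b - a + 1) (b' - a + 1) w q"
    unfolding gauged_P_def gauged_Q_def tt t[OF q] c_def[symmetric] unfolding f a by (simp_all add: algebra_simps)
qed

lemma gauged_linear:
  assumes U: "open U" and w: "holomorphic2_on w U" and v: "holomorphic2_on v U" and q: "q \<in> U"
  shows "theta_x (\<lambda>q. w q - c * v q) q = theta_x w q - c * theta_x v q" "theta_y (\<lambda>q. w q - c * v q) q = theta_y w q - c * theta_y v q"
    "gauged_P a b b' (\<lambda>q. w q - c * v q) q = gauged_P a b b' w q - c * gauged_P a b b' v q"
    "gauged_Q a b b' (\<lambda>q. w q - c * v q) q = gauged_Q a b b' w q - c * gauged_Q a b b' v q"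
proof -
  have th: "theta_x (\<lambda>q. w q - c * v q) s = theta_x w s - c * theta_x v s" "theta_y (\<lambda>q. w q - c * v q) s = theta_y w s - c * theta_y v s"
    if "holomorphic2_on w U" "holomorphic2_on v U" "s \<in> U" for w v s
    using theta_x_partials[OF partials_diff[OF holomorphic2_on_partials[OF that(1,3)] partials_cmult[OF holomorphic2_on_partials[OF that(2,3)]]]]
      theta_y_partials[OF partials_diff[OF holomorphic2_on_partials[OF that(1,3)] partials_cmult[OF holomorphic2_on_partials[OF that(2,3)]]]]
    by (simp_all add: theta_x_def theta_y_def algebra_simps)
  note t = th[OF w v]
  show "theta_x (\<lambda>q. w q - c * v q) q = theta_x w q - c * theta_x v q" "theta_y (\<lambda>q. w q - c * v q) q = theta_y w q - c * theta_y v q"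
    using t q by auto
  note h = holomorphic2_on_theta_x[OF U w] holomorphic2_on_theta_x[OF U v] holomorphic2_on_theta_y[OF U w] holomorphic2_on_theta_y[OF U v]
  have tt: "theta_x (theta_x (\<lambda>q. w q - c * v q)) q = theta_x (theta_x w) q - c * theta_x (theta_x v) q"
    "theta_x (theta_y (\<lambda>q. w q - c * v q)) q = theta_x (theta_y w) q - c * theta_x (theta_y v) q"
    "theta_y (theta_y (\<lambda>q. w q - c * v q)) q = theta_y (theta_y w) q - c * theta_y (theta_y v) q"
    using theta_x_cong_open[OF U q t(1)] theta_x_cong_open[OF U q t(2)] theta_y_cong_open[OF U q t(2)]
      th[OF h(1,2) q] th[OF h(3,4) q] by auto
  show "gauged_P a b b' (\<lambda>q. w q - c * v q) q = gauged_P a b b' w q - c * gauged_P a b b' v q"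
    "gauged_Q a b b' (\<lambda>q. w q - c * v q) q = gauged_Q a b b' w q - c * gauged_Q a b b' v q"
    unfolding gauged_P_def gauged_Q_def tt t[OF q] by (simp_all add: algebra_simps)
qed

lemma gauged_solutions_diff:
  assumes "w \<in> gauged_solutions a b b' p" "v \<in> gauged_solutions a b b' p"
  shows "(\<lambda>q. w q - c * v q) \<in> gauged_solutions a b b' p"
proof -
  obtain U V where U: "open U" "p \<in> U" "holomorphic2_on w U" "\<And>q. q \<in> U \<Longrightarrow> gauged_P a b b' w q = 0 \<and> gauged_Q a b b' w q = 0"
    and V: "open V" "p \<in> V" "holomorphic2_on v V" "\<And>q. q \<in> V \<Longrightarrow> gauged_P a b b' v q = 0 \<and> gauged_Q a b b' v q = 0"
    using assms unfolding gauged_solutions_def by blast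
  have W: "open (U \<inter> V)" "p \<in> U \<inter> V" and w: "holomorphic2_on w (U \<inter> V)" and v: "holomorphic2_on v (U \<inter> V)"
    using U V by (auto elim: holomorphic2_on_subset)
  show ?thesis
  proof (rule gauged_solutionsI[OF W _ _ always_eventually])
    show "holomorphic2_on (\<lambda>q. w q - c * v q) (U \<inter> V)"
      by (intro holomorphic2_on_diff holomorphic2_on_cmult w v)
    show "gauged_P a b b' (\<lambda>q. w q - c * v q) q = 0 \<and> gauged_Q a b b' (\<lambda>q. w q - c * v q) q = 0" if "q \<in> U \<inter> V" for q
      using gauged_linear(3,4)[OF W(1) w v that] U(4)[of q] V(4)[of q] that by simp
  qed simp
qed

text \<open>
  The local solutions of a first order system \<open>\<theta> f = A f\<close>, \<open>\<theta>' f = B f\<close> are the multiples of one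
  of them that does not vanish.
\<close>

lemma constant_quotient:
  assumes U: "open U" "convex U" "U \<subseteq> generic" "p \<in> U"
    and f: "\<And>q. q \<in> U \<Longrightarrow> has_thetas f (A q * f q) (B q * f q) q"
    and g: "\<And>q. q \<in> U \<Longrightarrow> has_thetas g (A q * g q) (B q * g q) q" "\<And>q. q \<in> U \<Longrightarrow> g q \<noteq> 0"
  obtains k where "\<And>q. q \<in> U \<Longrightarrow> f q = k * g q"
proof -
  have "has_partials (\<lambda>q. f q / g q) 0 0 q" if "q \<in> U" for q
    by (rule partials_eq[OF partials_divide[OF f[OF that, unfolded has_thetas_def] g(1)[OF that, unfolded has_thetas_def] g(2)[OF that]]])
      simp_all
  then have "((\<lambda>q. f q / g q) has_derivative (\<lambda>h. 0)) (at q within U)" if "q \<in> U" for q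
    using that has_derivative_at_withinI by (fastforce simp: has_partials_def case_prod_beta')
  from has_derivative_zero_constant[OF U(2) this]
  obtain k where "\<And>q. q \<in> U \<Longrightarrow> f q / g q = k" by blast
  with g(2) have "f q = k * g q" if "q \<in> U" for q
    using that by (auto simp: field_simps)
  with that show thesis by blast
qed

text \<open>
  Here \<open>\<alpha> = D \<phi>\<close> and \<open>\<beta> = D' \<phi>\<close> with \<open>D = (1 - X) \<theta> - b X\<close> and \<open>D' = (1 - Y) \<theta>' - b' Y\<close>. The decomposition
  \<open>(1 - a) \<phi> = \<alpha> + \<beta>\<close> is the difference of the two equations. The equation \<open>D D' \<phi> = 0\<close> is
  \<open>\<theta>'\<close> of the first minus \<open>\<theta>\<close> of the second equation; it says \<open>D' \<alpha> = 0\<close> and \<open>D \<beta> = 0\<close>. Applying \<open>D\<close> and \<open>D'\<close> to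
  the decomposition gives the eigenvalue equations \<open>D \<alpha> = (1 - a) \<alpha>\<close> and \<open>D' \<beta> = (1 - a) \<beta>\<close>.
\<close>

lemma difference_splits:
  assumes U: "open U" "U \<subseteq> generic" and w: "holomorphic2_on w U"
    and eqs: "\<And>q. q \<in> U \<Longrightarrow> gauged_P a b b' w q = 0 \<and> gauged_Q a b b' w q = 0"
  obtains \<alpha> \<beta> where "\<And>q. q \<in> U \<Longrightarrow> (1 - a) * (theta_x w q - theta_y w q) = \<alpha> q + \<beta> q"
    "\<And>q. q \<in> U \<Longrightarrow> has_thetas \<alpha> ((1 - a + (a - b - 1) * fst q) * \<alpha> q) (- b' * snd q * \<alpha> q) q"
    "\<And>q. q \<in> U \<Longrightarrow> has_thetas \<beta> (- b * fst q * \<beta> q) ((1 - a + (a - b' - 1) * snd q) * \<beta> q) q"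
proof -
  have r: "s \<in> generic" if "s \<in> U" for s using U that by auto
  define w10 w01 where "w10 = theta_x w" and "w01 = theta_y w"
  have h1: "holomorphic2_on w10 U" "holomorphic2_on w01 U"
    unfolding w10_def w01_def by (intro holomorphic2_on_theta_x holomorphic2_on_theta_y U w)+
  define w20 w11 w02 where "w20 = theta_x w10" and "w11 = theta_x w01" and "w02 = theta_y w01"
  have h2: "holomorphic2_on w20 U" "holomorphic2_on w11 U" "holomorphic2_on w02 U"
    unfolding w20_def w11_def w02_def by (intro holomorphic2_on_theta_x holomorphic2_on_theta_y U h1)+
  define w21 w12 where "w21 = theta_x w11" and "w12 = theta_y w11"
  have t11: "theta_y w10 s = w11 s" if "s \<in> U" for s
    unfolding w10_def w11_def w01_def by (rule theta_y_theta_x[OF U(1) w that])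
  have t21: "theta_y w20 s = w21 s" "theta_x w02 s = w12 s" if "s \<in> U" for s
  proof -
    have "theta_y w20 s = theta_x (theta_y w10) s" unfolding w20_def by (rule theta_y_theta_x[OF U(1) h1(1) that])
    also have "\<dots> = w21 s" unfolding w21_def by (rule theta_x_cong_open[OF U(1) that t11])
    finally show "theta_y w20 s = w21 s" .
    show "theta_x w02 s = w12 s"
      unfolding w02_def w12_def w11_def by (rule theta_y_theta_x[OF U(1) h1(2) that, symmetric])
  qed
  have w: "has_thetas w (w10 s) (w01 s) s" "has_thetas w10 (w20 s) (w11 s) s" "has_thetas w01 (w11 s) (w02 s) s"
    "has_thetas w20 (theta_x w20 s) (w21 s) s" "has_thetas w11 (w21 s) (w12 s) s" "has_thetas w02 (w12 s) (theta_y w02 s) s" if "s \<in> U" for s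
    using holomorphic2_on_thetas[OF w that r[OF that]] holomorphic2_on_thetas[OF h1(1) that r[OF that]]
      holomorphic2_on_thetas[OF h1(2) that r[OF that]] holomorphic2_on_thetas[OF h2(1) that r[OF that]]
      holomorphic2_on_thetas[OF h2(2) that r[OF that]] holomorphic2_on_thetas[OF h2(3) that r[OF that]]
      t11[OF that] t21[OF that]
    by (simp_all add: w10_def w01_def w20_def w11_def w02_def w21_def w12_def)
  define \<phi> where "\<phi> = (\<lambda>s. w10 s - w01 s)"
  have h\<phi>: "has_thetas \<phi> (w20 s - w11 s) (w11 s - w02 s) s" if "s \<in> U" for s
    unfolding \<phi>_def by (rule thetas_diff[OF w(2)[OF that] w(3)[OF that]])
  have e1: "w20 s + (a - 1) * w10 s - X s * (b * \<phi> s + w20 s - w11 s)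
     - XY s * (b * b' * w s + b * w01 s + b' * w10 s + w11 s) = 0" if "s \<in> U" for s
    using eqs[OF that] unfolding gauged_P_def w10_def[symmetric] w01_def[symmetric]
      w20_def[symmetric] w11_def[symmetric] \<phi>_def by simp
  have e2: "w02 s + (a - 1) * w01 s + Y s * (b' * \<phi> s + w11 s - w02 s)
     - XY s * (b * b' * w s + b * w01 s + b' * w10 s + w11 s) = 0" if "s \<in> U" for s
    using eqs[OF that] unfolding gauged_Q_def w10_def[symmetric] w01_def[symmetric]
      w02_def[symmetric] w11_def[symmetric] \<phi>_def by simp
  define \<alpha> where "\<alpha> = (\<lambda>s. (1 - X s) * (w20 s - w11 s) - b * (X s * \<phi> s))"
  define \<beta> where "\<beta> = (\<lambda>s. (1 - Y s) * (w11 s - w02 s) - b' * (Y s * \<phi> s))"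
  have sum: "(1 - a) * \<phi> s = \<alpha> s + \<beta> s" if "s \<in> U" for s
    using e1[OF that] e2[OF that] unfolding \<alpha>_def \<beta>_def \<phi>_def by algebra
  \<comment> \<open>This is \<open>D D' \<phi> = 0\<close>, written in third order jets \<open>w\<^sub>i\<^sub>j = \<theta>\<^sup>i \<theta>'\<^sup>j w\<close>.\<close>
  have mixed: "(1 - X q) * (1 - Y q) * (w21 q - w12 q) - b * X q * (1 - Y q) * (w11 q - w02 q)
      - b' * Y q * (1 - X q) * (w20 q - w11 q) + b * b' * XY q * \<phi> q = 0" if q: "q \<in> U" for q
  proof -
    have T: "XY q = X q * Y q" by (rule XY_eq_mult)
    note hX = thetas_X[OF r[OF q]] and hY = thetas_Y[OF r[OF q]] and hXY = thetas_XY[OF r[OF q]]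
    note hw = w[OF q]
    have z: "has_thetas (\<lambda>s. w20 s + (a - 1) * w10 s - X s * (b * \<phi> s + w20 s - w11 s)
       - XY s * (b * b' * w s + b * w01 s + b' * w10 s + w11 s)) 0 0 q"
      by (rule thetas_transform[OF thetas_const U(1) q]) (use e1 in simp)
    note d = thetas_diff[OF thetas_diff[OF thetas_add[OF hw(4) thetas_cmult[OF hw(2), of "a - 1"]]
        thetas_mult[OF hX thetas_diff[OF thetas_add[OF thetas_cmult[OF h\<phi>[OF q], of b] hw(4)] hw(5)]]]
        thetas_mult[OF hXY thetas_add[OF thetas_add[OF thetas_add[OF thetas_cmult[OF hw(1), of "b * b'"] thetas_cmult[OF hw(3), of b]]
          thetas_cmult[OF hw(2), of b']] hw(5)]]]
    from thetas_unique[OF d z r[OF q]] have d1: "w21 q + (a - 1) * w11 q - X q * (b * (w11 q - w02 q) + w21 q - w12 q)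
       - (XY q * (b * b' * w q + b * w01 q + b' * w10 q + w11 q)
         + XY q * (b * b' * w01 q + b * w02 q + b' * w11 q + w12 q)) = 0"
      by simp
    have z': "has_thetas (\<lambda>s. w02 s + (a - 1) * w01 s + Y s * (b' * \<phi> s + w11 s - w02 s)
       - XY s * (b * b' * w s + b * w01 s + b' * w10 s + w11 s)) 0 0 q"
      by (rule thetas_transform[OF thetas_const U(1) q]) (use e2 in simp)
    note d' = thetas_diff[OF thetas_add[OF thetas_add[OF hw(6) thetas_cmult[OF hw(3), of "a - 1"]]
        thetas_mult[OF hY thetas_diff[OF thetas_add[OF thetas_cmult[OF h\<phi>[OF q], of b'] hw(5)] hw(6)]]]
        thetas_mult[OF hXY thetas_add[OF thetas_add[OF thetas_add[OF thetas_cmult[OF hw(1), of "b * b'"] thetas_cmult[OF hw(3), of b]]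
          thetas_cmult[OF hw(2), of b']] hw(5)]]]
    from thetas_unique[OF d' z' r[OF q]] have d2: "w12 q + (a - 1) * w11 q + Y q * (b' * (w20 q - w11 q) + w21 q - w12 q)
       - (XY q * (b * b' * w q + b * w01 q + b' * w10 q + w11 q)
         + XY q * (b * b' * w10 q + b * w11 q + b' * w20 q + w21 q)) = 0"
      by simp
    show ?thesis
      using d1 d2 unfolding T \<phi>_def by algebra
  qed
  have XY1: "(1 - X q) * (1 - fst q) = 1" "(1 - Y q) * (1 - snd q) = 1" "X q * (1 - fst q) = - fst q" "Y q * (1 - snd q) = - snd q"
     if "q \<in> U" for q
    using r[OF that] by (auto simp: X_eq Y_eq field_simps)
  have h\<alpha>: "holomorphic2_on \<alpha> U" and h\<beta>: "holomorphic2_on \<beta> U"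
    unfolding \<alpha>_def \<beta>_def
    by (intro holomorphic2_on_diff holomorphic2_on_mult holomorphic2_on_const h2
        holomorphic2_on_subset[OF holomorphic2_X] holomorphic2_on_subset[OF holomorphic2_Y]
        holomorphic2_onI_thetas[OF h\<phi>]; use r in force)+
  show thesis
  proof (rule that)
    show "(1 - a) * (theta_x w q - theta_y w q) = \<alpha> q + \<beta> q" if "q \<in> U" for q
      using sum[OF that] by (simp add: \<phi>_def w10_def w01_def)
    fix q assume q: "q \<in> U"
    note hX = thetas_X[OF r[OF q]] and hY = thetas_Y[OF r[OF q]]
    have d\<alpha>: "theta_y \<alpha> q = (1 - X q) * (w21 q - w12 q) - b * (X q * (w11 q - w02 q))"
      unfolding \<alpha>_def
      using thetas_D[OF thetas_diff[OF thetas_mult[OF thetas_diff[OF thetas_const[of 1] hX] thetas_diff[OF w(4)[OF q] w(5)[OF q]]]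
         thetas_cmult[OF thetas_mult[OF hX h\<phi>[OF q]], of b]] r[OF q]] by simp
    have d\<beta>: "theta_x \<beta> q = (1 - Y q) * (w21 q - w12 q) - b' * (Y q * (w20 q - w11 q))"
      unfolding \<beta>_def
      using thetas_D[OF thetas_diff[OF thetas_mult[OF thetas_diff[OF thetas_const[of 1] hY] thetas_diff[OF w(5)[OF q] w(6)[OF q]]]
         thetas_cmult[OF thetas_mult[OF hY h\<phi>[OF q]], of b']] r[OF q]] by simp
    have z: "has_thetas (\<lambda>s. (1 - a) * \<phi> s - (\<alpha> s + \<beta> s)) 0 0 q"
      by (rule thetas_transform[OF thetas_const U(1) q]) (use sum in simp)
    note d = thetas_diff[OF thetas_cmult[OF h\<phi>[OF q], of "1 - a"]
        thetas_add[OF holomorphic2_on_thetas[OF h\<alpha> q r[OF q]] holomorphic2_on_thetas[OF h\<beta> q r[OF q]]]]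
    from thetas_unique[OF d z r[OF q]] have s: "(1 - a) * (w20 q - w11 q) = theta_x \<alpha> q + theta_x \<beta> q" "(1 - a) * (w11 q - w02 q) = theta_y \<alpha> q + theta_y \<beta> q"
      by simp_all
    have 1: "theta_y \<alpha> q = - b' * snd q * \<alpha> q"
      using mixed[OF q] d\<alpha> XY1(2,4)[OF q] unfolding \<alpha>_def XY_eq_mult by algebra
    have 2: "theta_x \<beta> q = - b * fst q * \<beta> q"
      using mixed[OF q] d\<beta> XY1(1,3)[OF q] unfolding \<beta>_def XY_eq_mult by algebra
    have 3: "theta_x \<alpha> q = (1 - a + (a - b - 1) * fst q) * \<alpha> q"
      using s(1) 2 sum[OF q] fun_cong[OF \<alpha>_def, of q] XY1(1,3)[OF q] by algebra
    have 4: "theta_y \<beta> q = (1 - a + (a - b' - 1) * snd q) * \<beta> q"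
      using s(2) 1 sum[OF q] fun_cong[OF \<beta>_def, of q] XY1(2,4)[OF q] by algebra
    show "has_thetas \<alpha> ((1 - a + (a - b - 1) * fst q) * \<alpha> q) (- b' * snd q * \<alpha> q) q"
      using holomorphic2_on_thetas[OF h\<alpha> q r[OF q]] 1 3 by simp
    show "has_thetas \<beta> (- b * fst q * \<beta> q) ((1 - a + (a - b' - 1) * snd q) * \<beta> q) q"
      using holomorphic2_on_thetas[OF h\<beta> q r[OF q]] 2 4 by simp
  qed
qed

text \<open>
  Off the axes \<open>(X, T)\<close> are local coordinates, with inverse \<open>x = X / (X - 1)\<close>, \<open>y = T / (T - X)\<close>, and
  \<open>\<theta> - \<theta>' = X d/dX\<close>. So \<open>w\<close> does not depend on \<open>X\<close>, and its restriction \<open>u\<close> to the slice through \<open>p\<close>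
  solves the Gauss equation because \<open>w\<close> solves the system along that slice.
\<close>

lemma remainder_is_pullback:
  assumes U: "open U" "p \<in> U" "U \<subseteq> generic" and w: "holomorphic2_on w U"
    and gauged_P: "\<And>q. q \<in> U \<Longrightarrow> gauged_P a b b' w q = 0" and eq: "\<And>q. q \<in> U \<Longrightarrow> theta_x w q = theta_y w q"
  shows "w \<in> pullback XY (S b b' a (XY p)) p"
proof -
  define F where "F = (\<lambda>r::complex \<times> complex. fst r / (fst r - 1))"
  define G where "G = (\<lambda>r::complex \<times> complex. snd r / (snd r - fst r))"
  define D where "D = {r::complex \<times> complex. fst r \<noteq> 1 \<and> fst r \<noteq> snd r \<and> fst r \<noteq> 0}"
  have D: "open D"
    unfolding D_def by (intro open_Collect_conj open_Collect_neq continuous_intros)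
  have hF: "has_partials F (- 1 / (fst r - 1)\<^sup>2) 0 r" and hG: "has_partials G (snd r / (snd r - fst r)\<^sup>2) (- fst r / (snd r - fst r)\<^sup>2) r"
    if "r \<in> D" for r
  proof -
    have n: "fst r - 1 \<noteq> 0" "snd r - fst r \<noteq> 0" using that by (auto simp: D_def)
    show "has_partials F (- 1 / (fst r - 1)\<^sup>2) 0 r"
      unfolding F_def by (rule partials_eq[OF partials_divide[OF partials_fst partials_diff[OF partials_fst partials_const] n(1)]]) simp_all
    show "has_partials G (snd r / (snd r - fst r)\<^sup>2) (- fst r / (snd r - fst r)\<^sup>2) r"
      unfolding G_def by (rule partials_eq[OF partials_divide[OF partials_snd partials_diff[OF partials_snd partials_fst] n(2)]]) simp_all
  qed
  have inv: "F (X q, XY q) = fst q" "G (X q, XY q) = snd q" "(X q, XY q) \<in> D" if "q \<in> generic" for q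
    using that unfolding F_def G_def D_def X_eq XY_eq by (auto simp: divide_simps) (auto simp: algebra_simps)
  have FG: "X (F r, G r) = fst r" "XY (F r, G r) = snd r" if "r \<in> D" for r
    using that unfolding F_def G_def D_def X_eq XY_eq by (auto simp: divide_simps)
  have "continuous_on D (\<lambda>r. (F r, G r))"
    by (intro continuous_on_Pair holomorphic2_on_continuous holomorphic2_onI[OF hF] holomorphic2_onI[OF hG])
  then have "open (D \<inter> (\<lambda>r. (F r, G r)) -` U)"
    using D U(1) by (rule continuous_open_preimage)
  moreover have "(X p, XY p) \<in> D \<inter> (\<lambda>r. (F r, G r)) -` U"
    using inv[of p] U by auto
  ultimately obtain A B where AB: "open A" "open B" "(X p, XY p) \<in> A \<times> B" "A \<times> B \<subseteq> D \<inter> (\<lambda>r. (F r, G r)) -` U"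
    by (rule open_prod_elim)
  then obtain e where e: "e > 0" "ball (X p) e \<subseteq> A"
    by (metis SigmaE2 open_contains_ball)
  let ?N = "ball (X p) e \<times> B"
  have N: "(F r, G r) \<in> U" "r \<in> D" if "r \<in> ?N" for r
    using that e(2) AB(4) by auto
  have XpN: "(X p, t) \<in> ?N" if "t \<in> B" for t using that e by simp
  define h where "h = (\<lambda>r. w (F r, G r))"
  have hh: "has_partials h 0 (dy w (F r, G r) * (- fst r / (snd r - fst r)\<^sup>2)) r" if "r \<in> ?N" for r
  proof (unfold h_def, rule partials_eq[OF partials_chain2[OF holomorphic2_on_partials[OF w N(1)[OF that]] hF[OF N(2)[OF that]] hG[OF N(2)[OF that]]]])
    have n: "fst r \<noteq> 1" "snd r - fst r \<noteq> 0" "fst r \<noteq> 0" using N(2)[OF that] by (auto simp: D_def)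
    have 1: "- 1 / (fst r - 1)\<^sup>2 = F r * (1 - F r) / fst r"
      using n by (simp add: F_def divide_simps power2_eq_square)
    have 2: "snd r / (snd r - fst r)\<^sup>2 = - (G r * (1 - G r)) / fst r"
      using n by (simp add: G_def divide_simps power2_eq_square)
    have "dx w (F r, G r) * (- 1 / (fst r - 1)\<^sup>2) + dy w (F r, G r) * (snd r / (snd r - fst r)\<^sup>2)
       = (theta_x w (F r, G r) - theta_y w (F r, G r)) / fst r"
      unfolding 1 2 theta_x_def theta_y_def using n by (simp add: field_simps)
    then show "dx w (F r, G r) * (- 1 / (fst r - 1)\<^sup>2) + dy w (F r, G r) * (snd r / (snd r - fst r)\<^sup>2) = 0"
      using eq[OF N(1)[OF that]] by simp
  qed simp
  define u where "u = (\<lambda>t. h (X p, t))"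
  have hu: "h (x, t) = u t" if "x \<in> ball (X p) e" "t \<in> B" for x t
  proof -
    have "((\<lambda>x. h (x, t)) has_field_derivative 0) (at x within ball (X p) e)" if "x \<in> ball (X p) e" for x
      using partials_slices(1)[OF hh, of "(x, t)"] that \<open>t \<in> B\<close> by (auto intro: has_field_derivative_at_within)
    from has_field_derivative_zero_constant[OF convex_ball this]
    obtain c where "\<And>x. x \<in> ball (X p) e \<Longrightarrow> h (x, t) = c" by blast
    then show ?thesis using that(1) e(1) by (simp add: u_def)
  qed
  have "u holomorphic_on B"
    unfolding u_def holomorphic_on_def field_differentiable_def
  proof
    fix t assume "t \<in> B"
    from partials_slices(2)[OF hh[OF XpN[OF this]]]
    show "\<exists>f'. ((\<lambda>t. h (X p, t)) has_field_derivative f') (at t within B)"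
      by (auto intro: has_field_derivative_at_within)
  qed
  define W where "W = U \<inter> (\<lambda>q. (X q, XY q)) -` ?N"
  have "continuous_on U (\<lambda>q. (X q, XY q))"
    using U(3) by (intro continuous_on_Pair holomorphic2_on_continuous
        holomorphic2_on_subset[OF holomorphic2_X] holomorphic2_on_subset[OF holomorphic2_XY]) auto
  then have W: "open W"
    unfolding W_def using U(1) AB(2) by (intro continuous_open_preimage) (auto simp: open_Times)
  have pW: "p \<in> W" using U(2) AB(3) XpN by (auto simp: W_def)
  have wu: "w q = u (XY q)" if "q \<in> W" for q
  proof -
    have "q \<in> generic" "(X q, XY q) \<in> ?N" using that U(3) by (auto simp: W_def)
    then show ?thesis using hu[of "X q" "XY q"] inv(1,2)[of q] by (simp add: h_def)
  qed
  have "gauss_op b b' a u t = 0" if t: "t \<in> B" for t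
  proof -
    define q where "q = (F (X p, t), G (X p, t))"
    have qU: "q \<in> U" and D': "(X p, t) \<in> D" using N[OF XpN[OF t]] by (auto simp: q_def)
    have XYq: "XY q = t" and "X q = X p" using FG[OF D'] by (simp_all add: q_def)
    then have qW: "q \<in> W" using qU XpN[OF t] by (simp add: W_def)
    have "gauged_P a b b' w q = gauged_P a b b' (\<lambda>q. u (XY q)) q"
      by (rule gauged_cong_open(1)[OF W qW wu])
    also have "\<dots> = gauss_op b b' a u (XY q)"
      by (rule gauged_P_pullback[OF AB(2) \<open>u holomorphic_on B\<close> W _ _ qW]) (use U(3) in \<open>auto simp: W_def\<close>)
    finally show ?thesis using gauged_P[OF qU] XYq by simp
  qed
  then have "u \<in> S b b' a (XY p)"
    unfolding S_def using AB(2,3) \<open>u holomorphic_on B\<close> by blast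
  moreover have "\<forall>\<^sub>F q in nhds p. w q = u (XY q)"
    using W pW wu by (auto simp: eventually_nhds)
  ultimately show ?thesis by (auto simp: pullback_def)
qed

text \<open>
  The points of \<open>U\<close> lie off the axes on their own account: the logarithms at the two ends of the path exist only if
  \<open>X \<noteq> 0\<close> and \<open>T \<noteq> 0\<close>.
\<close>

lemma integral_branch_solution:
  assumes p: "p \<in> domain_XY" and F: "integral_branch (b' - a) (a - b - 1) (- b') F p"
    and adm: "b' - a + 1 \<notin> \<int>\<^sub>\<le>\<^sub>0"
  obtains U \<phi> where "open U" "p \<in> U" "U \<subseteq> generic" "holomorphic2_on F U"
    "\<And>q. q \<in> U \<Longrightarrow> gauged_P a b b' F q = 0 \<and> gauged_Q a b b' F q = 0"
    "\<And>q. q \<in> U \<Longrightarrow> theta_x F q - theta_y F q = \<phi> q"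
    "\<And>q. q \<in> U \<Longrightarrow> \<phi> q \<noteq> 0"
    "\<And>q. q \<in> U \<Longrightarrow> has_thetas \<phi> ((1 - a + (a - b - 1) * fst q) * \<phi> q) (- b' * snd q * \<phi> q) q"
proof -
  obtain U0 \<tau> l0 l1 l2 where U0: "open U0" "p \<in> U0"
    and \<tau>: "\<tau> C1_differentiable_on {0..1}" "\<tau> 0 = 0" "\<tau> 1 = 1" "vector_derivative \<tau> (at 0) \<noteq> 0"
    and cont: "continuous_on (U0 \<times> {0<..1}) (\<lambda>(q, t). l0 q t)"
      "continuous_on (U0 \<times> {0..1}) (\<lambda>(q, t). l1 q t)" "continuous_on (U0 \<times> {0..1}) (\<lambda>(q, t). l2 q t)"
    and l0': "\<forall>q\<in>U0. \<forall>t\<in>{0<..1}. exp (l0 q t) = X q * \<tau> t"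
    and l1': "\<forall>q\<in>U0. \<forall>t\<in>{0..1}. exp (l1 q t) = 1 - X q * \<tau> t"
    and l2': "\<forall>q\<in>U0. \<forall>t\<in>{0..1}. exp (l2 q t) = XY q - X q * \<tau> t"
    and F': "\<forall>q\<in>U0. F q = reg_integral (\<lambda>t. X q * \<tau> t) (l0 q) (l1 q) (l2 q) (b' - a) (a - b - 1) (- b')"
    using F unfolding integral_branch_def by (elim exE conjE) (rule that)
  have l0: "exp (l0 q t) = X q * \<tau> t" if "q \<in> U0" "t \<in> {0<..1}" for q t
    using l0' that by blast
  have l1: "exp (l1 q t) = 1 - X q * \<tau> t" and l2: "exp (l2 q t) = XY q - X q * \<tau> t"
    if "q \<in> U0" "t \<in> {0..1}" for q t
    using l1' l2' that by blast+
  have F: "F q = reg_integral (\<lambda>t. X q * \<tau> t) (l0 q) (l1 q) (l2 q) (b' - a) (a - b - 1) (- b')" if "q \<in> U0" for q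
    using F' that by blast
  define U where "U = U0 \<inter> domain_XY"
  have nbhd: "open U" "p \<in> U" "U \<subseteq> U0" using U0 p open_domain_XY by (auto simp: U_def)
  have ram: "U \<subseteq> generic"
  proof
    fix q assume q: "q \<in> U"
    have "X q \<noteq> 0" using l0[of q 1] q nbhd(3) \<tau>(3) by (metis exp_not_eq_zero greaterThanAtMost_iff mult_zero_left order_refl subsetD zero_less_one)
    moreover have "XY q \<noteq> 0" using l2[of q 0] q nbhd(3) \<tau>(2) exp_not_eq_zero[of "l2 q 0"] by auto
    ultimately show "q \<in> generic" using q by (auto simp: U_def X_eq XY_eq)
  qed
  interpret integration_path U \<tau> "\<lambda>t. vector_derivative \<tau> (at t)" l0 l1 l2
  proof
    show "(\<tau> has_vector_derivative vector_derivative \<tau> (at t)) (at t)" if "t \<in> {0..1}" for t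
      using \<tau>(1) that by (simp add: C1_differentiable_on_eq vector_derivative_works[symmetric])
    show "continuous_on {0..1} (\<lambda>t. vector_derivative \<tau> (at t))"
      using \<tau>(1) by (simp add: C1_differentiable_on_eq)
    show "continuous_on (U \<times> {0<..1}) (\<lambda>(q, t). l0 q t)" "continuous_on (U \<times> {0..1}) (\<lambda>(q, t). l1 q t)"
      "continuous_on (U \<times> {0..1}) (\<lambda>(q, t). l2 q t)"
      using cont nbhd(3) by (auto elim: continuous_on_subset)
  qed (use nbhd ram \<tau> l0 l1 l2 in auto)
  let ?euler = "euler (b' - a) (a - b - 1) (- b')"
  have FJ: "?euler q = F q" if "q \<in> U" for q
    using F[of q] reg_integral_eq_euler[OF adm that] that nbhd(3) by auto
  show thesis
  proof (rule that[OF nbhd(1,2) ram, of "end_value (b' - a + 1) (a - b - 1) (- b')"])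
    show "holomorphic2_on F U"
      by (rule holomorphic2_on_cong[OF holomorphic2_euler[OF adm] nbhd(1) FJ])
    fix q assume q: "q \<in> U"
    show "gauged_P a b b' F q = 0 \<and> gauged_Q a b b' F q = 0"
    proof -
      have "gauged_P a b b' ?euler q = gauged_P a b b' F q" "gauged_Q a b b' ?euler q = gauged_Q a b b' F q"
        by (rule gauged_cong_open[OF nbhd(1) q], erule FJ)+
      then show ?thesis using euler_solves[OF adm q, of b] by simp
    qed
    show "theta_x F q - theta_y F q = end_value (b' - a + 1) (a - b - 1) (- b') q"
    proof -
      have "theta_x ?euler q = theta_x F q" "theta_y ?euler q = theta_y F q"
        by (rule theta_x_cong_open[OF nbhd(1) q] theta_y_cong_open[OF nbhd(1) q], erule FJ)+
      then show ?thesis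
        unfolding diff_eq_eq using theta_euler(2)[OF adm q, of "a - b - 1" "- b'"] by (simp add: add.commute)
    qed
    show "end_value (b' - a + 1) (a - b - 1) (- b') q \<noteq> 0" by (rule end_value_nonzero)
    show "has_thetas (end_value (b' - a + 1) (a - b - 1) (- b')) ((1 - a + (a - b - 1) * fst q) * end_value (b' - a + 1) (a - b - 1) (- b') q)
       (- b' * snd q * end_value (b' - a + 1) (a - b - 1) (- b') q) q"
      by (rule thetas_eq[OF thetas_end_value_xy[OF q]]) simp_all
  qed
qed

text \<open>
  The exponents of \<open>F\<close> are those of the first integral for the parameters \<open>(2 - a, b - a + 1, b' - a + 1)\<close>.
\<close>

lemma second_solution:
  assumes p: "p \<in> generic" and K: "log_branch K XY p" and F: "integral_branch (b' - 1) (- b) (a - b' - 1) F p"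
    and adm: "b' \<notin> \<int>\<^sub>\<le>\<^sub>0" and f_def: "f = (\<lambda>q. exp ((1 - a) * K q) * F q)"
  obtains U \<phi> where "open U" "p \<in> U" "U \<subseteq> generic" "holomorphic2_on f U"
    "\<And>q. q \<in> U \<Longrightarrow> gauged_P a b b' f q = 0 \<and> gauged_Q a b b' f q = 0"
    "\<And>q. q \<in> U \<Longrightarrow> theta_x f q - theta_y f q = \<phi> q"
    "\<And>q. q \<in> U \<Longrightarrow> \<phi> q \<noteq> 0"
    "\<And>q. q \<in> U \<Longrightarrow> has_thetas \<phi> (- b * fst q * \<phi> q) ((1 - a + (a - b' - 1) * snd q) * \<phi> q) q"
proof -
  have par: "b' - a + 1 - (2 - a) = b' - 1" "2 - a - (b - a + 1) - 1 = - b" "- (b' - a + 1) = a - b' - 1"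
    "b' - a + 1 - (2 - a) + 1 = b'" by simp_all
  obtain U1 \<phi> where U1: "open U1" "p \<in> U1" "U1 \<subseteq> generic" "holomorphic2_on F U1"
    "\<And>q. q \<in> U1 \<Longrightarrow> gauged_P (2 - a) (b - a + 1) (b' - a + 1) F q = 0 \<and> gauged_Q (2 - a) (b - a + 1) (b' - a + 1) F q = 0"
    "\<And>q. q \<in> U1 \<Longrightarrow> theta_x F q - theta_y F q = \<phi> q"
    "\<And>q. q \<in> U1 \<Longrightarrow> \<phi> q \<noteq> 0"
    "\<And>q. q \<in> U1 \<Longrightarrow> has_thetas \<phi> ((1 - (2 - a) + (2 - a - (b - a + 1) - 1) * fst q) * \<phi> q) (- (b' - a + 1) * snd q * \<phi> q) q"
    by (rule integral_branch_solution[of p "b' - a + 1" "2 - a" "b - a + 1" F], unfold par)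
      (use p F adm in \<open>auto intro: that\<close>)
  obtain U2 where U2: "open U2" "p \<in> U2" "\<And>q. q \<in> U2 \<Longrightarrow> exp (K q) = XY q"
    "\<And>q A B. q \<in> U2 \<Longrightarrow> has_partials XY A B q \<Longrightarrow> has_partials K (A / XY q) (B / XY q) q"
    by (rule log_branch_partials[OF K], rule that)
  define U where "U = U1 \<inter> U2"
  have U: "open U" "p \<in> U" "U \<subseteq> generic" "U \<subseteq> U1" using U1 U2 by (auto simp: U_def)
  have hK: "has_thetas K 1 1 q" if "q \<in> U" for q
  proof -
    have q: "q \<in> U1" "q \<in> U2" "q \<in> generic" using that U by (auto simp: U_def)
    have "XY q \<noteq> 0" using q(3) by (auto simp: XY_eq)
    then show ?thesis
      using U2(4)[OF q(2) thetas_XY[OF q(3), unfolded has_thetas_def]] by (simp add: has_thetas_def)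
  qed
  have FU: "holomorphic2_on F U" by (rule holomorphic2_on_subset[OF U1(4) U(4)])
  have \<phi>U: "holomorphic2_on \<phi> U"
    by (rule holomorphic2_on_subset[OF holomorphic2_onI_thetas[OF U1(8)] U(4)])
  note tw = power_T_mult[OF U(1,3) hK FU, where a=a, folded f_def]
  show thesis
  proof (rule that[OF U(1,2,3), of "\<lambda>q. exp ((1 - a) * K q) * \<phi> q"])
    show "holomorphic2_on f U" by (rule tw(1)[OF _ U(2)])
    fix q assume q: "q \<in> U"
    have q1: "q \<in> U1" and r: "q \<in> generic" using q U by auto
    show "gauged_P a b b' f q = 0 \<and> gauged_Q a b b' f q = 0"
      using tw(3,4)[OF _ q] U1(5)[OF q1] by simp
    show "theta_x f q - theta_y f q = exp ((1 - a) * K q) * \<phi> q"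
      using tw(2)[OF _ q] U1(6)[OF q1] by simp
    show "exp ((1 - a) * K q) * \<phi> q \<noteq> 0" using U1(7)[OF q1] by simp
    have t: "theta_x \<phi> q = (1 - (2 - a) + (2 - a - (b - a + 1) - 1) * fst q) * \<phi> q" "theta_y \<phi> q = - (b' - a + 1) * snd q * \<phi> q"
      using thetas_D[OF U1(8)[OF q1] r] by auto
    show "has_thetas (\<lambda>q. exp ((1 - a) * K q) * \<phi> q) (- b * fst q * (exp ((1 - a) * K q) * \<phi> q))
       ((1 - a + (a - b' - 1) * snd q) * (exp ((1 - a) * K q) * \<phi> q)) q"
      by (rule thetas_eq[OF thetas_power_mult[OF U(1,3) hK \<phi>U q]]) (simp_all add: t algebra_simps)
  qed
qed

lemma S_subset_gauged:
  "p \<in> domain_XY \<Longrightarrow> pullback XY (S b b' a (XY p)) p \<subseteq> gauged_solutions a b b' p"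
  using S_subset_S1_XT S1_XT_subset_gauged by (rule subset_trans)

text \<open>
  The difference \<open>\<theta> w - \<theta>' w\<close> of a solution is a combination of those of \<open>f1\<close> and \<open>f2\<close>; the coefficients are divided
  by \<open>1 - a\<close>, whence \<open>a \<noteq> 1\<close>.
\<close>

lemma gauged_solutions_eq_span:
  assumes p: "p \<in> generic" and a: "a \<noteq> 1" and adm: "b' - a + 1 \<notin> \<int>\<^sub>\<le>\<^sub>0" "b' \<notin> \<int>\<^sub>\<le>\<^sub>0"
    and K: "log_branch K XY p"
    and F1: "integral_branch (b' - a) (a - b - 1) (- b') f1 p"
    and F2: "integral_branch (b' - 1) (- b) (a - b' - 1) F2 p"
    and f2: "f2 = (\<lambda>q. exp ((1 - a) * K q) * F2 q)"
  shows "gauged_solutions a b b' p = module.span (\<lambda>c f q. c * f q) ({f1, f2} \<union> pullback XY (S b b' a (XY p)) p)"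
proof -
  interpret fun_space: module "\<lambda>(c::complex) (f::complex \<times> complex \<Rightarrow> complex) q. c * f q"
    by unfold_locales (auto simp: fun_eq_iff algebra_simps)
  have preg: "p \<in> domain_XY" using p by simp
  obtain U1 \<phi>1 where U1: "open U1" "p \<in> U1" "U1 \<subseteq> generic" "holomorphic2_on f1 U1"
    and eq1: "\<And>q. q \<in> U1 \<Longrightarrow> gauged_P a b b' f1 q = 0 \<and> gauged_Q a b b' f1 q = 0"
    and d1: "\<And>q. q \<in> U1 \<Longrightarrow> theta_x f1 q - theta_y f1 q = \<phi>1 q"
    and n1: "\<And>q. q \<in> U1 \<Longrightarrow> \<phi>1 q \<noteq> 0"
    and h1: "\<And>q. q \<in> U1 \<Longrightarrow> has_thetas \<phi>1 ((1 - a + (a - b - 1) * fst q) * \<phi>1 q) (- b' * snd q * \<phi>1 q) q"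
    by (rule integral_branch_solution[OF preg F1 adm(1)], rule that)
  obtain U2 \<phi>2 where U2: "open U2" "p \<in> U2" "U2 \<subseteq> generic" "holomorphic2_on f2 U2"
    and eq2: "\<And>q. q \<in> U2 \<Longrightarrow> gauged_P a b b' f2 q = 0 \<and> gauged_Q a b b' f2 q = 0"
    and d2: "\<And>q. q \<in> U2 \<Longrightarrow> theta_x f2 q - theta_y f2 q = \<phi>2 q"
    and n2: "\<And>q. q \<in> U2 \<Longrightarrow> \<phi>2 q \<noteq> 0"
    and h2: "\<And>q. q \<in> U2 \<Longrightarrow> has_thetas \<phi>2 (- b * fst q * \<phi>2 q) ((1 - a + (a - b' - 1) * snd q) * \<phi>2 q) q"
    by (rule second_solution[OF p K F2 adm(2) f2], rule that)
  have sol: "f1 \<in> gauged_solutions a b b' p" "f2 \<in> gauged_solutions a b b' p"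
    unfolding gauged_solutions_def using U1 eq1 U2 eq2 by blast+
  let ?G = "{f1, f2} \<union> pullback XY (S b b' a (XY p)) p"
  show ?thesis
  proof (intro equalityI)
    have zero: "0 \<in> gauged_solutions a b b' p"
      using gauged_solutions_diff[OF sol(1,1), of 1] by (simp add: zero_fun_def)
    have scale: "(\<lambda>q. c * f q) \<in> gauged_solutions a b b' p" if "f \<in> gauged_solutions a b b' p" for c f
      using gauged_solutions_diff[OF zero that, of "- c"] by simp
    have add: "f + g \<in> gauged_solutions a b b' p" if "f \<in> gauged_solutions a b b' p" "g \<in> gauged_solutions a b b' p" for f g
      using gauged_solutions_diff[OF that, of "- 1"] by (simp add: plus_fun_def)
    show "fun_space.span ?G \<subseteq> gauged_solutions a b b' p"
      by (rule fun_space.span_minimal)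
        (use sol S_subset_gauged[OF preg] zero scale add in \<open>auto simp: fun_space.subspace_def\<close>)
    show "gauged_solutions a b b' p \<subseteq> fun_space.span ?G"
    proof
      fix w assume "w \<in> gauged_solutions a b b' p"
      then obtain V where V: "open V" "p \<in> V" "holomorphic2_on w V"
        and eqw: "\<And>q. q \<in> V \<Longrightarrow> gauged_P a b b' w q = 0 \<and> gauged_Q a b b' w q = 0"
        unfolding gauged_solutions_def by blast
      have "open (U1 \<inter> U2 \<inter> V)" "p \<in> U1 \<inter> U2 \<inter> V" using U1 U2 V by auto
      then obtain e where e: "e > 0" "ball p e \<subseteq> U1 \<inter> U2 \<inter> V"
        using open_contains_ball by blast
      define B where "B = ball p e"
      have B: "open B" "convex B" "p \<in> B" "B \<subseteq> U1" "B \<subseteq> U2" "B \<subseteq> V" "B \<subseteq> generic"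
        using e U1(3) by (auto simp: B_def)
      have hol: "holomorphic2_on w B" "holomorphic2_on f1 B" "holomorphic2_on f2 B"
        using V(3) U1(4) U2(4) B holomorphic2_on_subset by blast+
      obtain \<alpha> \<beta> where \<alpha>\<beta>: "\<And>q. q \<in> B \<Longrightarrow> (1 - a) * (theta_x w q - theta_y w q) = \<alpha> q + \<beta> q"
        "\<And>q. q \<in> B \<Longrightarrow> has_thetas \<alpha> ((1 - a + (a - b - 1) * fst q) * \<alpha> q) (- b' * snd q * \<alpha> q) q"
        "\<And>q. q \<in> B \<Longrightarrow> has_thetas \<beta> (- b * fst q * \<beta> q) ((1 - a + (a - b' - 1) * snd q) * \<beta> q) q"
        by (rule difference_splits[OF B(1,7) hol(1), of a b b'], use eqw B(6) in blast, rule that)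
      obtain k1 where k1: "\<And>q. q \<in> B \<Longrightarrow> \<alpha> q = k1 * \<phi>1 q"
        by (rule constant_quotient[OF B(1,2,7,3) \<alpha>\<beta>(2) h1[OF subsetD[OF B(4)]] n1[OF subsetD[OF B(4)]]], assumption+, rule that)
      obtain k2 where k2: "\<And>q. q \<in> B \<Longrightarrow> \<beta> q = k2 * \<phi>2 q"
        by (rule constant_quotient[OF B(1,2,7,3) \<alpha>\<beta>(3) h2[OF subsetD[OF B(5)]] n2[OF subsetD[OF B(5)]]], assumption+, rule that)
      define c1 c2 where "c1 = k1 / (1 - a)" and "c2 = k2 / (1 - a)"
      define v where "v = (\<lambda>q. w q - c1 * f1 q)"
      define u where "u = (\<lambda>q. v q - c2 * f2 q)"
      have hv: "holomorphic2_on v B" unfolding v_def by (intro holomorphic2_on_diff holomorphic2_on_cmult hol)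
      have hu: "holomorphic2_on u B" unfolding u_def by (intro holomorphic2_on_diff holomorphic2_on_cmult hol hv)
      note lv = gauged_linear[OF B(1) hol(1,2), where c=c1, folded v_def]
      note lu = gauged_linear[OF B(1) hv hol(3), where c=c2, folded u_def]
      have "u \<in> pullback XY (S b b' a (XY p)) p"
      proof (rule remainder_is_pullback[OF B(1,3,7) hu])
        fix q assume q: "q \<in> B"
        then have qs: "q \<in> U1" "q \<in> U2" "q \<in> V" using B by auto
        show "gauged_P a b b' u q = 0"
          unfolding lu(3)[OF q] lv(3)[OF q] using eq1[OF qs(1)] eq2[OF qs(2)] eqw[OF qs(3)] by simp
        have "k1 = (1 - a) * c1" "k2 = (1 - a) * c2" using a by (simp_all add: c1_def c2_def)
        then have "(1 - a) * (theta_x w q - theta_y w q) = (1 - a) * (c1 * \<phi>1 q + c2 * \<phi>2 q)"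
          using \<alpha>\<beta>(1)[OF q] k1[OF q] k2[OF q] by algebra
        then have "theta_x w q - theta_y w q = c1 * \<phi>1 q + c2 * \<phi>2 q"
          using a by simp
        then show "theta_x u q = theta_y u q"
          unfolding lu(1,2)[OF q] lv(1,2)[OF q] d1[OF qs(1), symmetric] d2[OF qs(2), symmetric]
          by (simp add: algebra_simps)
      qed
      then have span: "f1 \<in> fun_space.span ?G" "f2 \<in> fun_space.span ?G" "u \<in> fun_space.span ?G"
        by (auto intro: fun_space.span_base)
      have "w = u + (\<lambda>q. c1 * f1 q) + (\<lambda>q. c2 * f2 q)"
        by (simp add: u_def v_def plus_fun_def)
      then show "w \<in> fun_space.span ?G"
        using span by (auto intro: fun_space.span_add fun_space.span_scale)
    qed
  qed
qed

theorem theorem2p4: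
  fixes a b b' x y :: complex and L L' :: "complex \<times> complex \<Rightarrow> complex"
  defines "p \<equiv> (x, y)"
  assumes "x \<noteq> 1" "y \<noteq> 1"
    and "log_branch L (\<lambda>(x, y). 1 - x) p" "log_branch L' (\<lambda>(x, y). 1 - y) p"
  shows
    "(multiples (\<lambda>q. exp (b' * L' q) * exp (b * L q)) (S2 a b b' a a p) p
        \<supseteq> pullback (\<lambda>q. (X q, XY q)) (S1 b 0 b' a (X p, XY p)) p
    \<and> pullback (\<lambda>q. (X q, XY q)) (S1 b 0 b' a (X p, XY p)) p
        \<supseteq> pullback XY (S b b' a (XY p)) p
    \<and> multiples (\<lambda>q. exp (b' * L' q) * exp (b * L q)) (S2 a b b' a a p) p
        \<supseteq> pullback (\<lambda>q. (XY q, Y q)) (S1 b' b 0 a (XY p, Y p)) p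
    \<and> pullback (\<lambda>q. (XY q, Y q)) (S1 b' b 0 a (XY p, Y p)) p
        \<supseteq> pullback XY (S b b' a (XY p)) p)
    \<and> (\<forall>K f1 F2 f2.
        x \<noteq> 0 \<longrightarrow> y \<noteq> 0 \<longrightarrow> x + y \<noteq> 1 \<longrightarrow>
        a \<noteq> 1 \<longrightarrow> b' - a + 1 \<notin> \<int>\<^sub>\<le>\<^sub>0 \<longrightarrow> b' \<notin> \<int>\<^sub>\<le>\<^sub>0 \<longrightarrow>
        log_branch K XY p \<longrightarrow>
        integral_branch (b' - a) (a - b - 1) (- b') f1 p \<longrightarrow>
        integral_branch (b' - 1) (- b) (a - b' - 1) F2 p \<longrightarrow>
        f2 = (\<lambda>q. exp ((1 - a) * K q) * F2 q) \<longrightarrow>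
        multiples (\<lambda>q. exp (b' * L' q) * exp (b * L q)) (S2 a b b' a a p) p
          = module.span (\<lambda>c f q. c * f q) ({f1, f2} \<union> pullback XY (S b b' a (XY p)) p))"
proof -
  have p: "p \<in> domain_XY" using assms(2,3) by (simp add: p_def)
  note gauge = multiples_S2_eq_gauged[OF assms(4,5) refl]
  show ?thesis
    unfolding gauge
  proof (intro conjI allI impI)
    show "pullback (\<lambda>q. (X q, XY q)) (S1 b 0 b' a (X p, XY p)) p \<subseteq> gauged_solutions a b b' p"
      by (rule S1_XT_subset_gauged[OF p])
    show "pullback (\<lambda>q. (XY q, Y q)) (S1 b' b 0 a (XY p, Y p)) p \<subseteq> gauged_solutions a b b' p"
      by (rule S1_TY_subset_gauged[OF p])
    show "pullback XY (S b b' a (XY p)) p \<subseteq> pullback (\<lambda>q. (X q, XY q)) (S1 b 0 b' a (X p, XY p)) p"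
      by (rule S_subset_S1_XT)
    show "pullback XY (S b b' a (XY p)) p \<subseteq> pullback (\<lambda>q. (XY q, Y q)) (S1 b' b 0 a (XY p, Y p)) p"
      by (rule S_subset_S1_TY)
    fix K f1 F2 f2
    assume "x \<noteq> 0" "y \<noteq> 0" "x + y \<noteq> 1" "a \<noteq> 1" "b' - a + 1 \<notin> \<int>\<^sub>\<le>\<^sub>0" "b' \<notin> \<int>\<^sub>\<le>\<^sub>0" "log_branch K XY p"
      "integral_branch (b' - a) (a - b - 1) (- b') f1 p" "integral_branch (b' - 1) (- b) (a - b' - 1) F2 p"
      "f2 = (\<lambda>q. exp ((1 - a) * K q) * F2 q)"
    moreover from this have "p \<in> generic" using assms(2,3) by (simp add: p_def)
    ultimately show "gauged_solutions a b b' p = module.span (\<lambda>c f q. c * f q) ({f1, f2} \<union> pullback XY (S b b' a (XY p)) p)"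
      by (intro gauged_solutions_eq_span)
  qed
qed

end
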